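(* Let $f,\bar y\in L^2(\Gamma)$ and $\beta>0$ be arbitrary. Let $(u,y)\in\mathbb{R}^{n_D}\times H^1(\Gamma)$ be the solution of the continuous optimal control problem (P) and let $(u_h,y_h)\in\mathbb{R}^{n_D}\times V_h$ be the solution of the discretized optimal control problem (P$_h$), both defined in the context, and let $p$ be the adjoint state corresponding to $(u,y)$. Then $$|u-u_h|_2+\|y-y_h\|_{H^1(\Gamma)}\le c\,h\left(|y|_{H^2(\Gamma)}+|p|_{H^2(\Gamma)}\right)$$ with a constant $c>0$ independent of $h$ (and of $f,\bar y$ and the functions $u,u_h,y,y_h,p$ appearing in the estimate; it may depend on the metric graph, on $\mathcal V_D$, on $c_0$ and on $\beta$).
   Context: Metric graph: $G=(\mathcal V,\mathcal E)$ is a finite undirected graph; each edge $e\in\mathcal E$ joins two vertices and is identified with an interval $(0,L_e)$, $L_e>0$. $\Gamma$ denotes the resulting metric graph. The vertex set is split as $\mathcal V=\mathcal V_K\cup\mathcal V_D$ (disjoint), $n_D=|\mathcal V_D|$; vectors in $\mathbb R^{n_D}$ are indexed by $v\in\mathcal V_D$, and $|\cdot|_2$ is the Euclidean norm. Spaces: $L^2(\Gamma)=\prod_{e}L^2(e)$ with $(f,g)_{L^2(\Gamma)}=\sum_e\int_e fg\,dx$; $L^\infty(\Gamma)=\prod_e L^\infty(e)$; $H^1(\Gamma)$ is the set of $y\in\prod_e H^1(e)$ that are continuous on $\Gamma$ (values from all incident edges agree at each vertex), with $\|y\|_{H^1(\Gamma)}^2=\|y\|_{L^2(\Gamma)}^2+\sum_e\|y'\|_{L^2(e)}^2$;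 $H^1_D(\Gamma)=\{y\in H^1(\Gamma): y(v)=0\ \forall v\in\mathcal V_D\}$; $H^2(\Gamma)$ is the set of $y\in H^1(\Gamma)$ with $y|_e\in H^2(e)$ for all $e$, with seminorm $|y|_{H^2(\Gamma)}^2=\sum_e\|y''\|_{L^2(e)}^2$. Bilinear form: $c_0\in L^\infty(\Gamma)$, $c_0\ge0$ a.e., and $a(y,w)=\sum_{e}\int_e(y'w'+c_0\,y\,w)\,dx$. Standing assumption: $a$ is coercive on $H^1_D(\Gamma)$ (this holds e.g. if $G$ is connected and $\mathcal V_D\ne\emptyset$). (P): minimize $\frac12\|y-\bar y\|_{L^2(\Gamma)}^2+\frac\beta2|u|_2^2$ over $u\in\mathbb R^{n_D}$, $y\in H^1(\Gamma)$ subject to $y(v)=u_v$ for $v\in\mathcal V_D$ and $a(y,w)=(f,w)_{L^2(\Gamma)}$ for all $w\in H^1_D(\Gamma)$. It has a unique solution $(u,y)$. The corresponding adjoint state is the $p\in H^1_D(\Gamma)$ with $a(w,p)=(y-\bar y,w)_{L^2(\Gamma)}$ for all $w\in H_D^1(\Gamma)$. (Both $y$ and $p$ belong to $H^2(\Gamma)$.) Discretization: each edge $e$ carries an equidistant grid of $n_e\ge1$ subintervals, whose first and last grid points are the endpoints of $e$; $h>0$ is the maximal length of all subintervals over all edges. $V_h$ is the space of continuous functions on $\Gamma$ that are affine on each subinterval, and $V_{h,D}=V_h\cap H^1_D(\Gamma)$. (P$_h$): minimize $\frac12\|y_h-\bar y\|_{L^2(\Gamma)}^2+\frac\beta2|u_h|_2^2$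 over $u_h\in\mathbb R^{n_D}$, $y_h\in V_h$ subject to $y_h(v)=u_{h,v}$ for $v\in\mathcal V_D$ and $a(y_h,w_h)=(f,w_h)_{L^2(\Gamma)}$ for all $w_h\in V_{h,D}$. It has a unique solution. *)

theory Defs
  imports "HOL-Analysis.Analysis"
begin

section \<open>Function spaces on an interval\<close>

text \<open>
  Elements of the spaces on \<open>(0,l)\<close> are represented by functions on the reals; values
  outside the interval play no role.
\<close>

definition L2_edge :: "real \<Rightarrow> (real \<Rightarrow> real) set" where
  "L2_edge l = {f. f \<in> borel_measurable (lebesgue_on {0<..<l}) \<and>
                   integrable (lebesgue_on {0<..<l}) (\<lambda>x. (f x)\<^sup>2)}"

definition Linf_edge :: "real \<Rightarrow> (real \<Rightarrow> real) set" where
  "Linf_edge l = {f. f \<in> borel_measurable (lebesgue_on {0<..<l}) \<and>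
                     (\<exists>C. AE x in lebesgue_on {0<..<l}. \<bar>f x\<bar> \<le> C)}"

text \<open>The space $C_c^1(0,l)$ of test functions, extended by zero to the real line.\<close>

definition test_functions :: "real \<Rightarrow> (real \<Rightarrow> real) set" where
  "test_functions l = {\<phi>. \<phi> C1_differentiable_on UNIV \<and>
     (\<exists>K. compact K \<and> K \<subseteq> {0<..<l} \<and> (\<forall>x. x \<notin> K \<longrightarrow> \<phi> x = 0))}"

definition is_weak_deriv :: "real \<Rightarrow> (real \<Rightarrow> real) \<Rightarrow> (real \<Rightarrow> real) \<Rightarrow> bool" where
  "is_weak_deriv l y g \<longleftrightarrow>
     (\<forall>\<phi>\<in>test_functions l.
        integral\<^sup>L (lebesgue_on {0<..<l}) (\<lambda>x. y x * deriv \<phi> x)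
          = - integral\<^sup>L (lebesgue_on {0<..<l}) (\<lambda>x. g x * \<phi> x))"

definition H1_edge :: "real \<Rightarrow> (real \<Rightarrow> real) set" where
  "H1_edge l = {y \<in> L2_edge l. \<exists>g\<in>L2_edge l. is_weak_deriv l y g}"

text \<open>
  The weak derivative is determined up to a null set only; \<open>wderiv\<close> picks a representative.
  It is meaningful for elements of \<open>H1_edge l\<close>.
\<close>

definition wderiv :: "real \<Rightarrow> (real \<Rightarrow> real) \<Rightarrow> (real \<Rightarrow> real)" where
  "wderiv l y = (SOME g. g \<in> L2_edge l \<and> is_weak_deriv l y g)"

definition H2_edge :: "real \<Rightarrow> (real \<Rightarrow> real) set" where
  "H2_edge l = {y \<in> H1_edge l. wderiv l y \<in> H1_edge l}"

section \<open>Metric graphs\<close>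

text \<open>
  The edge \<open>e\<close> is identified with the interval from \<open>0\<close> (the vertex \<open>src G e\<close>) to \<open>len G e\<close>
  (the vertex \<open>tgt G e\<close>). The order of the two vertices serves only to fix this
  parametrization. Parallel edges and loops are allowed.
\<close>

record ('v, 'e) mgraph =
  verts :: "'v set"
  edges :: "'e set"
  src :: "'e \<Rightarrow> 'v"
  tgt :: "'e \<Rightarrow> 'v"
  len :: "'e \<Rightarrow> real"

definition metric_graph :: "('v, 'e) mgraph \<Rightarrow> bool" where
  "metric_graph G \<longleftrightarrow> finite (verts G) \<and> finite (edges G) \<and>
     (\<forall>e\<in>edges G. src G e \<in> verts G \<and> tgt G e \<in> verts G \<and> 0 < len G e)"

type_synonym 'e gfun = "'e \<Rightarrow> real \<Rightarrow> real"

definition L2_graph :: "('v, 'e) mgraph \<Rightarrow> 'e gfun set" where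
  "L2_graph G = {f. \<forall>e\<in>edges G. f e \<in> L2_edge (len G e)}"

definition Linf_graph :: "('v, 'e) mgraph \<Rightarrow> 'e gfun set" where
  "Linf_graph G = {f. \<forall>e\<in>edges G. f e \<in> Linf_edge (len G e)}"

definition L2_inner :: "('v, 'e) mgraph \<Rightarrow> 'e gfun \<Rightarrow> 'e gfun \<Rightarrow> real" where
  "L2_inner G f g =
     (\<Sum>e\<in>edges G. integral\<^sup>L (lebesgue_on {0<..<len G e}) (\<lambda>x. f e x * g e x))"

definition L2_norm :: "('v, 'e) mgraph \<Rightarrow> 'e gfun \<Rightarrow> real" where
  "L2_norm G f = sqrt (L2_inner G f f)"

definition gderiv :: "('v, 'e) mgraph \<Rightarrow> 'e gfun \<Rightarrow> 'e gfun" where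
  "gderiv G y = (\<lambda>e. wderiv (len G e) (y e))"

definition gdiff :: "'e gfun \<Rightarrow> 'e gfun \<Rightarrow> 'e gfun" where
  "gdiff f g = (\<lambda>e x. f e x - g e x)"

text \<open>\<open>vertex_value G y v c\<close> expresses \<open>y(v) = c\<close>: this is the value at \<open>v\<close> from every edge end at \<open>v\<close>.\<close>

definition vertex_value :: "('v, 'e) mgraph \<Rightarrow> 'e gfun \<Rightarrow> 'v \<Rightarrow> real \<Rightarrow> bool" where
  "vertex_value G y v c \<longleftrightarrow>
     (\<forall>e\<in>edges G. (src G e = v \<longrightarrow> y e 0 = c) \<and> (tgt G e = v \<longrightarrow> y e (len G e) = c))"

definition continuous_graph :: "('v, 'e) mgraph \<Rightarrow> 'e gfun \<Rightarrow> bool" where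
  "continuous_graph G y \<longleftrightarrow>
     (\<forall>e\<in>edges G. continuous_on {0..len G e} (y e)) \<and>
     (\<forall>v\<in>verts G. \<exists>c. vertex_value G y v c)"

text \<open>
  An element of the product of the spaces \<open>H1_edge\<close> enters through its continuous
  representative on the closed edges, so that vertex values make sense.
\<close>

definition H1_graph :: "('v, 'e) mgraph \<Rightarrow> 'e gfun set" where
  "H1_graph G = {y. (\<forall>e\<in>edges G. y e \<in> H1_edge (len G e)) \<and> continuous_graph G y}"

definition H1_norm :: "('v, 'e) mgraph \<Rightarrow> 'e gfun \<Rightarrow> real" where
  "H1_norm G y = sqrt ((L2_norm G y)\<^sup>2 + (L2_norm G (gderiv G y))\<^sup>2)"

definition H1D_graph :: "('v, 'e) mgraph \<Rightarrow> 'v set \<Rightarrow> 'e gfun set" where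
  "H1D_graph G VD = {y \<in> H1_graph G. \<forall>v\<in>VD. vertex_value G y v 0}"

definition H2_graph :: "('v, 'e) mgraph \<Rightarrow> 'e gfun set" where
  "H2_graph G = {y \<in> H1_graph G. \<forall>e\<in>edges G. y e \<in> H2_edge (len G e)}"

text \<open>The seminorm of \<open>H2_graph\<close>; the value is meaningful for elements of that space.\<close>

definition H2_seminorm :: "('v, 'e) mgraph \<Rightarrow> 'e gfun \<Rightarrow> real" where
  "H2_seminorm G y = L2_norm G (gderiv G (gderiv G y))"

definition bilin :: "('v, 'e) mgraph \<Rightarrow> 'e gfun \<Rightarrow> 'e gfun \<Rightarrow> 'e gfun \<Rightarrow> real" where
  "bilin G c0 y w =
     (\<Sum>e\<in>edges G. integral\<^sup>L (lebesgue_on {0<..<len G e})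
        (\<lambda>x. gderiv G y e x * gderiv G w e x + c0 e x * y e x * w e x))"

definition coercive_on :: "('v, 'e) mgraph \<Rightarrow> 'e gfun set \<Rightarrow> ('e gfun \<Rightarrow> 'e gfun \<Rightarrow> real) \<Rightarrow> bool" where
  "coercive_on G W a \<longleftrightarrow> (\<exists>\<alpha>>0. \<forall>y\<in>W. \<alpha> * (H1_norm G y)\<^sup>2 \<le> a y y)"

section \<open>The optimal control problem and its discretization\<close>

text \<open>
  A control is a function on all vertices of which only the values on \<open>VD\<close> matter;
  \<open>L2_set u VD\<close> is its Euclidean norm.
\<close>

definition objective ::
  "('v, 'e) mgraph \<Rightarrow> 'v set \<Rightarrow> real \<Rightarrow> 'e gfun \<Rightarrow> ('v \<Rightarrow> real) \<Rightarrow> 'e gfun \<Rightarrow> real" where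
  "objective G VD \<beta> ybar u y =
     1/2 * (L2_norm G (gdiff y ybar))\<^sup>2 + \<beta>/2 * (L2_set u VD)\<^sup>2"

text \<open>
  \<open>Y\<close> is the state space and \<open>W\<close> the space of functions against which the state equation
  is tested.
\<close>

definition feasible ::
  "('v, 'e) mgraph \<Rightarrow> 'v set \<Rightarrow> 'e gfun \<Rightarrow> 'e gfun \<Rightarrow> 'e gfun set \<Rightarrow> 'e gfun set
    \<Rightarrow> ('v \<Rightarrow> real) \<Rightarrow> 'e gfun \<Rightarrow> bool" where
  "feasible G VD c0 f Y W u y \<longleftrightarrow> y \<in> Y \<and> (\<forall>v\<in>VD. vertex_value G y v (u v)) \<and>
     (\<forall>w\<in>W. bilin G c0 y w = L2_inner G f w)"

definition optimal ::
  "('v, 'e) mgraph \<Rightarrow> 'v set \<Rightarrow> 'e gfun \<Rightarrow> real \<Rightarrow> 'e gfun \<Rightarrow> 'e gfun \<Rightarrow> 'e gfun set \<Rightarrow> 'e gfun set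
    \<Rightarrow> ('v \<Rightarrow> real) \<Rightarrow> 'e gfun \<Rightarrow> bool" where
  "optimal G VD c0 \<beta> f ybar Y W u y \<longleftrightarrow> feasible G VD c0 f Y W u y \<and>
     (\<forall>u' y'. feasible G VD c0 f Y W u' y' \<longrightarrow>
        objective G VD \<beta> ybar u y \<le> objective G VD \<beta> ybar u' y')"

definition solves_P ::
  "('v, 'e) mgraph \<Rightarrow> 'v set \<Rightarrow> 'e gfun \<Rightarrow> real \<Rightarrow> 'e gfun \<Rightarrow> 'e gfun
    \<Rightarrow> ('v \<Rightarrow> real) \<Rightarrow> 'e gfun \<Rightarrow> bool" where
  "solves_P G VD c0 \<beta> f ybar u y \<longleftrightarrow>
     optimal G VD c0 \<beta> f ybar (H1_graph G) (H1D_graph G VD) u y"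

definition is_adjoint ::
  "('v, 'e) mgraph \<Rightarrow> 'v set \<Rightarrow> 'e gfun \<Rightarrow> 'e gfun \<Rightarrow> 'e gfun \<Rightarrow> 'e gfun \<Rightarrow> bool" where
  "is_adjoint G VD c0 ybar y p \<longleftrightarrow> p \<in> H1D_graph G VD \<and>
     (\<forall>w\<in>H1D_graph G VD. bilin G c0 w p = L2_inner G (gdiff y ybar) w)"

text \<open>The grid is given by the numbers \<open>n e\<close> of subintervals of the edges.\<close>

definition mesh_size :: "('v, 'e) mgraph \<Rightarrow> ('e \<Rightarrow> nat) \<Rightarrow> real" where
  "mesh_size G n = Max ((\<lambda>e. len G e / real (n e)) ` edges G)"

definition Vh :: "('v, 'e) mgraph \<Rightarrow> ('e \<Rightarrow> nat) \<Rightarrow> 'e gfun set" where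
  "Vh G n = {y. continuous_graph G y \<and>
     (\<forall>e\<in>edges G. \<forall>k<n e. \<exists>a b.
        \<forall>x\<in>{real k * (len G e / real (n e)) .. real (Suc k) * (len G e / real (n e))}.
          y e x = a + b * x)}"

definition VhD :: "('v, 'e) mgraph \<Rightarrow> 'v set \<Rightarrow> ('e \<Rightarrow> nat) \<Rightarrow> 'e gfun set" where
  "VhD G VD n = Vh G n \<inter> H1D_graph G VD"

definition solves_Ph ::
  "('v, 'e) mgraph \<Rightarrow> 'v set \<Rightarrow> 'e gfun \<Rightarrow> real \<Rightarrow> 'e gfun \<Rightarrow> 'e gfun \<Rightarrow> ('e \<Rightarrow> nat)
    \<Rightarrow> ('v \<Rightarrow> real) \<Rightarrow> 'e gfun \<Rightarrow> bool" where
  "solves_Ph G VD c0 \<beta> f ybar n u y \<longleftrightarrow>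
     optimal G VD c0 \<beta> f ybar (Vh G n) (VhD G VD n) u y"

end

theory Submission
  imports Defs
begin

text \<open>
  Write \<open>a\<close> for the bilinear form, \<open>W\<close> for \<open>H1D_graph G VD\<close>, \<open>W\<^sub>h\<close> for \<open>VhD G VD n\<close>,
  \<open>d = u - u\<^sub>h\<close>, and \<open>I\<close> for nodal interpolation. The argument compares the two optimality
  conditions on one well chosen direction.

  Perturbing the control in the direction \<open>d\<close> changes the discrete state by the discrete harmonic
  extension \<open>s\<close> of \<open>d\<close>: the element of the finite element space with vertex values \<open>d\<close> on \<open>VD\<close> and
  \<open>a(s, w) = 0\<close> for all \<open>w \<in> W\<^sub>h\<close>. Discrete optimality reads \<open>(y\<^sub>h - ybar, s) + \<beta> u\<^sub>h\<cdot>d = 0\<close>.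
  Continuous optimality involves the continuous harmonic extension, but the adjoint state turns it
  into \<open>(y - ybar, b) + \<beta> u\<cdot>d = a(b, p)\<close> for \<^emph>\<open>every\<close> \<open>b\<close> in \<open>H1\<close> with vertex values \<open>d\<close>, in particular
  for \<open>b = s\<close>. Subtracting, and using \<open>a(s, I p) = 0\<close>,
  \<open>\<beta> |d|\<^sup>2 + (y - y\<^sub>h, s) = a(s, p - I p)\<close>.
  Now \<open>y - y\<^sub>h = s + r\<close>, where \<open>r = y - (y\<^sub>h + s)\<close> vanishes on \<open>VD\<close> and satisfies \<open>a(r, w) = 0\<close> on \<open>W\<^sub>h\<close>: it is
  the error of the finite element solution with the exact boundary values, so it is bounded by
  \<open>y - I y\<close>. Dropping \<open>(s, s) \<ge> 0\<close> and using that the norm of \<open>s\<close> is at most a multiple of \<open>|d|\<close>, one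
  factor \<open>|d|\<close> cancels, and both errors are bounded by the interpolation errors of \<open>y\<close> and \<open>p\<close>
  (lemma \<open>error_le_interpolation_errors\<close>). These are \<open>O(h)\<close> by \<open>ginterp_error\<close>.

  Three things have to be supplied. A continuous function has the weak derivative \<open>g\<close> iff it is a
  primitive of \<open>g\<close> (\<open>prim_weak_deriv\<close>, \<open>weak_deriv_continuous_imp_prim\<close>), and so calculations with weak
  derivatives become calculations with integrals. Harmonic extensions exist because of the
  projection theorem (\<open>projection\<close>), for which \<open>H1_graph_complete\<close> and coercivity provide completeness
  in the energy norm; this serves the continuous and the discrete case alike. Finally,
  \<open>y\<close> and \<open>p\<close> have second derivatives because testing with functions supported in one
  edge identifies the weak derivative of \<open>y'\<close> as \<open>c\<^sub>0 y - f\<close> (\<open>weak_solution_regular\<close>).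
\<close>

section \<open>Square integrable functions on an interval\<close>

text \<open>The source of all Cauchy--Schwarz inequalities below, and, with \<open>A = 0\<close>, of first
  order optimality: a minimum forces the linear coefficient \<open>B\<close> to vanish.\<close>

lemma quadratic_nonneg_discriminant:
  fixes A B C :: real
  assumes "\<And>t. 0 \<le> A + 2 * t * B + t\<^sup>2 * C" and "0 \<le> C"
  shows "B\<^sup>2 \<le> A * C"
proof (cases "C = 0")
  case True
  have "B = 0"
  proof (rule ccontr)
    assume "B \<noteq> 0"
    with assms(1)[of "- (A + 1) / (2 * B)"] True show False by (simp add: field_simps)
  qed
  with True show ?thesis by simp
next
  case False
  with assms(2) have C: "0 < C" by simp
  have "0 \<le> A + 2 * (- B / C) * B + (- B / C)\<^sup>2 * C" by (rule assms(1))
  also have "\<dots> = A - B\<^sup>2 / C" using C by (simp add: field_simps power2_eq_square)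
  finally show ?thesis using C by (simp add: field_simps)
qed

text \<open>Square integrability on the \<^emph>\<open>closed\<close> interval, phrased with the gauge
  integral, whose lemmas on subintervals and primitives are then at hand; it agrees with
  \<open>L2_edge\<close> by \<open>L2_edge_iff\<close>.\<close>

definition l2 :: "real \<Rightarrow> real \<Rightarrow> (real \<Rightarrow> real) \<Rightarrow> bool" where
  "l2 a b f \<longleftrightarrow> f \<in> borel_measurable (lebesgue_on {a..b}) \<and> (\<lambda>x. (f x)\<^sup>2) integrable_on {a..b}"

lemma l2_mult:
  assumes "l2 a b f" "l2 a b g"
  shows "(\<lambda>x. f x * g x) absolutely_integrable_on {a..b}"
proof (rule measurable_bounded_by_integrable_imp_absolutely_integrable)
  show "(\<lambda>x. f x * g x) \<in> borel_measurable (lebesgue_on {a..b})"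
    using assms by (auto simp: l2_def)
  show "(\<lambda>x. (f x)\<^sup>2 + (g x)\<^sup>2) integrable_on {a..b}"
    using assms by (auto simp: l2_def intro: integrable_add)
  show "norm (f x * g x) \<le> (f x)\<^sup>2 + (g x)\<^sup>2" for x
  proof -
    have "0 \<le> (\<bar>f x\<bar> - \<bar>g x\<bar>)\<^sup>2" "0 \<le> \<bar>f x\<bar> * \<bar>g x\<bar>" by simp_all
    then have "\<bar>f x\<bar> * \<bar>g x\<bar> \<le> (f x)\<^sup>2 + (g x)\<^sup>2"
      unfolding power2_diff power2_abs by linarith
    then show ?thesis by (simp add: abs_mult)
  qed
qed auto

lemma l2_mult_integrable:
  assumes "l2 a b f" "l2 a b g"
  shows "(\<lambda>x. f x * g x) integrable_on {a..b}"
  using l2_mult[OF assms] by (rule set_lebesgue_integral_eq_integral(1))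

lemma l2_comb:
  assumes "l2 a b f" "l2 a b g"
  shows "l2 a b (\<lambda>x. f x + t * g x)"
proof -
  have "(\<lambda>x. (f x)\<^sup>2 + (2 * t * (f x * g x) + t\<^sup>2 * (g x)\<^sup>2)) integrable_on {a..b}"
    using assms l2_mult_integrable[OF assms]
    by (intro integrable_add integrable_on_mult_right) (auto simp: l2_def)
  moreover have "(f x + t * g x)\<^sup>2 = (f x)\<^sup>2 + (2 * t * (f x * g x) + t\<^sup>2 * (g x)\<^sup>2)" for x
    by (simp add: power2_eq_square algebra_simps)
  ultimately show ?thesis
    using assms by (auto simp: l2_def)
qed

lemma l2_continuous: "continuous_on {a..b} f \<Longrightarrow> l2 a b f"
  by (auto simp: l2_def intro!: continuous_imp_measurable_on_sets_lebesgue
      integrable_continuous_real continuous_intros)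

lemma l2_const: "l2 a b (\<lambda>x. c)"
  by (simp add: l2_continuous)

lemma l2_diff:
  assumes "l2 a b f" "l2 a b g"
  shows "l2 a b (\<lambda>x. f x - g x)"
  using l2_comb[OF assms, of "-1"] by simp

lemma l2_abs: "l2 a b f \<Longrightarrow> l2 a b (\<lambda>x. \<bar>f x\<bar>)"
  by (auto simp: l2_def)

lemma l2_absolutely_integrable: "l2 a b f \<Longrightarrow> f absolutely_integrable_on {a..b}"
  using l2_mult[OF _ l2_const, of a b f 1] by simp

lemma l2_integrable: "l2 a b f \<Longrightarrow> f integrable_on {a..b}"
  using l2_absolutely_integrable by (rule set_lebesgue_integral_eq_integral(1))

lemma l2_subinterval:
  assumes "l2 a b f" "{c..d} \<subseteq> {a..b}"
  shows "l2 c d f"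
proof -
  have "f integrable_on {c..d}"
    using l2_integrable[OF assms(1)] assms(2) by (rule integrable_on_subinterval)
  moreover have "(\<lambda>x. (f x)\<^sup>2) integrable_on {c..d}"
    using assms integrable_on_subinterval[of "\<lambda>x. (f x)\<^sup>2"] by (auto simp: l2_def)
  ultimately show ?thesis by (simp add: l2_def integrable_imp_measurable)
qed

lemma l2_sq_integrable: "l2 a b f \<Longrightarrow> (\<lambda>x. (f x)\<^sup>2) integrable_on {a..b}"
  by (simp add: l2_def)

lemma l2_Cauchy_Schwarz:
  assumes "l2 a b f" "l2 a b g"
  shows "(integral {a..b} (\<lambda>x. f x * g x))\<^sup>2
          \<le> integral {a..b} (\<lambda>x. (f x)\<^sup>2) * integral {a..b} (\<lambda>x. (g x)\<^sup>2)"
proof (rule quadratic_nonneg_discriminant)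
  fix t
  have "0 \<le> integral {a..b} (\<lambda>x. (f x + t * g x)\<^sup>2)"
    by (rule integral_nonneg) (use l2_sq_integrable[OF l2_comb[OF assms]] in auto)
  also have "\<dots> = integral {a..b} (\<lambda>x. (f x)\<^sup>2 + (2 * t * (f x * g x) + t\<^sup>2 * (g x)\<^sup>2))"
    by (rule arg_cong[where f="integral _"]) (auto simp: power2_eq_square algebra_simps)
  also have "\<dots> = integral {a..b} (\<lambda>x. (f x)\<^sup>2)
      + (integral {a..b} (\<lambda>x. 2 * t * (f x * g x)) + integral {a..b} (\<lambda>x. t\<^sup>2 * (g x)\<^sup>2))"
    using assms l2_mult_integrable[OF assms]
    by (simp add: integral_add integrable_add integrable_on_mult_right l2_sq_integrable)
  also have "\<dots> = integral {a..b} (\<lambda>x. (f x)\<^sup>2) + 2 * t * integral {a..b} (\<lambda>x. f x * g x)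
      + t\<^sup>2 * integral {a..b} (\<lambda>x. (g x)\<^sup>2)"
    by simp
  finally show "0 \<le> \<dots>" .
next
  show "0 \<le> integral {a..b} (\<lambda>x. (g x)\<^sup>2)"
    by (rule integral_nonneg) (use assms in \<open>auto simp: l2_def\<close>)
qed

lemma l2_integral_abs_sq_le:
  assumes "l2 a b f" "a \<le> b"
  shows "(integral {a..b} (\<lambda>x. \<bar>f x\<bar>))\<^sup>2 \<le> (b - a) * integral {a..b} (\<lambda>x. (f x)\<^sup>2)"
  using l2_Cauchy_Schwarz[OF l2_abs[OF assms(1)] l2_const[of a b 1]] assms(2)
  by (simp add: mult.commute)

definition aeq :: "real \<Rightarrow> real \<Rightarrow> (real \<Rightarrow> real) \<Rightarrow> (real \<Rightarrow> real) \<Rightarrow> bool" where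
  "aeq a b f g \<longleftrightarrow> negligible {x \<in> {a..b}. f x \<noteq> g x}"

lemma aeq_refl [simp]: "aeq a b f f"
  by (simp add: aeq_def)

lemma aeq_sym: "aeq a b f g \<Longrightarrow> aeq a b g f"
  by (simp add: aeq_def eq_commute)

lemma aeq_cong2:
  assumes "aeq a b f f'" "aeq a b g g'"
  shows "aeq a b (\<lambda>x. F x (f x) (g x)) (\<lambda>x. F x (f' x) (g' x))"
  unfolding aeq_def by (rule negligible_subset[OF negligible_Un[OF assms[unfolded aeq_def]]]) auto

lemma aeq_subinterval: "aeq a b f g \<Longrightarrow> {c..d} \<subseteq> {a..b} \<Longrightarrow> aeq c d f g"
  unfolding aeq_def by (erule negligible_subset) auto

lemma aeq_integral:
  assumes "aeq a b f g"
  shows "integral {a..b} f = integral {a..b} g"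
  using assms unfolding aeq_def by (rule integral_spike) auto

lemma aeq_absolutely_integrable:
  assumes "aeq a b f g" "f absolutely_integrable_on {a..b}"
  shows "g absolutely_integrable_on {a..b}"
  using assms(2) assms(1)[unfolded aeq_def] by (rule absolutely_integrable_spike) auto

lemma aeq_l2:
  assumes "aeq a b f g" "l2 a b f"
  shows "l2 a b g"
proof -
  have "g absolutely_integrable_on {a..b}"
    using aeq_absolutely_integrable[OF assms(1) l2_absolutely_integrable[OF assms(2)]] .
  moreover have "(\<lambda>x. (g x)\<^sup>2) absolutely_integrable_on {a..b}"
    using aeq_absolutely_integrable[OF aeq_cong2[OF assms(1) aeq_refl, where F="\<lambda>_ y _. y\<^sup>2"]]
      l2_mult[OF assms(2) assms(2)] by (simp add: power2_eq_square)
  ultimately show ?thesis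
    by (auto simp: l2_def absolutely_integrable_imp_borel_measurable
        intro: set_lebesgue_integral_eq_integral(1))
qed

text \<open>A function whose primitive vanishes is a null function: its positive and its negative part
  are densities of the same measure, since the two measures agree on intervals.\<close>

lemma aeq_zero_if_primitive_zero:
  fixes f :: "real \<Rightarrow> real"
  assumes f: "f absolutely_integrable_on {a..b}"
    and z: "\<And>x. x \<in> {a..b} \<Longrightarrow> integral {a..x} f = 0"
  shows "aeq a b f (\<lambda>x. 0)"
proof -
  define F where "F = (\<lambda>x. indicator {a..b} x * f x)"
  have Fi: "integrable lebesgue F"
    using f by (simp add: F_def set_integrable_def)
  obtain g where g: "g \<in> borel_measurable lborel" and gF: "AE x in lborel. F x = g x"
    using completion_ex_borel_measurable_real[of F lborel] Fi by auto
  have gm [measurable]: "g \<in> borel_measurable borel" using g by simp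
  have gFl: "AE x in lebesgue. F x = g x" using gF by (rule AE_completion)
  have "integrable lebesgue g"
    using Fi gFl measurable_completion[OF g] integrable_cong_AE[of F lebesgue g] by blast
  then have gi: "integrable lborel g"
    using g by (simp add: integrable_completion)
  have box0: "(\<integral>x. indicator (box c d) x * g x \<partial>lborel) = 0" for c d :: real
  proof -
    have "(\<integral>x. indicator (box c d) x * g x \<partial>lborel) = (\<integral>x. indicator (box c d) x * g x \<partial>lebesgue)"
      by (rule integral_completion[symmetric]) simp
    also have "\<dots> = (\<integral>x. indicator (box c d) x * F x \<partial>lebesgue)"
    proof (rule integral_cong_AE)
      show "AE x in lebesgue. indicator (box c d) x * g x = indicator (box c d) x * F x"
        using gFl by eventually_elim simp
      show "(\<lambda>x. indicator (box c d) x * g x) \<in> borel_measurable lebesgue"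
        by (rule measurable_completion) simp
      have [measurable]: "F \<in> borel_measurable lebesgue" using Fi by auto
      show "(\<lambda>x. indicator (box c d) x * F x) \<in> borel_measurable lebesgue"
        by (intro borel_measurable_times borel_measurable_indicator) auto
    qed
    also have "\<dots> = (LINT x:(box c d \<inter> {a..b})|lebesgue. f x)"
      unfolding set_lebesgue_integral_def F_def
      by (rule Bochner_Integration.integral_cong) (auto simp: indicator_def)
    also have "\<dots> = integral (box c d \<inter> {a..b}) f"
      by (rule set_lebesgue_integral_eq_integral(2), rule set_integrable_subset[OF f]) auto
    also have "\<dots> = integral ({c..d} \<inter> {a..b}) f"
      by (rule integral_subset_negligible, force, rule negligible_subset[of "{c,d}"]) auto
    also have "\<dots> = integral {max a c..min b d} f"
      by (rule arg_cong[where f="\<lambda>S. integral S f"]) auto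
    also have "\<dots> = 0"
    proof (cases "max a c \<le> min b d")
      case True
      have "integral {a..max a c} f + integral {max a c..min b d} f = integral {a..min b d} f"
        using True
        by (intro Henstock_Kurzweil_Integration.integral_combine
            integrable_on_subinterval[OF set_lebesgue_integral_eq_integral(1)[OF f]]) auto
      moreover have "integral {a..max a c} f = 0" "integral {a..min b d} f = 0"
        using True by (auto intro!: z)
      ultimately show ?thesis by simp
    qed simp
    finally show ?thesis .
  qed
  define P where "P = (\<lambda>x. ennreal (g x))"
  define N where "N = (\<lambda>x. ennreal (- g x))"
  have [measurable]: "P \<in> borel_measurable borel" "N \<in> borel_measurable borel"
    by (auto simp: P_def N_def)
  have Pi: "integrable lborel (\<lambda>x. indicator X x * max 0 (g x))"
    and Ni: "integrable lborel (\<lambda>x. indicator X x * max 0 (- g x))" if "X \<in> sets borel" for X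
  proof -
    show "integrable lborel (\<lambda>x. indicator X x * max 0 (g x))"
      by (rule Bochner_Integration.integrable_bound[OF gi])
        (use that in \<open>auto simp: indicator_def\<close>)
    show "integrable lborel (\<lambda>x. indicator X x * max 0 (- g x))"
      by (rule Bochner_Integration.integrable_bound[OF gi])
        (use that in \<open>auto simp: indicator_def\<close>)
  qed
  have eP: "emeasure (density lborel P) X = ennreal (\<integral>x. indicator X x * max 0 (g x) \<partial>lborel)"
    if X: "X \<in> sets borel" for X
  proof -
    have "emeasure (density lborel P) X = (\<integral>\<^sup>+x. ennreal (indicator X x * max 0 (g x)) \<partial>lborel)"
      unfolding P_def using X
      by (subst emeasure_density) (auto intro!: nn_integral_cong simp: indicator_def max_def ennreal_neg)
    also have "\<dots> = ennreal (\<integral>x. indicator X x * max 0 (g x) \<partial>lborel)"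
      by (rule nn_integral_eq_integral[OF Pi[OF X]]) auto
    finally show ?thesis .
  qed
  have eN: "emeasure (density lborel N) X = ennreal (\<integral>x. indicator X x * max 0 (- g x) \<partial>lborel)"
    if X: "X \<in> sets borel" for X
  proof -
    have "emeasure (density lborel N) X = (\<integral>\<^sup>+x. ennreal (indicator X x * max 0 (- g x)) \<partial>lborel)"
      unfolding N_def using X
      by (subst emeasure_density) (auto intro!: nn_integral_cong simp: indicator_def max_def ennreal_neg)
    also have "\<dots> = ennreal (\<integral>x. indicator X x * max 0 (- g x) \<partial>lborel)"
      by (rule nn_integral_eq_integral[OF Ni[OF X]]) auto
    finally show ?thesis .
  qed
  have "density lborel P = density lborel N"
  proof (rule measure_eqI_generator_eq)
    let ?E = "range (\<lambda>(a, b). box a b::real set)"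
    show "Int_stable ?E"
      by (auto simp: Int_stable_def box_Int_box)
    show "?E \<subseteq> Pow UNIV" "sets (density lborel P) = sigma_sets UNIV ?E"
      "sets (density lborel N) = sigma_sets UNIV ?E"
      by (simp_all add: borel_eq_box)
    let ?A = "\<lambda>n::nat. box (- (real n *\<^sub>R One)) (real n *\<^sub>R One) :: real set"
    show "range ?A \<subseteq> ?E" "(\<Union>i. ?A i) = UNIV"
      unfolding UN_box_eq_UNIV by auto
    show "emeasure (density lborel P) (?A i) \<noteq> \<infinity>" for i
      by (subst eP) auto
    show "emeasure (density lborel P) X = emeasure (density lborel N) X" if X: "X \<in> ?E" for X
    proof -
      obtain c d where Xb: "X = box c d" using X by auto
      then have X': "X \<in> sets borel" by simp
      have "(\<integral>x. indicator X x * max 0 (g x) \<partial>lborel) - (\<integral>x. indicator X x * max 0 (- g x) \<partial>lborel)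
          = (\<integral>x. indicator X x * max 0 (g x) - indicator X x * max 0 (- g x) \<partial>lborel)"
        by (rule Bochner_Integration.integral_diff[symmetric, OF Pi[OF X'] Ni[OF X']])
      also have "\<dots> = (\<integral>x. indicator X x * g x \<partial>lborel)"
        by (rule Bochner_Integration.integral_cong) (auto simp: indicator_def)
      finally show ?thesis using box0 Xb by (simp add: eP eN)
    qed
  qed
  moreover have "(\<integral>\<^sup>+x. P x \<partial>lborel) \<noteq> \<infinity>"
    using eP[of UNIV] by (simp add: emeasure_density)
  ultimately have "AE x in lborel. P x = N x"
    by (subst (asm) finite_density_unique) auto
  then have "AE x in lborel. g x = 0"
  proof eventually_elim
    case (elim x)
    then show ?case unfolding P_def N_def
      by (cases "g x \<ge> 0"; cases "g x \<le> 0") (auto simp: ennreal_neg ennreal_eq_0_iff)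
  qed
  with gF have "AE x in lborel. F x = 0" by eventually_elim simp
  then have "AE x in lebesgue. F x = 0" by (rule AE_completion)
  then have "{x. F x \<noteq> 0} \<in> null_sets lebesgue"
    by (subst (asm) completion.AE_iff_null_sets) (use Fi in auto)
  then have "negligible {x. F x \<noteq> 0}" by (simp add: negligible_iff_null_sets)
  then show ?thesis unfolding aeq_def
    by (rule negligible_subset) (auto simp: F_def)
qed

section \<open>Weak derivatives and primitives\<close>

lemma integral_restrict_subset:
  fixes f :: "real \<Rightarrow> real"
  assumes "S \<subseteq> T"
  shows "integral T (\<lambda>x. if x \<in> S then f x else 0) = integral S f"
  by (simp only: integral_def integrable_on_def has_integral_restrict[OF assms])

lemma absolutely_integrable_open_closed:
  fixes f :: "real \<Rightarrow> real"
  shows "f absolutely_integrable_on {0<..<l} \<longleftrightarrow> f absolutely_integrable_on {0..l}"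
  using absolutely_integrable_on_open_interval[where f=f and a=0 and b=l] by (simp add: box_real)

lemma L2_edge_iff: "f \<in> L2_edge l \<longleftrightarrow> l2 0 l f"
proof
  assume f: "f \<in> L2_edge l"
  have sq: "(\<lambda>x. (f x)\<^sup>2) absolutely_integrable_on {0<..<l}"
    using f by (simp add: L2_edge_def set_integrable_def integrable_restrict_space)
  have "f absolutely_integrable_on {0<..<l}"
  proof (rule measurable_bounded_by_integrable_imp_absolutely_integrable)
    show "f \<in> borel_measurable (lebesgue_on {0<..<l})" using f by (simp add: L2_edge_def)
    show "(\<lambda>x. 1 + (f x)\<^sup>2) integrable_on {0<..<l}"
      using set_lebesgue_integral_eq_integral(1)[OF sq]
      by (intro integrable_add) (auto simp: integrable_on_open_interval_real)
    show "norm (f x) \<le> 1 + (f x)\<^sup>2" for x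
    proof -
      have "0 \<le> (\<bar>f x\<bar> - 1)\<^sup>2" by simp
      then have "2 * \<bar>f x\<bar> \<le> 1 + (f x)\<^sup>2" unfolding power2_diff power2_abs by simp
      then show ?thesis by simp
    qed
  qed auto
  then have "f absolutely_integrable_on {0..l}" by (simp add: absolutely_integrable_open_closed)
  moreover have "(\<lambda>x. (f x)\<^sup>2) absolutely_integrable_on {0..l}"
    using sq by (simp add: absolutely_integrable_open_closed)
  ultimately show "l2 0 l f"
    by (simp add: l2_def absolutely_integrable_imp_borel_measurable set_lebesgue_integral_eq_integral(1))
next
  assume f: "l2 0 l f"
  have "f absolutely_integrable_on {0<..<l}" "(\<lambda>x. f x * f x) absolutely_integrable_on {0<..<l}"
    using l2_absolutely_integrable[OF f] l2_mult[OF f f] by (simp_all add: absolutely_integrable_open_closed)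
  then show "f \<in> L2_edge l"
    by (simp add: L2_edge_def power2_eq_square absolutely_integrable_imp_borel_measurable
        absolutely_integrable_imp_integrable)
qed

lemma lebesgue_open_integral:
  fixes h :: "real \<Rightarrow> real"
  assumes "h absolutely_integrable_on {0..l}"
  shows "integral\<^sup>L (lebesgue_on {0<..<l}) h = integral {0..l} h"
proof -
  have "h absolutely_integrable_on {0<..<l}" using assms by (simp add: absolutely_integrable_open_closed)
  then have "integral\<^sup>L (lebesgue_on {0<..<l}) h = integral {0<..<l} h"
    by (intro lebesgue_integral_eq_integral absolutely_integrable_imp_integrable) auto
  then show ?thesis by (simp add: integral_open_interval_real)
qed

text \<open>\<open>y\<close> is absolutely continuous on \<open>[0,l]\<close> with square integrable
  derivative \<open>g\<close>. This is the working form of \<open>H1\<close> on an edge.\<close>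

definition prim :: "real \<Rightarrow> (real \<Rightarrow> real) \<Rightarrow> (real \<Rightarrow> real) \<Rightarrow> bool" where
  "prim l y g \<longleftrightarrow> l2 0 l g \<and> (\<forall>x\<in>{0..l}. y x = y 0 + integral {0..x} g)"

lemma prim_l2: "prim l y g \<Longrightarrow> l2 0 l g"
  by (simp add: prim_def)

lemma prim_eq: "prim l y g \<Longrightarrow> x \<in> {0..l} \<Longrightarrow> y x = y 0 + integral {0..x} g"
  unfolding prim_def by blast

lemma prim_continuous:
  assumes "prim l y g"
  shows "continuous_on {0..l} y"
proof -
  have "continuous_on {0..l} (\<lambda>x. y 0 + integral {0..x} g)"
    by (intro continuous_on_add continuous_on_const indefinite_integral_continuous_1
        l2_integrable[OF prim_l2[OF assms]])
  then show ?thesis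
    by (rule continuous_on_eq) (rule prim_eq[OF assms, symmetric])
qed

lemma prim_l2_self: "prim l y g \<Longrightarrow> l2 0 l y"
  by (rule l2_continuous[OF prim_continuous])

lemma prim_increment:
  assumes "prim l y g" "0 \<le> a" "a \<le> b" "b \<le> l"
  shows "y b - y a = integral {a..b} g"
proof -
  have "integral {0..a} g + integral {a..b} g = integral {0..b} g"
    using assms l2_integrable[OF l2_subinterval[OF prim_l2[OF assms(1)], of 0 b]]
    by (intro Henstock_Kurzweil_Integration.integral_combine) auto
  then show ?thesis
    using prim_eq[OF assms(1), of a] prim_eq[OF assms(1), of b] assms(2-4) by simp
qed

lemma prim_increment_sq:
  assumes "prim l y g" "0 \<le> a" "a \<le> b" "b \<le> l"
  shows "(y b - y a)\<^sup>2 \<le> (b - a) * integral {a..b} (\<lambda>x. (g x)\<^sup>2)"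
  using l2_Cauchy_Schwarz[OF l2_subinterval[OF prim_l2[OF assms(1)], of a b] l2_const[of a b 1]] assms
  by (simp add: prim_increment mult.commute)

lemma prim_cong:
  assumes "prim l y g" "aeq 0 l g g'"
  shows "prim l y g'"
  unfolding prim_def
proof (intro conjI ballI)
  show "l2 0 l g'" using aeq_l2[OF assms(2) prim_l2[OF assms(1)]] .
  fix x assume x: "x \<in> {0..l}"
  show "y x = y 0 + integral {0..x} g'"
    using prim_eq[OF assms(1) x] x aeq_integral[OF aeq_subinterval[OF assms(2), of 0 x]] by simp
qed

lemma prim_unique:
  assumes "prim l y g" "prim l y g'"
  shows "aeq 0 l g g'"
proof -
  have d: "l2 0 l (\<lambda>x. g x - g' x)"
    using assms by (intro l2_diff prim_l2)
  have "aeq 0 l (\<lambda>x. g x - g' x) (\<lambda>x. 0)"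
  proof (rule aeq_zero_if_primitive_zero[OF l2_absolutely_integrable[OF d]])
    fix x assume x: "x \<in> {0..l}"
    have "g integrable_on {0..x}" "g' integrable_on {0..x}"
      using x by (auto intro!: l2_integrable l2_subinterval[OF prim_l2[OF assms(1)]]
          l2_subinterval[OF prim_l2[OF assms(2)]])
    then have "integral {0..x} (\<lambda>x. g x - g' x) = integral {0..x} g - integral {0..x} g'"
      by (rule integral_diff)
    then show "integral {0..x} (\<lambda>x. g x - g' x) = 0"
      using prim_eq[OF assms(1) x] prim_eq[OF assms(2) x] by linarith
  qed
  then show ?thesis by (simp add: aeq_def)
qed

lemma prim_comb:
  assumes "prim l y g" "prim l w k"
  shows "prim l (\<lambda>x. y x + t * w x) (\<lambda>x. g x + t * k x)"
  unfolding prim_def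
proof (intro conjI ballI)
  show "l2 0 l (\<lambda>x. g x + t * k x)" using assms by (intro l2_comb prim_l2)
  fix x assume x: "x \<in> {0..l}"
  have "g integrable_on {0..x}" "k integrable_on {0..x}"
    using x by (auto intro!: l2_integrable l2_subinterval[OF prim_l2[OF assms(1)]]
          l2_subinterval[OF prim_l2[OF assms(2)]])
  then have "integral {0..x} (\<lambda>x. g x + t * k x) = integral {0..x} g + t * integral {0..x} k"
    by (simp add: integral_add integrable_on_mult_right)
  moreover have "t * w x = t * w 0 + t * integral {0..x} k"
    using arg_cong[OF prim_eq[OF assms(2) x], of "\<lambda>z. t * z"] by (simp add: distrib_left)
  ultimately show "y x + t * w x = y 0 + t * w 0 + integral {0..x} (\<lambda>x. g x + t * k x)"
    using prim_eq[OF assms(1) x] by linarith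
qed

text \<open>Subdividing \<open>[0,l]\<close> into \<open>n\<close> equal parts bounds \<open>\<bar>h l - h 0\<bar>\<close> by \<open>K (M l - M 0) l / n\<close>.\<close>

lemma constant_if_increments_small:
  fixes h M :: "real \<Rightarrow> real"
  assumes l: "0 \<le> l"
    and inc: "\<And>a b. 0 \<le> a \<Longrightarrow> a \<le> b \<Longrightarrow> b \<le> l \<Longrightarrow> \<bar>h b - h a\<bar> \<le> K * (b - a) * (M b - M a)"
  shows "h l = h 0"
proof -
  have bound: "\<bar>h l - h 0\<bar> \<le> K * (l / Suc n) * (M l - M 0)" for n
  proof -
    define s where "s = (\<lambda>k::nat. real k * (l / Suc n))"
    have s: "0 \<le> s k" "s k \<le> s (Suc k)" "s (Suc k) - s k = l / Suc n" for k
      using l by (auto simp: s_def algebra_simps add_divide_distrib)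
    have sl: "s k \<le> l" if "k \<le> Suc n" for k
      using that l mult_left_mono[of "real k" "real (Suc n)" "l"]
      by (simp add: s_def divide_le_eq mult.commute)
    have "\<bar>h l - h 0\<bar> = \<bar>\<Sum>k<Suc n. h (s (Suc k)) - h (s k)\<bar>"
      using sum_lessThan_telescope[of "\<lambda>k. h (s k)" "Suc n"] by (simp add: s_def)
    also have "\<dots> \<le> (\<Sum>k<Suc n. \<bar>h (s (Suc k)) - h (s k)\<bar>)" by (rule sum_abs)
    also have "\<dots> \<le> (\<Sum>k<Suc n. K * (l / Suc n) * (M (s (Suc k)) - M (s k)))"
    proof (rule sum_mono)
      fix k assume "k \<in> {..<Suc n}"
      then show "\<bar>h (s (Suc k)) - h (s k)\<bar> \<le> K * (l / Suc n) * (M (s (Suc k)) - M (s k))"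
        using inc[of "s k" "s (Suc k)"] s sl[of "Suc k"] by simp
    qed
    also have "\<dots> = K * (l / Suc n) * (M l - M 0)"
    proof -
      have "(\<Sum>k<Suc n. M (s (Suc k)) - M (s k)) = M l - M 0"
        using sum_lessThan_telescope[of "\<lambda>k. M (s k)" "Suc n"] by (simp add: s_def)
      then show ?thesis by (simp only: sum_distrib_left[symmetric])
    qed
    finally show ?thesis .
  qed
  have "(\<lambda>n. K * (l * (1 / Suc n)) * (M l - M 0)) \<longlonglongrightarrow> K * (l * 0) * (M l - M 0)"
    by (intro tendsto_intros LIMSEQ_Suc[OF lim_1_over_n])
  then have "\<bar>h l - h 0\<bar> \<le> 0"
    by (intro LIMSEQ_le_const[where X="\<lambda>n. K * (l * (1 / Suc n)) * (M l - M 0)"]) (use bound in auto)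
  then show ?thesis by simp
qed

text \<open>The difference of the two sides, as a function of the right end point, has increments of
  second order: on \<open>[a,b]\<close> one may freeze \<open>y\<close> at \<open>a\<close> and
  \<open>\<phi>\<close> at \<open>b\<close> up to an error \<open>2 L (b - a)
  \<integral>|g|\<close>. This avoids differentiating \<open>y\<close> almost everywhere.\<close>

lemma integration_by_parts_prim:
  assumes y: "prim l y g" and l: "0 \<le> l"
    and D: "\<And>x. (\<phi> has_vector_derivative D x) (at x)" and cD: "continuous_on UNIV D"
  shows "integral {0..l} (\<lambda>x. y x * D x + g x * \<phi> x) = y l * \<phi> l - y 0 * \<phi> 0"
proof -
  have c\<phi>: "continuous_on S \<phi>" for S
    using D by (meson continuous_at_imp_continuous_on has_vector_derivative_continuous)
  have l2D: "l2 a b D" and l2\<phi>: "l2 a b \<phi>" for a b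
    using cD c\<phi> by (auto intro!: l2_continuous intro: continuous_on_subset)
  have l2yg: "l2 a b y" "l2 a b g" if "0 \<le> a" "b \<le> l" for a b
    using that by (auto intro!: l2_subinterval[OF prim_l2_self[OF y]] l2_subinterval[OF prim_l2[OF y]])
  obtain L where L: "\<And>x. x \<in> {0..l} \<Longrightarrow> \<bar>D x\<bar> \<le> L"
  proof -
    have "bounded (D ` {0..l})"
      using cD by (intro compact_imp_bounded compact_continuous_image)
        (auto intro: continuous_on_subset)
    then show ?thesis using that by (fastforce simp: bounded_iff)
  qed
  define h where "h = (\<lambda>x. y x * \<phi> x - integral {0..x} (\<lambda>x. y x * D x + g x * \<phi> x))"
  define M where "M = (\<lambda>x. integral {0..x} (\<lambda>x. \<bar>g x\<bar>))"
  have "h l = h 0"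
  proof (rule constant_if_increments_small[OF l])
    fix a b assume ab: "0 \<le> a" "a \<le> b" "b \<le> l"
    note l2s = l2D[of a b] l2\<phi>[of a b] l2yg[OF ab(1,3)]
    have M: "M b - M a = integral {a..b} (\<lambda>x. \<bar>g x\<bar>)"
      using Henstock_Kurzweil_Integration.integral_combine[of 0 a b "\<lambda>x. \<bar>g x\<bar>"]
        ab l2_integrable[OF l2_abs[OF l2yg(2)], of 0 b]
      by (simp add: M_def)
    have Mx: "\<bar>g' - g''\<bar> \<le> M b - M a" if "g' = y x" "g'' = y a" "x \<in> {a..b}" for x g' g''
    proof -
      have "y x - y a = integral {a..x} g" using that ab by (intro prim_increment[OF y]) auto
      also have "\<bar>\<dots>\<bar> \<le> integral {a..x} (\<lambda>x. \<bar>g x\<bar>)"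
        using that ab l2_absolutely_integrable[OF l2yg(2), of a x]
        by (intro integral_norm_bound_integral[where 'a=real and 'n=real, unfolded real_norm_def])
          (auto intro!: l2_integrable l2_abs l2yg)
      also have "\<dots> \<le> integral {a..b} (\<lambda>x. \<bar>g x\<bar>)"
        using that ab by (intro integral_subset_le) (auto intro!: l2_integrable l2_abs l2yg)
      finally show ?thesis using that M by simp
    qed
    have "integral {0..a} (\<lambda>x. y x * D x + g x * \<phi> x) + integral {a..b} (\<lambda>x. y x * D x + g x * \<phi> x)
        = integral {0..b} (\<lambda>x. y x * D x + g x * \<phi> x)"
      using ab
      by (intro Henstock_Kurzweil_Integration.integral_combine integrable_add l2_mult_integrable
          l2D l2\<phi> l2yg) auto
    then have "h b - h a = y b * \<phi> b - y a * \<phi> a - integral {a..b} (\<lambda>x. y x * D x + g x * \<phi> x)"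
      by (simp add: h_def)
    also have "y b * \<phi> b - y a * \<phi> a = y a * (\<phi> b - \<phi> a) + (y b - y a) * \<phi> b"
      by (simp add: algebra_simps)
    also have "\<phi> b - \<phi> a = integral {a..b} D"
      using ab D by (intro integral_unique[symmetric] fundamental_theorem_of_calculus)
        (auto intro: has_vector_derivative_at_within)
    also have "y b - y a = integral {a..b} g"
      using ab by (intro prim_increment[OF y])
    also have "y a * integral {a..b} D + integral {a..b} g * \<phi> b
        - integral {a..b} (\<lambda>x. y x * D x + g x * \<phi> x)
        = integral {a..b} (\<lambda>x. y a * D x + g x * \<phi> b - (y x * D x + g x * \<phi> x))"
      using l2s by (simp add: integral_diff integral_add integrable_add l2_mult_integrable l2_integrable
          integrable_on_mult_right integrable_on_mult_left)
    also have "\<dots> = integral {a..b} (\<lambda>x. (y a - y x) * D x + g x * (\<phi> b - \<phi> x))"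
      by (rule arg_cong[where f="integral _"]) (auto simp: algebra_simps)
    finally have eq: "h b - h a = \<dots>" .
    have Lip: "\<bar>\<phi> b - \<phi> x\<bar> \<le> L * (b - a)" if x: "x \<in> {a..b}" for x
    proof -
      have L0: "0 \<le> L" using L[of 0] l by auto
      have "norm (\<phi> b - \<phi> x) \<le> L * norm (b - x)"
      proof (rule differentiable_bound[where S="{x..b}" and f'="\<lambda>x h. h *\<^sub>R D x"])
        show "(\<phi> has_derivative (\<lambda>h. h *\<^sub>R D z)) (at z within {x..b})" if "z \<in> {x..b}" for z
          using D[of z] by (auto simp: has_vector_derivative_def intro: has_derivative_at_withinI)
        show "onorm (\<lambda>h. h *\<^sub>R D z) \<le> L" if "z \<in> {x..b}" for z
        proof (rule onorm_le)
          show "norm (h *\<^sub>R D z) \<le> L * norm h" for h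
            using L[of z] that x ab mult_right_mono[of "\<bar>D z\<bar>" L "\<bar>h\<bar>"] by (simp add: abs_mult mult.commute)
        qed
      qed (use x in auto)
      also have "\<dots> \<le> L * (b - a)" using x L0 by (intro mult_left_mono) auto
      finally show ?thesis by simp
    qed
    have "\<bar>h b - h a\<bar> \<le> integral {a..b} (\<lambda>x. (M b - M a) * L + L * (b - a) * \<bar>g x\<bar>)"
      unfolding eq
    proof (rule integral_norm_bound_integral[where 'a=real and 'n=real, unfolded real_norm_def])
      show "(\<lambda>x. (y a - y x) * D x + g x * (\<phi> b - \<phi> x)) integrable_on {a..b}"
        by (intro integrable_add l2_mult_integrable l2_diff l2s l2_const)
      show "(\<lambda>x. (M b - M a) * L + L * (b - a) * \<bar>g x\<bar>) integrable_on {a..b}"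
        by (intro integrable_add integrable_on_mult_right l2_integrable l2_abs l2s l2_const)
      fix x assume x: "x \<in> {a..b}"
      have "\<bar>(y a - y x) * D x\<bar> \<le> (M b - M a) * L"
        unfolding abs_mult using Mx[of "y x" x "y a"] L[of x] x ab
        by (intro mult_mono) auto
      moreover have "\<bar>g x * (\<phi> b - \<phi> x)\<bar> \<le> L * (b - a) * \<bar>g x\<bar>"
        using mult_left_mono[OF Lip[OF x], of "\<bar>g x\<bar>"] by (simp add: abs_mult mult.commute mult.left_commute)
      ultimately show "\<bar>(y a - y x) * D x + g x * (\<phi> b - \<phi> x)\<bar> \<le> (M b - M a) * L + L * (b - a) * \<bar>g x\<bar>"
        by linarith
    qed
    also have "\<dots> = 2 * L * (b - a) * (M b - M a)"
    proof -
      have "integral {a..b} (\<lambda>x. (M b - M a) * L + L * (b - a) * \<bar>g x\<bar>)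
          = integral {a..b} (\<lambda>x. (M b - M a) * L) + integral {a..b} (\<lambda>x. L * (b - a) * \<bar>g x\<bar>)"
        by (intro integral_add integrable_on_mult_right[OF l2_integrable[OF l2_abs[OF l2s(4)]]]
            l2_integrable[OF l2_const])
      then show ?thesis using ab by (simp add: M)
    qed
    finally show "\<bar>h b - h a\<bar> \<le> 2 * L * (b - a) * (M b - M a)" .
  qed
  then show ?thesis by (simp add: h_def)
qed

lemma test_functionE:
  assumes "\<phi> \<in> test_functions l"
  obtains D where "\<And>x. (\<phi> has_vector_derivative D x) (at x)" "continuous_on UNIV D" "deriv \<phi> = D"
    "\<And>x. x \<notin> {0<..<l} \<Longrightarrow> \<phi> x = 0" "continuous_on UNIV \<phi>"
proof -
  from assms obtain D where D: "\<And>x. (\<phi> has_vector_derivative D x) (at x)" "continuous_on UNIV D"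
    by (auto simp: test_functions_def C1_differentiable_on_def)
  moreover have "deriv \<phi> = D"
    by (rule ext, rule DERIV_imp_deriv) (use D in \<open>simp add: has_real_derivative_iff_has_vector_derivative\<close>)
  moreover have "\<phi> x = 0" if "x \<notin> {0<..<l}" for x
    using assms that by (auto simp: test_functions_def)
  moreover have "continuous_on UNIV \<phi>"
    using D by (meson continuous_at_imp_continuous_on has_vector_derivative_continuous)
  ultimately show ?thesis using that by blast
qed

lemma is_weak_deriv_iff:
  assumes "l2 0 l y" "l2 0 l g"
  shows "is_weak_deriv l y g \<longleftrightarrow> (\<forall>\<phi>\<in>test_functions l.
    integral {0..l} (\<lambda>x. y x * deriv \<phi> x) = - integral {0..l} (\<lambda>x. g x * \<phi> x))"
  unfolding is_weak_deriv_def
proof (rule ball_cong[OF refl])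
  fix \<phi> assume "\<phi> \<in> test_functions l"
  then obtain D where D: "continuous_on UNIV D" "deriv \<phi> = D" "continuous_on UNIV \<phi>"
    by (elim test_functionE)
  then have "l2 0 l (deriv \<phi>)" "l2 0 l \<phi>"
    by (auto intro!: l2_continuous elim: continuous_on_subset)
  then show "(LINT x|lebesgue_on {0<..<l}. y x * deriv \<phi> x) = - (LINT x|lebesgue_on {0<..<l}. g x * \<phi> x)
    \<longleftrightarrow> integral {0..l} (\<lambda>x. y x * deriv \<phi> x) = - integral {0..l} (\<lambda>x. g x * \<phi> x)"
    using assms by (simp add: lebesgue_open_integral l2_mult)
qed

lemma prim_weak_deriv:
  assumes y: "prim l y g" and l: "0 < l"
  shows "is_weak_deriv l y g"
  unfolding is_weak_deriv_iff[OF prim_l2_self[OF y] prim_l2[OF y]]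
proof
  fix \<phi> assume "\<phi> \<in> test_functions l"
  then obtain D where D: "\<And>x. (\<phi> has_vector_derivative D x) (at x)" "continuous_on UNIV D" "deriv \<phi> = D"
    "\<And>x. x \<notin> {0<..<l} \<Longrightarrow> \<phi> x = 0" "continuous_on UNIV \<phi>"
    by (erule test_functionE)
  have l2s: "l2 0 l D" "l2 0 l \<phi>"
    using D by (auto intro!: l2_continuous elim: continuous_on_subset)
  have "integral {0..l} (\<lambda>x. y x * D x + g x * \<phi> x) = 0"
    using integration_by_parts_prim[OF y _ D(1,2)] l D(4) by simp
  then show "integral {0..l} (\<lambda>x. y x * deriv \<phi> x) = - integral {0..l} (\<lambda>x. g x * \<phi> x)"
    using D(3) l2s prim_l2_self[OF y] prim_l2[OF y]
    by (simp add: integral_add l2_mult_integrable)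
qed

text \<open>The test function is the primitive of \<open>\<psi>\<close>, which vanishes to the left of the support of \<open>\<psi>\<close>
  by its choice of base point and to the right of it because \<open>\<psi>\<close> has mean zero.\<close>

lemma test_function_of_derivative:
  assumes c\<psi>: "continuous_on UNIV \<psi>" and ab: "0 < a" "b < l"
    and z: "\<And>x. x \<notin> {a..b} \<Longrightarrow> \<psi> x = 0" and mean: "integral {0..l} \<psi> = 0"
  obtains \<phi> where "\<phi> \<in> test_functions l" "deriv \<phi> = \<psi>"
proof -
  define \<phi> where "\<phi> = (\<lambda>x. integral {-1..x} \<psi>)"
  have c: "continuous_on S \<psi>" for S using c\<psi> continuous_on_subset by blast
  have supp: "integral T \<psi> = integral {a..b} \<psi>" if "{a..b} \<subseteq> T" for T
  proof -
    have "integral T \<psi> = integral T (\<lambda>x. if x \<in> {a..b} then \<psi> x else 0)"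
      using z by (intro integral_cong) auto
    then show ?thesis using integral_restrict_subset[OF that, of \<psi>] by simp
  qed
  have int: "integral {-1..x} \<psi> = integral {a..b} \<psi>" if "b \<le> x" for x
    using that ab by (intro supp) auto
  have "integral {0..l} \<psi> = integral {a..b} \<psi>"
    using ab by (intro supp) auto
  then have 0: "integral {a..b} \<psi> = 0" using mean by simp
  have left: "\<phi> x = 0" if "x < a" for x
  proof -
    have "integral {-1..x} \<psi> = integral {-1..x} (\<lambda>x. 0)"
      using that z by (intro integral_cong) auto
    then show ?thesis by (simp add: \<phi>_def)
  qed
  have right: "\<phi> x = 0" if "b < x" for x
    using int[of x] 0 that by (simp add: \<phi>_def)
  have D: "(\<phi> has_vector_derivative \<psi> x) (at x)" for x
  proof (cases "x < a")
    case True
    have "((\<lambda>x. 0) has_vector_derivative \<psi> x) (at x)"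
      using True z[of x] by simp
    then show ?thesis
      by (rule has_vector_derivative_transform_within_open[of _ _ _ "{..<a}"]) (use True left in auto)
  next
    case False
    have "(\<phi> has_vector_derivative \<psi> x) (at x within {-1..x+1})"
      unfolding \<phi>_def by (rule integral_has_vector_derivative[OF c]) (use False ab in auto)
    then show ?thesis
      using False ab by (subst (asm) at_within_interior) auto
  qed
  have "\<phi> \<in> test_functions l"
    unfolding test_functions_def C1_differentiable_on_def
  proof (intro CollectI conjI exI ballI)
    show "(\<phi> has_vector_derivative \<psi> x) (at x)" for x by (rule D)
    show "continuous_on UNIV \<psi>" by fact
    show "compact {a..b}" by simp
    show "{a..b} \<subseteq> {0<..<l}" using ab by auto
    show "\<forall>x. x \<notin> {a..b} \<longrightarrow> \<phi> x = 0"
      using left right by (auto simp: not_le)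
  qed
  moreover have "deriv \<phi> = \<psi>"
    by (rule ext, rule DERIV_imp_deriv) (use D in \<open>simp add: has_real_derivative_iff_has_vector_derivative\<close>)
  ultimately show ?thesis using that by blast
qed

text \<open>The lemma of du Bois-Reymond: testing with \<open>\<psi> - (\<integral>\<psi>) \<psi>\<^sub>0\<close>, where \<open>\<psi>\<^sub>0\<close> has mean one, shows that
  \<open>z - c\<close> is orthogonal to all \<open>\<psi>\<close>, and trapezoidal \<open>\<psi>\<close> increase to the indicator of \<open>(0,x)\<close>.\<close>

lemma weak_deriv_zero_imp_constant:
  assumes l: "0 < l" and z: "l2 0 l z"
    and w: "\<And>\<phi>. \<phi> \<in> test_functions l \<Longrightarrow> integral {0..l} (\<lambda>x. z x * deriv \<phi> x) = 0"
  obtains c where "aeq 0 l z (\<lambda>x. c)"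
proof -
  \<comment> \<open>A hat on the middle half of the interval, to be normalized by its mean \<open>I0\<close>.\<close>
  define \<psi>0 where "\<psi>0 = (\<lambda>t. max 0 (min (t - l/4) (3*l/4 - t)))"
  have c0: "continuous_on S \<psi>0" for S unfolding \<psi>0_def by (intro continuous_intros)
  define I0 where "I0 = integral {0..l} \<psi>0"
  have "I0 \<noteq> 0"
  proof
    assume "I0 = 0"
    then have "\<forall>x\<in>{0..l}. \<psi>0 x = 0"
      unfolding I0_def by (subst (asm) integral_eq_0_iff) (use l c0 in \<open>auto simp: \<psi>0_def\<close>)
    then have "\<psi>0 (l/2) = 0" using l by auto
    then show False using l by (simp add: \<psi>0_def field_simps max_def min_def split: if_splits)
  qed
  define c where "c = integral {0..l} (\<lambda>x. z x * \<psi>0 x) / I0"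
  have zc: "l2 0 l (\<lambda>x. z x - c)" by (intro l2_diff z l2_const)
  have orth: "integral {0..l} (\<lambda>x. (z x - c) * \<psi> x) = 0"
    if \<psi>: "continuous_on UNIV \<psi>" "0 < a" "b < l" "\<And>x. x \<notin> {a..b} \<Longrightarrow> \<psi> x = 0" for \<psi> a b
  proof -
    define m where "m = integral {0..l} \<psi> / I0"
    have c\<psi>: "l2 0 l \<psi>" "l2 0 l \<psi>0"
      using \<psi> c0 by (auto intro!: l2_continuous intro: continuous_on_subset)
    have "integral {0..l} (\<lambda>x. \<psi> x - m * \<psi>0 x) = integral {0..l} \<psi> - m * I0"
      using c\<psi> by (simp add: integral_diff integrable_on_mult_right l2_integrable I0_def)
    also have "\<dots> = 0" using \<open>I0 \<noteq> 0\<close> by (simp add: m_def)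
    finally have mean: "integral {0..l} (\<lambda>x. \<psi> x - m * \<psi>0 x) = 0" .
    obtain \<phi> where \<phi>: "\<phi> \<in> test_functions l" "deriv \<phi> = (\<lambda>x. \<psi> x - m * \<psi>0 x)"
    proof (rule test_function_of_derivative[of "\<lambda>x. \<psi> x - m * \<psi>0 x" "min a (l/4)" "max b (3*l/4)" l])
      show "continuous_on UNIV (\<lambda>x. \<psi> x - m * \<psi>0 x)"
        using \<psi>(1) c0 by (intro continuous_intros)
      show "\<psi> x - m * \<psi>0 x = 0" if "x \<notin> {min a (l/4)..max b (3*l/4)}" for x
      proof -
        have "x \<notin> {a..b}" using that by auto
        moreover have "\<psi>0 x = 0" using that by (auto simp: \<psi>0_def max_def min_def split: if_splits)
        ultimately show ?thesis using \<psi>(4) by simp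
      qed
    qed (use l \<psi> mean in auto)
    have "0 = integral {0..l} (\<lambda>x. z x * \<psi> x - m * (z x * \<psi>0 x))"
      using w[OF \<phi>(1)] by (simp add: \<phi>(2) algebra_simps)
    also have "\<dots> = integral {0..l} (\<lambda>x. z x * \<psi> x) - m * (c * I0)"
      using c\<psi> z \<open>I0 \<noteq> 0\<close> by (simp add: integral_diff integrable_on_mult_right l2_mult_integrable c_def)
    also have "m * (c * I0) = c * integral {0..l} \<psi>"
      using \<open>I0 \<noteq> 0\<close> by (simp add: m_def)
    also have "integral {0..l} (\<lambda>x. z x * \<psi> x) - c * integral {0..l} \<psi>
        = integral {0..l} (\<lambda>x. (z x - c) * \<psi> x)"
      using c\<psi> z by (simp add: left_diff_distrib integral_diff integrable_on_mult_right
          l2_mult_integrable l2_integrable)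
    finally show ?thesis by simp
  qed
  have "aeq 0 l (\<lambda>x. z x - c) (\<lambda>x. 0)"
  proof (rule aeq_zero_if_primitive_zero[OF l2_absolutely_integrable[OF zc]])
    fix x assume x: "x \<in> {0..l}"
    \<comment> \<open>Trapezoids supported in \<open>[1/n, x - 1/n]\<close>: the interval \<open>(0,x)\<close> itself touches the end of the edge.\<close>
    define \<tau> where "\<tau> = (\<lambda>n t. max 0 (min 1 (real n * min t (x - t) - 1)))"
    have \<tau>0: "\<tau> (Suc n) t = 0" if "t \<notin> {1 / Suc n..x - 1 / Suc n}" for n t
    proof -
      have "min t (x - t) < 1 / Suc n" using that by auto
      then have "real (Suc n) * min t (x - t) < 1" by (simp add: field_simps)
      then show ?thesis by (simp add: \<tau>_def)
    qed
    have c\<tau>: "continuous_on S (\<tau> n)" for S n unfolding \<tau>_def by (intro continuous_intros)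
    have z0: "integral {0..l} (\<lambda>t. (z t - c) * \<tau> (Suc n) t) = 0" for n
    proof (rule orth[of _ "1 / Suc n" "x - 1 / Suc n"])
      have "0 < 1 / real (Suc n)" by simp
      then show "x - 1 / Suc n < l" using x by (simp only: atLeastAtMost_iff) linarith
    qed (use \<tau>0 c\<tau> in auto)
    have lim: "(\<lambda>n. (z t - c) * \<tau> (Suc n) t) \<longlonglongrightarrow> (z t - c) * (if t \<in> {0<..<x} then 1 else 0)" for t
    proof (rule tendsto_mult[OF tendsto_const])
      show "(\<lambda>n. \<tau> (Suc n) t) \<longlonglongrightarrow> (if t \<in> {0<..<x} then 1 else 0)"
      proof (cases "t \<in> {0<..<x}")
        case True
        define e where "e = min t (x - t)"
        have e: "0 < e" using True by (simp add: e_def)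
        obtain N :: nat where N: "2 / e < N" using reals_Archimedean2 by blast
        have "\<tau> (Suc n) t = 1" if "N \<le> n" for n
        proof -
          have "2 / e < real (Suc n)" using N that by linarith
          then have "2 < real (Suc n) * e" using e by (simp add: divide_less_eq)
          then show ?thesis by (simp add: \<tau>_def e_def)
        qed
        then have "\<forall>\<^sub>F n in sequentially. \<tau> (Suc n) t = 1" using eventually_sequentially by blast
        then show ?thesis using True by (simp add: tendsto_eventually)
      next
        case False
        then have "min t (x - t) \<le> 0" by auto
        then have "real (Suc n) * min t (x - t) \<le> 0" for n by (simp add: mult_nonneg_nonpos)
        then have "\<tau> (Suc n) t = 0" for n
          using order_trans[of "real (Suc n) * min t (x - t)" 0 1] by (simp add: \<tau>_def)
        then show ?thesis using False by auto
      qed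
    qed
    have "(\<lambda>n. integral {0..l} (\<lambda>t. (z t - c) * \<tau> (Suc n) t)) \<longlonglongrightarrow>
        integral {0..l} (\<lambda>t. (z t - c) * (if t \<in> {0<..<x} then 1 else 0))"
    proof (rule dominated_convergence(2)[where h="\<lambda>t. \<bar>z t - c\<bar>"])
      show "(\<lambda>t. (z t - c) * \<tau> (Suc n) t) integrable_on {0..l}" for n
        by (intro l2_mult_integrable zc l2_continuous c\<tau>)
      show "(\<lambda>t. \<bar>z t - c\<bar>) integrable_on {0..l}" by (intro l2_integrable l2_abs zc)
      show "norm ((z t - c) * \<tau> (Suc n) t) \<le> \<bar>z t - c\<bar>" for n t
        by (auto simp: \<tau>_def abs_mult intro!: mult_left_le)
    qed (use lim in auto)
    then have "integral {0..l} (\<lambda>t. (z t - c) * (if t \<in> {0<..<x} then 1 else 0)) = 0"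
      by (simp add: z0 LIMSEQ_const_iff)
    also have "(\<lambda>t. (z t - c) * (if t \<in> {0<..<x} then 1 else 0)) = (\<lambda>t. if t \<in> {0<..<x} then z t - c else 0)"
      by auto
    also have "integral {0..l} \<dots> = integral {0<..<x} (\<lambda>t. z t - c)"
      using x by (intro integral_restrict_subset) auto
    finally show "integral {0..x} (\<lambda>t. z t - c) = 0"
      by (simp add: integral_open_interval_real)
  qed
  then show ?thesis using that[of c] by (simp add: aeq_def)
qed

lemma prim_integral:
  assumes "l2 0 l g"
  shows "prim l (\<lambda>x. integral {0..x} g) g"
  using assms by (simp add: prim_def)

text \<open>The primitive \<open>G\<close> of \<open>g\<close> has the same weak derivative as
  \<open>y\<close>, so \<open>y - G\<close> is constant.\<close>

lemma weak_deriv_imp_prim: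
  assumes l: "0 < l" and y: "l2 0 l y" and g: "l2 0 l g" and w: "is_weak_deriv l y g"
  obtains Y where "prim l Y g" "aeq 0 l y Y"
proof -
  define G where "G = (\<lambda>x. integral {0..x} g)"
  have G: "prim l G g" unfolding G_def by (rule prim_integral[OF g])
  note G2 = prim_l2_self[OF G]
  obtain c where c: "aeq 0 l (\<lambda>x. y x - G x) (\<lambda>x. c)"
  proof (rule weak_deriv_zero_imp_constant[OF l l2_diff[OF y G2]])
    fix \<phi> assume \<phi>: "\<phi> \<in> test_functions l"
    then obtain D where "continuous_on UNIV D" "deriv \<phi> = D"
      by (meson test_functionE)
    then have l2s: "l2 0 l (deriv \<phi>)"
      by (auto intro!: l2_continuous elim: continuous_on_subset)
    have "integral {0..l} (\<lambda>x. y x * deriv \<phi> x) = integral {0..l} (\<lambda>x. G x * deriv \<phi> x)"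
      using w prim_weak_deriv[OF G l] \<phi> by (simp add: is_weak_deriv_iff y g G2)
    then show "integral {0..l} (\<lambda>x. (y x - G x) * deriv \<phi> x) = 0"
      using l2s y G2 by (simp add: left_diff_distrib integral_diff l2_mult_integrable)
  qed
  have "prim l (\<lambda>x. G x + c) g"
    unfolding prim_def using g by (simp add: G_def)
  moreover have "aeq 0 l y (\<lambda>x. G x + c)"
    using c unfolding aeq_def by (simp only: diff_eq_eq add.commute[of c])
  ultimately show ?thesis by (rule that)
qed

lemma aeq_continuous_imp_eq:
  assumes l: "0 < l" and f: "continuous_on {0..l} f" and g: "continuous_on {0..l} g" and fg: "aeq 0 l f g"
    and x: "x \<in> {0..l}"
  shows "f x = g x"
proof -
  have "continuous_on {0..l} (\<lambda>x. (f x - g x)\<^sup>2)" using f g by (intro continuous_intros)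
  moreover have "integral {0..l} (\<lambda>x. (f x - g x)\<^sup>2) = 0"
    using aeq_integral[OF aeq_cong2[OF fg aeq_refl[of 0 l g], of "\<lambda>_ u v. (u - v)\<^sup>2"]] by simp
  ultimately have "\<forall>x\<in>{0..l}. (f x - g x)\<^sup>2 = 0"
    by (subst (asm) integral_eq_0_iff) (use l in auto)
  then show ?thesis using x by auto
qed

lemma weak_deriv_continuous_imp_prim:
  assumes "0 < l" "continuous_on {0..l} y" "l2 0 l g" "is_weak_deriv l y g"
  shows "prim l y g"
proof -
  obtain Y where Y: "prim l Y g" "aeq 0 l y Y"
    using weak_deriv_imp_prim[OF assms(1) l2_continuous[OF assms(2)] assms(3,4)] .
  have "y x = Y x" if "x \<in> {0..l}" for x
    using aeq_continuous_imp_eq[OF assms(1,2) prim_continuous[OF Y(1)] Y(2) that] .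
  then have "y x = y 0 + integral {0..x} g" if "x \<in> {0..l}" for x
    using prim_eq[OF Y(1) that] that assms(1) by simp
  then show ?thesis unfolding prim_def using assms(3) by blast
qed

lemma H1_edgeI: "0 < l \<Longrightarrow> prim l y g \<Longrightarrow> y \<in> H1_edge l"
  unfolding H1_edge_def using prim_weak_deriv prim_l2 prim_l2_self by (blast intro: L2_edge_iff[THEN iffD2])

lemma wderiv_H1_edge:
  assumes "y \<in> H1_edge l"
  shows "wderiv l y \<in> L2_edge l \<and> is_weak_deriv l y (wderiv l y)"
  unfolding wderiv_def by (rule someI_ex[of "\<lambda>g. g \<in> L2_edge l \<and> is_weak_deriv l y g"]) (use assms in \<open>auto simp: H1_edge_def\<close>)

lemma prim_wderiv:
  assumes "0 < l" "continuous_on {0..l} y" "y \<in> H1_edge l"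
  shows "prim l y (wderiv l y)"
  using wderiv_H1_edge[OF assms(3)] assms by (intro weak_deriv_continuous_imp_prim) (auto simp: L2_edge_iff)

lemma wderiv_aeq:
  assumes "0 < l" "prim l y g"
  shows "aeq 0 l (wderiv l y) g"
  using prim_unique[OF prim_wderiv[OF assms(1) prim_continuous[OF assms(2)] H1_edgeI[OF assms]] assms(2)] .

section \<open>Completeness and interpolation on an edge\<close>

lemma l2_lebesgue:
  "l2 a b f \<longleftrightarrow> f \<in> borel_measurable (lebesgue_on {a..b}) \<and> integrable (lebesgue_on {a..b}) (\<lambda>x. (f x)\<^sup>2)"
proof
  assume "l2 a b f"
  then show "f \<in> borel_measurable (lebesgue_on {a..b}) \<and> integrable (lebesgue_on {a..b}) (\<lambda>x. (f x)\<^sup>2)"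
    using l2_mult[of a b f f] by (auto simp: l2_def power2_eq_square absolutely_integrable_imp_integrable)
next
  assume "f \<in> borel_measurable (lebesgue_on {a..b}) \<and> integrable (lebesgue_on {a..b}) (\<lambda>x. (f x)\<^sup>2)"
  then show "l2 a b f" by (auto simp: l2_def intro: integrable_on_lebesgue_on)
qed

text \<open>Completeness of \<open>L\<^sup>2\<close>, for sequences whose increments decay geometrically: the increments are
  absolutely summable almost everywhere, and Fatou's lemma bounds the distance to the limit.\<close>

lemma l2_complete:
  assumes ab: "a \<le> b" and g: "\<And>n. l2 a b (g n)"
    and C: "\<And>n m. n \<le> m \<Longrightarrow> integral {a..b} (\<lambda>x. (g m x - g n x)\<^sup>2) \<le> B * (1/4) ^ n"
  obtains G where "l2 a b G" "\<And>n. integral {a..b} (\<lambda>x. (g n x - G x)\<^sup>2) \<le> B * (1/4) ^ n"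
proof -
  let ?M = "lebesgue_on {a..b}"
  have gm [measurable]: "g n \<in> borel_measurable ?M" for n using g by (simp add: l2_def)
  have B: "0 \<le> B" using C[of 0 0] by simp
  define s where "s = (\<lambda>k x. \<bar>g (Suc k) x - g k x\<bar>)"
  have l2s: "l2 a b (s k)" for k unfolding s_def by (intro l2_abs l2_diff g)
  have sm [measurable]: "s k \<in> borel_measurable ?M" for k using l2s by (simp add: l2_def)
  have s_le: "integral {a..b} (s k) \<le> sqrt ((b - a) * B) * (1/2) ^ k" for k
  proof (rule power2_le_imp_le)
    have "(integral {a..b} (s k))\<^sup>2 \<le> (b - a) * integral {a..b} (\<lambda>x. (g (Suc k) x - g k x)\<^sup>2)"
      using l2_integral_abs_sq_le[OF l2_diff[OF g g] ab, of "Suc k" k] by (simp add: s_def)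
    also have "\<dots> \<le> (b - a) * (B * (1/4) ^ k)"
      using ab by (intro mult_left_mono C) auto
    also have "\<dots> = (sqrt ((b - a) * B) * (1/2) ^ k)\<^sup>2"
      using ab B by (simp add: power_mult_distrib power_even_eq[symmetric] power_divide)
        (simp add: power_mult[symmetric] mult.commute[of k 2] power_mult)
    finally show "(integral {a..b} (s k))\<^sup>2 \<le> \<dots>" .
  qed (use ab B in auto)
  have nn: "(\<integral>\<^sup>+x. ennreal (s k x) \<partial>?M) = ennreal (integral {a..b} (s k))" for k
  proof -
    have i: "integrable ?M (s k)"
      by (rule absolutely_integrable_imp_integrable[OF l2_absolutely_integrable[OF l2s]]) simp
    show ?thesis
      using nn_integral_eq_integral[OF i] lebesgue_integral_eq_integral[OF i] by (simp add: s_def)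
  qed
  have "(\<integral>\<^sup>+x. (\<Sum>k. ennreal (s k x)) \<partial>?M) = (\<Sum>k. ennreal (integral {a..b} (s k)))"
    by (subst nn_integral_suminf) (auto simp: nn)
  also have "\<dots> \<le> (\<Sum>k. ennreal (sqrt ((b - a) * B) * (1/2) ^ k))"
    by (intro suminf_le ennreal_leI s_le) auto
  also have "\<dots> < top"
    using ab B by (subst suminf_ennreal_eq[OF _ sums_mult[OF geometric_sums]]) auto
  finally have "AE x in ?M. (\<Sum>k. ennreal (s k x)) \<noteq> \<infinity>"
    by (intro nn_integral_PInf_AE) auto
  then have conv: "AE x in ?M. summable (\<lambda>k. g (Suc k) x - g k x)"
  proof eventually_elim
    case (elim x)
    then have "summable (\<lambda>k. s k x)"
      by (intro summable_suminf_not_top) (auto simp: s_def)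
    then show ?case unfolding s_def by (rule summable_rabs_cancel)
  qed
  define G where "G = (\<lambda>x. g 0 x + (\<Sum>k. g (Suc k) x - g k x))"
  have Gm [measurable]: "G \<in> borel_measurable ?M" unfolding G_def by measurable
  have lim: "AE x in ?M. (\<lambda>m. g m x) \<longlonglongrightarrow> G x"
    using conv
  proof eventually_elim
    case (elim x)
    have "(\<lambda>m. g 0 x + (\<Sum>k<m. g (Suc k) x - g k x)) \<longlonglongrightarrow> G x"
      unfolding G_def by (intro tendsto_intros summable_LIMSEQ elim)
    moreover have "g 0 x + (\<Sum>k<m. g (Suc k) x - g k x) = g m x" for m
      using sum_lessThan_telescope[of "\<lambda>k. g k x" m] by simp
    ultimately show ?case by simp
  qed
  have fatou: "(\<integral>\<^sup>+x. ennreal ((g n x - G x)\<^sup>2) \<partial>?M) \<le> ennreal (B * (1/4) ^ n)" for n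
  proof -
    have "(\<integral>\<^sup>+x. ennreal ((g n x - G x)\<^sup>2) \<partial>?M)
        = (\<integral>\<^sup>+x. liminf (\<lambda>m. ennreal ((g n x - g m x)\<^sup>2)) \<partial>?M)"
    proof (rule nn_integral_cong_AE, use lim in eventually_elim)
      case (elim x)
      have "(\<lambda>m. ennreal ((g n x - g m x)\<^sup>2)) \<longlonglongrightarrow> ennreal ((g n x - G x)\<^sup>2)"
        by (intro tendsto_intros elim)
      then show ?case by (intro lim_imp_Liminf[symmetric]) auto
    qed
    also have "\<dots> \<le> liminf (\<lambda>m. \<integral>\<^sup>+x. ennreal ((g n x - g m x)\<^sup>2) \<partial>?M)"
      by (rule nn_integral_liminf) auto
    also have "\<dots> \<le> liminf (\<lambda>m. ennreal (B * (1/4) ^ n))"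
    proof (rule Liminf_mono)
      have "(\<integral>\<^sup>+x. ennreal ((g n x - g m x)\<^sup>2) \<partial>?M) \<le> ennreal (B * (1/4) ^ n)" if "n \<le> m" for m
      proof -
        have i: "integrable ?M (\<lambda>x. (g n x - g m x)\<^sup>2)"
          using l2_diff[OF g g] by (simp add: l2_lebesgue)
        have "integral {a..b} (\<lambda>x. (g n x - g m x)\<^sup>2) \<le> B * (1/4) ^ n"
          using C[OF that] by (simp add: power2_commute)
        then show ?thesis
          using nn_integral_eq_integral[OF i] lebesgue_integral_eq_integral[OF i] by (simp add: ennreal_leI)
      qed
      then show "\<forall>\<^sub>F m in sequentially. (\<integral>\<^sup>+x. ennreal ((g n x - g m x)\<^sup>2) \<partial>?M) \<le> ennreal (B * (1/4) ^ n)"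
        using eventually_sequentially by blast
    qed
    also have "\<dots> = ennreal (B * (1/4) ^ n)" by (simp add: Liminf_const)
    finally show ?thesis .
  qed
  have l2d: "l2 a b (\<lambda>x. g n x - G x)" for n
    unfolding l2_lebesgue
  proof
    show "integrable ?M (\<lambda>x. (g n x - G x)\<^sup>2)"
    proof (rule integrableI_bounded)
      have "(\<integral>\<^sup>+x. ennreal (norm ((g n x - G x)\<^sup>2)) \<partial>?M) \<le> ennreal (B * (1/4) ^ n)"
        using fatou[of n] by simp
      also have "\<dots> < \<infinity>" by simp
      finally show "(\<integral>\<^sup>+x. ennreal (norm ((g n x - G x)\<^sup>2)) \<partial>?M) < \<infinity>" .
    qed measurable
  qed measurable
  have "l2 a b G" using l2_diff[OF g[of 0] l2d[of 0]] by simp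
  moreover have "integral {a..b} (\<lambda>x. (g n x - G x)\<^sup>2) \<le> B * (1/4) ^ n" for n
  proof -
    have i: "integrable ?M (\<lambda>x. (g n x - G x)\<^sup>2)" using l2d by (simp add: l2_lebesgue)
    have "ennreal (integral {a..b} (\<lambda>x. (g n x - G x)\<^sup>2)) \<le> ennreal (B * (1/4) ^ n)"
      using fatou[of n] nn_integral_eq_integral[OF i] lebesgue_integral_eq_integral[OF i] by simp
    then show ?thesis using B by (subst (asm) ennreal_le_iff) auto
  qed
  ultimately show ?thesis by (rule that)
qed

lemma integral_minus_const:
  assumes "l2 a b f" "a \<le> b"
  shows "integral {a..b} (\<lambda>x. f x - c) = integral {a..b} f - c * (b - a)"
  using assms by (subst integral_diff) (auto simp: l2_integrable l2_const)

lemma prim_increment_sq_le: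
  assumes y: "prim l y g" and "a \<in> {s..t}" "b \<in> {s..t}" "0 \<le> s" "t \<le> l"
  shows "(y b - y a)\<^sup>2 \<le> (t - s) * integral {s..t} (\<lambda>x. (g x)\<^sup>2)"
proof -
  have *: "(y b - y a)\<^sup>2 \<le> (t - s) * integral {s..t} (\<lambda>x. (g x)\<^sup>2)"
    if "a \<in> {s..t}" "b \<in> {s..t}" "a \<le> b" for a b
  proof -
    have i: "(\<lambda>x. (g x)\<^sup>2) integrable_on {c..d}" if "0 \<le> c" "d \<le> l" for c d
      using that by (intro l2_sq_integrable l2_subinterval[OF prim_l2[OF y]]) auto
    have le: "integral {a..b} (\<lambda>x. (g x)\<^sup>2) \<le> integral {s..t} (\<lambda>x. (g x)\<^sup>2)"
      using that assms(4,5) by (intro integral_subset_le i) auto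
    have "(y b - y a)\<^sup>2 \<le> (b - a) * integral {a..b} (\<lambda>x. (g x)\<^sup>2)"
      using that assms(4,5) by (intro prim_increment_sq[OF y]) auto
    also have "\<dots> \<le> (t - s) * integral {s..t} (\<lambda>x. (g x)\<^sup>2)"
      using that assms(4,5) le by (intro mult_mono integral_nonneg i) auto
    finally show ?thesis .
  qed
  show ?thesis
    using *[of a b] *[of b a] assms(2,3) by (cases "a \<le> b") (auto simp: power2_commute)
qed

text \<open>Integrate \<open>(y x)\<^sup>2 \<le> 2 (y t)\<^sup>2 + 2 (y x - y t)\<^sup>2\<close> over
  \<open>t\<close>. The bound makes point values, and thereby vertex values, continuous in the
  \<open>H1\<close> norm.\<close>

lemma prim_sup_bound:
  assumes y: "prim l y g" and l: "0 < l" and x: "x \<in> {0..l}"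
  shows "(y x)\<^sup>2 \<le> 2 / l * integral {0..l} (\<lambda>t. (y t)\<^sup>2) + 2 * l * integral {0..l} (\<lambda>t. (g t)\<^sup>2)"
proof -
  define A where "A = integral {0..l} (\<lambda>t. (g t)\<^sup>2)"
  have pt: "(y x)\<^sup>2 \<le> 2 * (y t)\<^sup>2 + 2 * l * A" if "t \<in> {0..l}" for t
  proof -
    have "(y x - y t)\<^sup>2 \<le> l * A"
      using prim_increment_sq_le[OF y that x] by (simp add: A_def)
    moreover have "(y x)\<^sup>2 \<le> 2 * (y t)\<^sup>2 + 2 * (y x - y t)\<^sup>2"
      using sum_squares_ge_zero[of "y x - 2 * y t" 0] by (simp add: power2_eq_square algebra_simps)
    ultimately show ?thesis by linarith
  qed
  have i: "(\<lambda>t. (y t)\<^sup>2) integrable_on {0..l}" by (rule l2_sq_integrable[OF prim_l2_self[OF y]])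
  have "integral {0..l} (\<lambda>t. (y x)\<^sup>2) \<le> integral {0..l} (\<lambda>t. 2 * (y t)\<^sup>2 + 2 * l * A)"
    by (rule integral_le) (use pt in \<open>auto intro!: integrable_add integrable_on_mult_right i\<close>)
  also have "\<dots> = 2 * integral {0..l} (\<lambda>t. (y t)\<^sup>2) + l * (2 * l * A)"
    using l by (subst integral_add) (auto intro!: integrable_on_mult_right i)
  finally have "l * (y x)\<^sup>2 \<le> \<dots>" using l by simp
  then show ?thesis using l by (simp add: A_def field_simps)
qed

text \<open>The derivatives converge in \<open>L\<^sup>2\<close>, and by \<open>prim_sup_bound\<close> the
  functions converge at every point. Pointwise convergence is recorded since vertex conditions
  and piecewise affinity are closed under it.\<close>

lemma prim_complete:
  assumes l: "0 < l" and y: "\<And>n. prim l (y n) (g n)"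
    and C: "\<And>n m. n \<le> m \<Longrightarrow> integral {0..l} (\<lambda>x. (y m x - y n x)\<^sup>2)
      + integral {0..l} (\<lambda>x. (g m x - g n x)\<^sup>2) \<le> B * (1/4) ^ n"
  obtains Y G where "prim l Y G" "\<And>x. x \<in> {0..l} \<Longrightarrow> (\<lambda>n. y n x) \<longlonglongrightarrow> Y x"
    "(\<lambda>n. integral {0..l} (\<lambda>x. (y n x - Y x)\<^sup>2) + integral {0..l} (\<lambda>x. (g n x - G x)\<^sup>2)) \<longlonglongrightarrow> 0"
proof -
  have d: "prim l (\<lambda>x. y m x - y n x) (\<lambda>x. g m x - g n x)" for m n
    using prim_comb[OF y y, of m "-1" n] by simp
  have nn: "0 \<le> integral {0..l} (\<lambda>x. (y m x - y n x)\<^sup>2)" "0 \<le> integral {0..l} (\<lambda>x. (g m x - g n x)\<^sup>2)" for m n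
    by (intro integral_nonneg l2_sq_integrable l2_diff prim_l2[OF y] prim_l2_self[OF y]; simp)+
  have gC: "integral {0..l} (\<lambda>x. (g m x - g n x)\<^sup>2) \<le> B * (1/4) ^ n" if "n \<le> m" for m n
    using C[OF that] nn(1)[of m n] by linarith
  obtain G where G: "l2 0 l G" "\<And>n. integral {0..l} (\<lambda>x. (g n x - G x)\<^sup>2) \<le> B * (1/4) ^ n"
    using l2_complete[OF less_imp_le[OF l] prim_l2[OF y] gC] by blast
  have nG: "0 \<le> integral {0..l} (\<lambda>x. (g n x - G x)\<^sup>2)" for n
    by (intro integral_nonneg l2_sq_integrable l2_diff prim_l2[OF y] G) simp
  have p0: "(\<lambda>n. K * (1/4) ^ n) \<longlonglongrightarrow> 0" for K :: real
    by (intro tendsto_mult_right_zero LIMSEQ_power_zero) simp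
  have limg: "(\<lambda>n. integral {0..l} (\<lambda>x. (g n x - G x)\<^sup>2)) \<longlonglongrightarrow> 0"
    by (rule tendsto_sandwich[OF _ _ tendsto_const p0[of B]]) (use nG G in auto)
  define K where "K = (2 / l + 2 * l) * B"
  have B: "0 \<le> B" using C[of 0 0] nn[of 0 0] by simp
  have ptC: "(y m x - y n x)\<^sup>2 \<le> K * (1/4) ^ n" if "n \<le> m" "x \<in> {0..l}" for m n x
  proof -
    have "integral {0..l} (\<lambda>x. (y m x - y n x)\<^sup>2) \<le> B * (1/4) ^ n"
      using C[OF that(1)] nn(2)[of m n] by linarith
    then have "2 / l * integral {0..l} (\<lambda>x. (y m x - y n x)\<^sup>2) + 2 * l * integral {0..l} (\<lambda>x. (g m x - g n x)\<^sup>2)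
       \<le> 2 / l * (B * (1/4) ^ n) + 2 * l * (B * (1/4) ^ n)"
      using gC[OF that(1)] l by (intro add_mono mult_left_mono) auto
    also have "\<dots> = K * (1/4) ^ n" by (simp add: K_def algebra_simps)
    finally show ?thesis using prim_sup_bound[OF d l that(2), of m n] by linarith
  qed
  have conv: "convergent (\<lambda>n. y n x)" if x: "x \<in> {0..l}" for x
  proof (rule real_Cauchy_convergent, rule metric_CauchyI)
    fix e :: real assume e: "0 < e"
    obtain N where N: "K * (1/4) ^ N < (e/2)\<^sup>2"
    proof -
      have "\<forall>\<^sub>F n in sequentially. K * (1/4) ^ n < (e/2)\<^sup>2"
        using e by (intro order_tendstoD(2)[OF p0]) auto
      then show ?thesis using that by (auto simp: eventually_sequentially)
    qed
    have "\<bar>y m x - y N x\<bar> < e/2" if "N \<le> m" for m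
    proof -
      have "\<bar>y m x - y N x\<bar>\<^sup>2 < (e/2)\<^sup>2" using ptC[OF that x] N by simp
      then show ?thesis by (rule power2_less_imp_less) (use e in simp)
    qed
    then have "dist (y m x) (y n x) < e" if "N \<le> m" "N \<le> n" for m n
      using that unfolding dist_real_def by (smt (verit) field_sum_of_halves)
    then show "\<exists>M. \<forall>m\<ge>M. \<forall>n\<ge>M. dist (y m x) (y n x) < e" by blast
  qed
  define Y where "Y = (\<lambda>x. lim (\<lambda>n. y n x))"
  have limY: "(\<lambda>n. y n x) \<longlonglongrightarrow> Y x" if "x \<in> {0..l}" for x
    using conv[OF that] by (simp add: Y_def convergent_LIMSEQ_iff)
  have Yprim: "prim l Y G"
    unfolding prim_def
  proof (intro conjI ballI)
    show "l2 0 l G" by fact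
    fix x assume x: "x \<in> {0..l}"
    have l2x: "l2 0 x (g n)" "l2 0 x G" for n
      using x by (auto intro!: l2_subinterval[OF prim_l2[OF y]] l2_subinterval[OF G(1)])
    have bound: "(integral {0..x} (g n) - integral {0..x} G)\<^sup>2 \<le> l * (B * (1/4) ^ n)" for n
    proof -
      have "(integral {0..x} (g n) - integral {0..x} G)\<^sup>2 = (integral {0..x} (\<lambda>x. (g n x - G x) * 1))\<^sup>2"
        using l2x by (simp add: integral_diff l2_integrable)
      also have "\<dots> \<le> integral {0..x} (\<lambda>x. (g n x - G x)\<^sup>2) * integral {0..x} (\<lambda>x. 1\<^sup>2)"
        by (rule l2_Cauchy_Schwarz[OF l2_diff[OF l2x] l2_const])
      also have "\<dots> = x * integral {0..x} (\<lambda>x. (g n x - G x)\<^sup>2)" using x by simp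
      also have "\<dots> \<le> l * integral {0..l} (\<lambda>x. (g n x - G x)\<^sup>2)"
        using x by (intro mult_mono integral_subset_le integral_nonneg l2_sq_integrable
            l2_diff l2x prim_l2[OF y] G) auto
      also have "\<dots> \<le> l * (B * (1/4) ^ n)" using l G(2) by (intro mult_left_mono) auto
      finally show ?thesis .
    qed
    have "(\<lambda>n. (integral {0..x} (g n) - integral {0..x} G)\<^sup>2) \<longlonglongrightarrow> 0"
      by (rule tendsto_sandwich[OF _ _ tendsto_const p0[of "l * B"]]) (use bound in \<open>auto simp: mult.assoc\<close>)
    then have "(\<lambda>n. integral {0..x} (g n) - integral {0..x} G) \<longlonglongrightarrow> 0"
      using tendsto_real_sqrt tendsto_rabs_zero_cancel by fastforce
    then have "(\<lambda>n. integral {0..x} (g n)) \<longlonglongrightarrow> integral {0..x} G"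
      by (rule LIM_zero_cancel)
    then have "(\<lambda>n. y n 0 + integral {0..x} (g n)) \<longlonglongrightarrow> Y 0 + integral {0..x} G"
      using l by (intro tendsto_add limY) auto
    then have "(\<lambda>n. y n x) \<longlonglongrightarrow> Y 0 + integral {0..x} G"
      using prim_eq[OF y x] by simp
    then show "Y x = Y 0 + integral {0..x} G"
      using limY[OF x] LIMSEQ_unique by blast
  qed
  have dY: "prim l (\<lambda>x. y n x - Y x) (\<lambda>x. g n x - G x)" for n
    using prim_comb[OF y Yprim, of n "-1"] by simp
  have ptY: "(y n x - Y x)\<^sup>2 \<le> K * (1/4) ^ n" if "x \<in> {0..l}" for n x
  proof (rule LIMSEQ_le_const2)
    show "(\<lambda>m. (y n x - y m x)\<^sup>2) \<longlonglongrightarrow> (y n x - Y x)\<^sup>2"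
      by (intro tendsto_intros limY that)
    show "\<exists>N. \<forall>m\<ge>N. (y n x - y m x)\<^sup>2 \<le> K * (1/4) ^ n"
    proof (intro exI allI impI)
      show "(y n x - y m x)\<^sup>2 \<le> K * (1/4) ^ n" if "n \<le> m" for m
        using ptC[OF that \<open>x \<in> {0..l}\<close>] by (subst power2_commute)
    qed
  qed
  have "integral {0..l} (\<lambda>x. (y n x - Y x)\<^sup>2) \<le> (l * K) * (1/4) ^ n" for n
  proof -
    have "integral {0..l} (\<lambda>x. (y n x - Y x)\<^sup>2) \<le> integral {0..l} (\<lambda>x. K * (1/4) ^ n)"
      by (rule integral_le) (use ptY in \<open>auto intro!: l2_sq_integrable prim_l2_self[OF dY]\<close>)
    then show ?thesis using l by (simp add: mult_ac)
  qed
  then have "(\<lambda>n. integral {0..l} (\<lambda>x. (y n x - Y x)\<^sup>2)) \<longlonglongrightarrow> 0"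
    by (intro tendsto_sandwich[OF _ _ tendsto_const p0[of "l * K"]])
      (auto intro!: always_eventually integral_nonneg l2_sq_integrable prim_l2_self[OF dY])
  from tendsto_add[OF this limg] show ?thesis
    by (intro that[OF Yprim limY]) auto
qed

text \<open>The derivative is determined only almost everywhere, so the slope is recovered from the
  primitive.\<close>

lemma aeq_const_on_affine_piece:
  assumes y: "prim l y g" and st: "0 \<le> s" "t \<le> l"
    and aff: "\<And>x. x \<in> {s..t} \<Longrightarrow> y x = y s + m * (x - s)"
  shows "aeq s t g (\<lambda>x. m)"
proof -
  have l2g: "l2 s t g" using st by (intro l2_subinterval[OF prim_l2[OF y]]) auto
  have "aeq s t (\<lambda>x. g x - m) (\<lambda>x. 0)"
  proof (rule aeq_zero_if_primitive_zero)
    show "(\<lambda>x. g x - m) absolutely_integrable_on {s..t}"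
      by (intro l2_absolutely_integrable l2_diff l2g l2_const)
    fix x assume x: "x \<in> {s..t}"
    have "l2 s x g" using x st by (intro l2_subinterval[OF l2g]) auto
    then have "integral {s..x} (\<lambda>x. g x - m) = integral {s..x} g - m * (x - s)"
      using x by (intro integral_minus_const) auto
    also have "integral {s..x} g = y x - y s"
      using x st by (intro prim_increment[OF y, symmetric]) auto
    finally show "integral {s..x} (\<lambda>x. g x - m) = 0" using aff[OF x] by simp
  qed
  then show ?thesis by (simp add: aeq_def)
qed

lemma integral_split_pieces:
  fixes f :: "real \<Rightarrow> real"
  assumes "0 \<le> \<delta>" "f integrable_on {0..real n * \<delta>}"
  shows "integral {0..real n * \<delta>} f = (\<Sum>k<n. integral {real k * \<delta>..real (Suc k) * \<delta>} f)"
  using assms(2)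
proof (induction n)
  case (Suc n)
  have le: "real n * \<delta> \<le> real (Suc n) * \<delta>" "0 \<le> real n * \<delta>"
    using assms(1) by (auto intro: mult_right_mono)
  then have "integral {0..real n * \<delta>} f + integral {real n * \<delta>..real (Suc n) * \<delta>} f
      = integral {0..real (Suc n) * \<delta>} f"
    by (intro Henstock_Kurzweil_Integration.integral_combine Suc.prems)
  moreover have "f integrable_on {0..real n * \<delta>}"
    using le by (intro integrable_on_subinterval[OF Suc.prems]) auto
  ultimately show ?case using Suc.IH by simp
qed simp

lemma in_some_piece:
  assumes n: "1 \<le> n" and \<delta>: "\<delta> = l / real n" and l: "0 < l" and x: "x \<in> {0..l}"
  obtains k where "k < n" "x \<in> {real k * \<delta>..real (Suc k) * \<delta>}"
proof -
  have \<delta>0: "0 < \<delta>" and nl: "real n * \<delta> = l" using n l \<delta> by auto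
  define k where "k = nat \<lfloor>x / \<delta>\<rfloor>"
  have "0 \<le> x / \<delta>" using x \<delta>0 by simp
  then have k: "real k \<le> x / \<delta>" "x / \<delta> < real (Suc k)" unfolding k_def by linarith+
  then have kx: "real k * \<delta> \<le> x" "x < real (Suc k) * \<delta>" using \<delta>0 by (auto simp: field_simps)
  show ?thesis
  proof (cases "k < n")
    case True then show ?thesis using kx by (intro that[of k]) auto
  next
    case False
    then have "real n * \<delta> \<le> real k * \<delta>" using \<delta>0 by (intro mult_right_mono) auto
    then have "x = l" using kx x nl by auto
    moreover have "real (Suc (n - 1)) = real n" using n by simp
    moreover have "real (n - 1) * \<delta> \<le> real n * \<delta>" using \<delta>0 by (intro mult_right_mono) auto
    ultimately show ?thesis using n nl by (intro that[of "n - 1"]) auto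
  qed
qed

lemma pieces_le:
  assumes n: "1 \<le> n" and \<delta>: "\<delta> = l / real n" and l: "0 < l" and k: "k < n"
  shows "0 \<le> real k * \<delta>" "real k * \<delta> \<le> real (Suc k) * \<delta>" "real (Suc k) * \<delta> \<le> l"
    "real (Suc k) * \<delta> - real k * \<delta> = \<delta>"
proof -
  have \<delta>0: "0 < \<delta>" and nl: "real n * \<delta> = l" using n l \<delta> by auto
  then show "0 \<le> real k * \<delta>" "real k * \<delta> \<le> real (Suc k) * \<delta>" by (auto intro: mult_right_mono)
  have "real (Suc k) * \<delta> \<le> real n * \<delta>" using k \<delta>0 by (intro mult_right_mono) auto
  then show "real (Suc k) * \<delta> \<le> l" using nl by simp
  show "real (Suc k) * \<delta> - real k * \<delta> = \<delta>" by (simp add: algebra_simps)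
qed

text \<open>The classical derivative exists off the finitely many nodes \<open>S\<close> and takes
  finitely many values.\<close>

lemma piecewise_affine_prim:
  assumes l: "0 < l" and n: "1 \<le> n" and c: "continuous_on {0..l} y" and \<delta>: "\<delta> = l / real n"
    and aff: "\<And>k. k < n \<Longrightarrow> \<exists>a b. \<forall>x\<in>{real k * \<delta>..real (Suc k) * \<delta>}. y x = a + b * x"
  shows "\<exists>g. prim l y g"
proof -
  obtain A B where AB: "\<And>k x. k < n \<Longrightarrow> x \<in> {real k * \<delta>..real (Suc k) * \<delta>} \<Longrightarrow> y x = A k + B k * x"
    using aff by metis
  define S where "S = (\<lambda>k. real k * \<delta>) ` {..n}"
  have fin: "finite S" by (simp add: S_def)
  define g where "g = (\<lambda>x. if x \<in> S then 0 else deriv y x)"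
  have D: "(y has_vector_derivative g x) (at x) \<and> \<bar>g x\<bar> \<le> Max ((\<lambda>k. \<bar>B k\<bar>) ` {..<n})"
    if x: "x \<in> {0<..<l} - S" for x
  proof -
    obtain k where k: "k < n" "x \<in> {real k * \<delta>..real (Suc k) * \<delta>}"
      using in_some_piece[OF n \<delta> l, of x] x by auto
    have "x \<noteq> real k * \<delta>" "x \<noteq> real (Suc k) * \<delta>"
      using x k(1) by (auto simp: S_def simp del: of_nat_Suc)
    then have xo: "x \<in> {real k * \<delta><..<real (Suc k) * \<delta>}" using k(2) by auto
    have "((\<lambda>x. A k + B k * x) has_real_derivative B k) (at x)"
      by (auto intro!: derivative_eq_intros)
    then have dy: "(y has_real_derivative B k) (at x)"
      using AB[OF k(1)] by (elim has_field_derivative_transform_within_open[OF _ open_greaterThanLessThan xo]) auto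
    then have "g x = B k" using x by (simp add: g_def DERIV_imp_deriv)
    then show ?thesis
      using dy k(1) by (auto simp: has_real_derivative_iff_has_vector_derivative)
  qed
  have I: "(g has_integral y b - y 0) {0..b}" if b: "b \<in> {0..l}" for b
  proof (rule fundamental_theorem_of_calculus_interior_strong[OF fin])
    show "continuous_on {0..b} y" using b by (intro continuous_on_subset[OF c]) auto
  qed (use b D in auto)
  have gm: "g \<in> borel_measurable (lebesgue_on {0..l})"
    using I[of l] l by (intro integrable_imp_measurable) (auto simp: integrable_on_def)
  define C where "C = max 0 (Max ((\<lambda>k. \<bar>B k\<bar>) ` {..<n}))"
  define g' where "g' = (\<lambda>x. if x \<in> S \<union> {0, l} then 0 else g x)"
  have ae: "aeq 0 l g g'"
    unfolding aeq_def by (rule negligible_subset[of "S \<union> {0, l}"]) (use fin in \<open>auto simp: g'_def\<close>)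
  have g'm: "g' \<in> borel_measurable (lebesgue_on {0..l})"
  proof (rule integrable_imp_measurable)
    show "g' integrable_on {0..l}"
      by (rule integrable_spike_finite[of "S \<union> {0, l}" _ _ g])
        (use fin I[of l] l in \<open>auto simp: g'_def integrable_on_def\<close>)
  qed
  have g'b: "\<bar>g' x\<bar> \<le> C" if "x \<in> {0..l}" for x
    using D[of x] that by (auto simp: g'_def C_def)
  have "l2 0 l g'"
    unfolding l2_def
  proof
    show "(\<lambda>x. (g' x)\<^sup>2) integrable_on {0..l}"
    proof (rule measurable_bounded_by_integrable_imp_integrable_real)
      show "(\<lambda>x. (g' x)\<^sup>2) \<in> borel_measurable (lebesgue_on {0..l})" using g'm by measurable
      show "(\<lambda>x. C\<^sup>2) integrable_on {0..l}" by (rule l2_integrable[OF l2_const])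
      show "\<bar>(g' x)\<^sup>2\<bar> \<le> C\<^sup>2" if "x \<in> {0..l}" for x
        using g'b[OF that] by (simp add: abs_le_square_iff[symmetric] C_def)
    qed simp
  qed (rule g'm)
  then have "l2 0 l g" using aeq_l2[OF aeq_sym[OF ae]] by blast
  moreover have "y x = y 0 + integral {0..x} g" if "x \<in> {0..l}" for x
    using integral_unique[OF I[OF that]] by simp
  ultimately have "prim l y g" unfolding prim_def by blast
  then show ?thesis by blast
qed

text \<open>At the right end \<open>x = l\<close> the index \<open>\<lfloor>x / \<delta>\<rfloor>\<close> would leave the grid, so it is cut off at \<open>n - 1\<close>.\<close>

definition interp :: "real \<Rightarrow> nat \<Rightarrow> (real \<Rightarrow> real) \<Rightarrow> real \<Rightarrow> real" where
  "interp l n y x = (let \<delta> = l / real n; k = min (n - 1) (nat \<lfloor>x / \<delta>\<rfloor>) in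
     y (real k * \<delta>) + (y (real (Suc k) * \<delta>) - y (real k * \<delta>)) / \<delta> * (x - real k * \<delta>))"

lemma interp_piece:
  assumes n: "1 \<le> n" and \<delta>: "\<delta> = l / real n" and l: "0 < l" and k: "k < n"
    and x: "x \<in> {real k * \<delta>..real (Suc k) * \<delta>}"
  shows "interp l n y x = y (real k * \<delta>) + (y (real (Suc k) * \<delta>) - y (real k * \<delta>)) / \<delta> * (x - real k * \<delta>)"
proof -
  have \<delta>0: "0 < \<delta>" using n l \<delta> by auto
  show ?thesis
  proof (cases "x = real (Suc k) * \<delta>")
    case False
    then have "real k \<le> x / \<delta>" "x / \<delta> < real (Suc k)" using x \<delta>0 by (auto simp: field_simps)
    then have "\<lfloor>x / \<delta>\<rfloor> = int k" by linarith
    then have "min (n - 1) (nat \<lfloor>x / \<delta>\<rfloor>) = k" using k by simp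
    then show ?thesis by (simp only: interp_def Let_def \<delta>[symmetric])
  next
    case True
    then have "x / \<delta> = real (Suc k)" using \<delta>0 by simp
    then have fl: "nat \<lfloor>x / \<delta>\<rfloor> = Suc k" by (simp del: of_nat_Suc)
    show ?thesis
    proof (cases "Suc k < n")
      case True': True
      then have "min (n - 1) (nat \<lfloor>x / \<delta>\<rfloor>) = Suc k" using fl by simp
      then have "interp l n y x = y (real (Suc k) * \<delta>)
          + (y (real (Suc (Suc k)) * \<delta>) - y (real (Suc k) * \<delta>)) / \<delta> * (x - real (Suc k) * \<delta>)"
        by (simp only: interp_def Let_def \<delta>[symmetric])
      then show ?thesis using True \<delta>0 pieces_le(4)[OF n \<delta> l k] by simp
    next
      case False
      then have "min (n - 1) (nat \<lfloor>x / \<delta>\<rfloor>) = k" using fl k by simp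
      then show ?thesis by (simp only: interp_def Let_def \<delta>[symmetric])
    qed
  qed
qed

lemma interp_node:
  assumes n: "1 \<le> n" and l: "0 < l" and k: "k \<le> n"
  shows "interp l n y (real k * (l / real n)) = y (real k * (l / real n))"
proof (cases "k < n")
  case True
  then show ?thesis using interp_piece[OF n refl l True, of "real k * (l / real n)" y]
      pieces_le[OF n refl l True] by simp
next
  case False
  then have kn: "k = Suc (n - 1)" "n - 1 < n" using k n by auto
  define \<delta> where "\<delta> = l / real n"
  have \<delta>0: "\<delta> \<noteq> 0" using n l by (simp add: \<delta>_def)
  show ?thesis
    using interp_piece[OF n \<delta>_def l kn(2), of "real (Suc (n - 1)) * \<delta>" y] \<delta>0
      pieces_le[OF n \<delta>_def l kn(2)] unfolding kn(1) \<delta>_def[symmetric]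
    by (simp del: of_nat_Suc)
qed

lemma interp_endpoints:
  assumes "1 \<le> n" "0 < l"
  shows "interp l n y 0 = y 0" "interp l n y l = y l"
  using interp_node[OF assms, of 0 y] interp_node[OF assms, of n y] assms by simp_all

lemma interp_continuous:
  assumes n: "1 \<le> n" and l: "0 < l"
  shows "continuous_on {0..l} (interp l n y)"
proof -
  define \<delta> where "\<delta> = l / real n"
  have \<delta>0: "\<delta> \<noteq> 0" using n l by (simp add: \<delta>_def)
  have "continuous_on (\<Union>k\<in>{..<n}. {real k * \<delta>..real (Suc k) * \<delta>}) (interp l n y)"
  proof (rule continuous_on_closed_Union)
    fix k assume "k \<in> {..<n}"
    then have eq: "y (real k * \<delta>) + (y (real (Suc k) * \<delta>) - y (real k * \<delta>)) / \<delta> * (x - real k * \<delta>)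
        = interp l n y x" if "x \<in> {real k * \<delta>..real (Suc k) * \<delta>}" for x
      using interp_piece[OF n \<delta>_def l _ that] by simp
    show "continuous_on {real k * \<delta>..real (Suc k) * \<delta>} (interp l n y)"
      by (rule continuous_on_eq[OF _ eq]) (auto intro!: continuous_intros simp: \<delta>0)
  qed auto
  then show ?thesis
    by (rule continuous_on_subset) (use in_some_piece[OF n \<delta>_def l] in blast)
qed

lemma interp_affine:
  assumes n: "1 \<le> n" and l: "0 < l" and k: "k < n"
  shows "\<exists>a b. \<forall>x\<in>{real k * (l / real n)..real (Suc k) * (l / real n)}. interp l n y x = a + b * x"
proof -
  define \<delta> where "\<delta> = l / real n"
  define m where "m = (y (real (Suc k) * \<delta>) - y (real k * \<delta>)) / \<delta>"
  have "interp l n y x = (y (real k * \<delta>) - m * (real k * \<delta>)) + m * x"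
    if "x \<in> {real k * \<delta>..real (Suc k) * \<delta>}" for x
    using interp_piece[OF n \<delta>_def l k that, of y] unfolding m_def[symmetric] by (simp add: algebra_simps)
  then show ?thesis unfolding \<delta>_def by blast
qed

text \<open>On each piece the derivative of the interpolant is the mean of \<open>y'\<close>, from which \<open>y'\<close> deviates by
  at most its oscillation; integrating the error from a node gains a second factor \<open>\<delta>\<close>.\<close>

lemma interp_error:
  assumes n: "1 \<le> n" and l: "0 < l" and \<delta>: "\<delta> = l / real n" and y: "prim l y g"
    and gG: "aeq 0 l g G" and G: "prim l G k" and E: "prim l (\<lambda>x. y x - interp l n y x) d"
  shows "integral {0..l} (\<lambda>x. (y x - interp l n y x)\<^sup>2) + integral {0..l} (\<lambda>x. (d x)\<^sup>2)
     \<le> (1 + l\<^sup>2) * \<delta>\<^sup>2 * integral {0..l} (\<lambda>x. (k x)\<^sup>2)"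
proof -
  have \<delta>0: "0 < \<delta>" and nl: "real n * \<delta> = l" and \<delta>l: "\<delta> \<le> l" using n l \<delta> by (auto simp: divide_le_eq)
  define e where "e = (\<lambda>x. y x - interp l n y x)"
  have E': "prim l e d" using E by (simp add: e_def)
  have yG: "prim l y G" by (rule prim_cong[OF y gG])
  have I: "prim l (interp l n y) (\<lambda>x. g x - d x)"
    using prim_comb[OF y E, of "-1"] by simp
  have piece: "integral {s..t} (\<lambda>x. (e x)\<^sup>2) + integral {s..t} (\<lambda>x. (d x)\<^sup>2)
      \<le> (1 + l\<^sup>2) * \<delta>\<^sup>2 * integral {s..t} (\<lambda>x. (k x)\<^sup>2)"
    if j: "j < n" and st_def: "s = real j * \<delta>" "t = real (Suc j) * \<delta>" for j s t
  proof -
    have st: "0 \<le> s" "s \<le> t" "t \<le> l" "t - s = \<delta>" "s \<in> {s..t}" "t \<in> {s..t}"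
      using pieces_le[OF n \<delta> l j] by (auto simp: st_def)
    have sub: "l2 s t f" if "l2 0 l f" for f using st by (intro l2_subinterval[OF that]) auto
    define m where "m = (y t - y s) / \<delta>"
    have Ix: "interp l n y x = y s + m * (x - s)" if "x \<in> {s..t}" for x
      using interp_piece[OF n \<delta> l j] that by (simp add: st_def m_def)
    have "aeq s t (\<lambda>x. g x - d x) (\<lambda>x. m)"
      by (rule aeq_const_on_affine_piece[OF I st(1,3)]) (use Ix st in auto)
    moreover have "aeq s t g G" using gG st by (rule_tac aeq_subinterval) auto
    ultimately have "aeq s t (\<lambda>x. g x - (g x - d x)) (\<lambda>x. G x - m)"
      by (intro aeq_cong2[where F="\<lambda>_ u v. u - v"])
    then have dG: "aeq s t d (\<lambda>x. G x - m)" by simp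
    define V where "V = \<delta> * integral {s..t} (\<lambda>x. (k x)\<^sup>2)"
    have V0: "0 \<le> V" unfolding V_def
      using \<delta>0 by (intro mult_nonneg_nonneg integral_nonneg l2_sq_integrable sub prim_l2[OF G]) auto
    have Gm: "(G x - m)\<^sup>2 \<le> V" if x: "x \<in> {s..t}" for x
    proof -
      have "\<delta> * m = y t - y s" using \<delta>0 by (simp add: m_def)
      also have "\<dots> = integral {s..t} G" using st by (intro prim_increment[OF yG])
      finally have "\<delta> * (m - G x) = integral {s..t} (\<lambda>\<xi>. G \<xi> - G x)"
        
        using integral_minus_const[OF sub[OF prim_l2_self[OF G]] st(2), of "G x"] unfolding st(4)
        by (simp add: algebra_simps)
      also have "\<bar>\<dots>\<bar> \<le> integral {s..t} (\<lambda>\<xi>. sqrt V)"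
      proof (rule integral_norm_bound_integral[where 'a=real and 'n=real, unfolded real_norm_def])
        fix \<xi> assume \<xi>: "\<xi> \<in> {s..t}"
        have "(G \<xi> - G x)\<^sup>2 \<le> V"
          using prim_increment_sq_le[OF G x \<xi> st(1,3)] st(4) by (simp add: V_def)
        then show "\<bar>G \<xi> - G x\<bar> \<le> sqrt V" by (rule real_le_rsqrt[of "\<bar>G \<xi> - G x\<bar>", simplified])
      qed (auto intro!: l2_integrable l2_diff l2_const sub[OF prim_l2_self[OF G]])
      also have "\<dots> = \<delta> * sqrt V" using st by simp
      finally have "\<bar>m - G x\<bar> \<le> sqrt V" using \<delta>0 by (simp add: abs_mult)
      then have "\<bar>m - G x\<bar>\<^sup>2 \<le> (sqrt V)\<^sup>2" by (intro power_mono) auto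
      then show ?thesis using V0 by (simp add: power2_commute)
    qed
    have "integral {s..t} (\<lambda>x. (d x)\<^sup>2) = integral {s..t} (\<lambda>x. (G x - m)\<^sup>2)"
      using aeq_integral[OF aeq_cong2[OF dG aeq_refl, of "\<lambda>_ u _. u\<^sup>2"]] .
    also have "\<dots> \<le> integral {s..t} (\<lambda>x. V)"
      by (rule integral_le) (auto intro!: Gm l2_sq_integrable l2_diff sub prim_l2_self[OF G] l2_const)
    also have "\<dots> = \<delta> * V" using st by simp
    finally have d: "integral {s..t} (\<lambda>x. (d x)\<^sup>2) \<le> \<delta> * V" .
    have "e s = 0" using Ix[of s] st by (simp add: e_def)
    have ex: "(e x)\<^sup>2 \<le> \<delta> * (\<delta> * V)" if x: "x \<in> {s..t}" for x
    proof -
      have "(e x - e s)\<^sup>2 \<le> \<delta> * integral {s..t} (\<lambda>x. (d x)\<^sup>2)"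
        using prim_increment_sq_le[OF E' st(5) x st(1,3)] st(4) by simp
      also have "\<dots> \<le> \<delta> * (\<delta> * V)" using d \<delta>0 by (intro mult_left_mono) auto
      finally show ?thesis using \<open>e s = 0\<close> by simp
    qed
    have "integral {s..t} (\<lambda>x. (e x)\<^sup>2) \<le> integral {s..t} (\<lambda>x. \<delta> * (\<delta> * V))"
      by (rule integral_le) (auto intro!: ex l2_sq_integrable sub prim_l2_self[OF E'])
    also have "\<dots> = \<delta>\<^sup>2 * (\<delta> * V)" using st by (simp add: power2_eq_square)
    also have "\<dots> \<le> l\<^sup>2 * (\<delta> * V)"
      using \<delta>0 \<delta>l V0 by (intro mult_right_mono power_mono) auto
    finally have "integral {s..t} (\<lambda>x. (e x)\<^sup>2) + integral {s..t} (\<lambda>x. (d x)\<^sup>2) \<le> (1 + l\<^sup>2) * (\<delta> * V)"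
      using d by (simp add: algebra_simps)
    then show ?thesis by (simp add: V_def power2_eq_square algebra_simps)
  qed
  have split: "integral {0..l} (\<lambda>x. (f x)\<^sup>2) = (\<Sum>j<n. integral {real j * \<delta>..real (Suc j) * \<delta>} (\<lambda>x. (f x)\<^sup>2))"
    if "l2 0 l f" for f
    using integral_split_pieces[of \<delta> "\<lambda>x. (f x)\<^sup>2" n] l2_sq_integrable[OF that] \<delta>0 by (simp add: nl)
  have "integral {0..l} (\<lambda>x. (e x)\<^sup>2) + integral {0..l} (\<lambda>x. (d x)\<^sup>2)
      = (\<Sum>j<n. integral {real j * \<delta>..real (Suc j) * \<delta>} (\<lambda>x. (e x)\<^sup>2)
          + integral {real j * \<delta>..real (Suc j) * \<delta>} (\<lambda>x. (d x)\<^sup>2))"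
    by (simp only: split[OF prim_l2[OF E']] split[OF prim_l2_self[OF E']] sum.distrib)
  also have "\<dots> \<le> (\<Sum>j<n. (1 + l\<^sup>2) * \<delta>\<^sup>2 * integral {real j * \<delta>..real (Suc j) * \<delta>} (\<lambda>x. (k x)\<^sup>2))"
    by (rule sum_mono, rule piece) auto
  also have "\<dots> = (1 + l\<^sup>2) * \<delta>\<^sup>2 * integral {0..l} (\<lambda>x. (k x)\<^sup>2)"
    by (simp only: split[OF prim_l2[OF G]] sum_distrib_left)
  finally show ?thesis by (simp add: e_def)
qed

section \<open>Inner products on a metric graph\<close>

definition comb :: "'e gfun \<Rightarrow> real \<Rightarrow> 'e gfun \<Rightarrow> 'e gfun" where
  "comb y t w = (\<lambda>e x. y e x + t * w e x)"

lemma gdiff_eq_comb: "gdiff y w = comb y (-1) w"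
  by (simp add: gdiff_def comb_def)

text \<open>Elements of the function spaces are representatives, on which the inner products are only
  positive semidefinite. The three instances are the \<open>L\<^sup>2\<close> product, the
  \<open>H1\<close> product and the energy product \<open>bilin G c\<close>.\<close>

locale semi_inner =
  fixes S :: "'e gfun set" and q :: "'e gfun \<Rightarrow> 'e gfun \<Rightarrow> real"
  assumes comb_closed: "y \<in> S \<Longrightarrow> w \<in> S \<Longrightarrow> comb y t w \<in> S"
    and sym: "y \<in> S \<Longrightarrow> w \<in> S \<Longrightarrow> q y w = q w y"
    and comb_left: "y \<in> S \<Longrightarrow> z \<in> S \<Longrightarrow> w \<in> S \<Longrightarrow> q (comb y t z) w = q y w + t * q z w"
    and nonneg: "y \<in> S \<Longrightarrow> 0 \<le> q y y"
begin

definition norm_of where "norm_of y = sqrt (q y y)"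

lemma norm_of_nonneg: "y \<in> S \<Longrightarrow> 0 \<le> norm_of y"
  by (simp add: norm_of_def nonneg)

lemma norm_of_sq: "y \<in> S \<Longrightarrow> (norm_of y)\<^sup>2 = q y y"
  by (simp add: norm_of_def nonneg)

lemma comb_right:
  assumes "y \<in> S" "z \<in> S" "w \<in> S"
  shows "q w (comb y t z) = q w y + t * q w z"
  using comb_left[OF assms, of t] sym[OF assms(3) comb_closed[OF assms(1,2)], of t]
    sym[OF assms(3,1)] sym[OF assms(3,2)] by simp

lemma comb_comb:
  assumes "y \<in> S" "z \<in> S"
  shows "q (comb y t z) (comb y t z) = q y y + 2 * t * q y z + t\<^sup>2 * q z z"
  using comb_left[OF assms comb_closed[OF assms]] comb_right[OF assms assms(1)]
    comb_right[OF assms assms(2)] sym[OF assms]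
  by (simp add: power2_eq_square algebra_simps)

lemma Cauchy_Schwarz_sq:
  assumes "y \<in> S" "z \<in> S"
  shows "(q y z)\<^sup>2 \<le> q y y * q z z"
proof (rule quadratic_nonneg_discriminant)
  show "0 \<le> q y y + 2 * t * q y z + t\<^sup>2 * q z z" for t
    using nonneg[OF comb_closed[OF assms]] comb_comb[OF assms] by simp
qed (rule nonneg[OF assms(2)])

lemma Cauchy_Schwarz:
  assumes "y \<in> S" "z \<in> S"
  shows "\<bar>q y z\<bar> \<le> norm_of y * norm_of z"
proof -
  have "sqrt ((q y z)\<^sup>2) \<le> sqrt (q y y * q z z)"
    by (rule real_sqrt_le_mono[OF Cauchy_Schwarz_sq[OF assms]])
  then show ?thesis by (simp add: norm_of_def real_sqrt_mult)
qed

lemma triangle: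
  assumes "y \<in> S" "z \<in> S"
  shows "norm_of (comb y t z) \<le> norm_of y + \<bar>t\<bar> * norm_of z"
proof (rule power2_le_imp_le)
  have "t * q y z \<le> \<bar>t\<bar> * \<bar>q y z\<bar>" by (metis abs_ge_self abs_mult)
  also have "\<dots> \<le> \<bar>t\<bar> * (norm_of y * norm_of z)"
    by (intro mult_left_mono Cauchy_Schwarz assms) simp
  finally show "(norm_of (comb y t z))\<^sup>2 \<le> (norm_of y + \<bar>t\<bar> * norm_of z)\<^sup>2"
    using comb_comb[OF assms, of t] norm_of_sq[OF assms(1)] norm_of_sq[OF assms(2)]
      norm_of_sq[OF comb_closed[OF assms]]
    by (simp add: power2_sum power_mult_distrib mult.left_commute)
qed (use assms norm_of_nonneg in auto)

text \<open>The first variation of the quadratic \<open>t \<mapsto> q(y + t z, y + t z)\<close> vanishes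
  at a minimum.\<close>

lemma minimal_imp_orthogonal:
  assumes "y \<in> S" "z \<in> S" and "\<And>t. q y y \<le> q (comb y t z) (comb y t z)"
  shows "q y z = 0"
proof -
  have "(q y z)\<^sup>2 \<le> 0 * q z z"
  proof (rule quadratic_nonneg_discriminant)
    show "0 \<le> 0 + 2 * t * q y z + t\<^sup>2 * q z z" for t
      using assms(3)[of t] comb_comb[OF assms(1,2), of t] by simp
  qed (rule nonneg[OF assms(2)])
  then show ?thesis by simp
qed

text \<open>A minimizing sequence for the distance from \<open>b\<close> whose excess decays like \<open>4\<^sup>-\<^sup>n\<close> is, by the
  parallelogram identity, Cauchy with the same rate.\<close>

lemma projection:
  assumes W: "W \<subseteq> S" "z0 \<in> W" "\<And>y t w. y \<in> W \<Longrightarrow> w \<in> W \<Longrightarrow> comb y t w \<in> W" and b: "b \<in> S"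
    and complete: "\<And>z B. (\<And>n. z n \<in> W) \<Longrightarrow>
       (\<And>n m. n \<le> m \<Longrightarrow> q (comb (z m) (-1) (z n)) (comb (z m) (-1) (z n)) \<le> B * (1/4) ^ n) \<Longrightarrow>
       \<exists>y\<in>W. (\<lambda>n. q (comb (z n) (-1) y) (comb (z n) (-1) y)) \<longlonglongrightarrow> 0"
  obtains y where "y \<in> W" "\<And>w. w \<in> W \<Longrightarrow> q (comb b (-1) y) w = 0"
proof -
  define D where "D = (\<lambda>z. q (comb b (-1) z) (comb b (-1) z))"
  have bz: "comb b (-1) z \<in> S" if "z \<in> W" for z using that W(1) b comb_closed by blast
  have D0: "0 \<le> D z" if "z \<in> W" for z unfolding D_def by (rule nonneg[OF bz[OF that]])
  define d where "d = Inf (D ` W)"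
  have bdd: "bdd_below (D ` W)" using D0 by (auto intro!: bdd_belowI[of _ 0])
  have d_le: "d \<le> D z" if "z \<in> W" for z unfolding d_def using that bdd by (intro cInf_lower) auto
  have "\<exists>z\<in>W. D z < d + (1/4) ^ n" for n :: nat
  proof -
    have "Inf (D ` W) < d + (1/4) ^ n" by (simp add: d_def)
    then show ?thesis using cInf_lessD[of "D ` W"] W(2) by blast
  qed
  then obtain z where z: "\<And>n. z n \<in> W" "\<And>n. D (z n) < d + (1/4) ^ n" by metis
  have "q (comb (z m) (-1) (z n)) (comb (z m) (-1) (z n)) \<le> 4 * (1/4) ^ n" if nm: "n \<le> m" for n m
  proof -
    let ?p = "comb b (-1) (z m)" and ?r = "comb b (-1) (z n)"
    have pS: "?p \<in> S" and rS: "?r \<in> S" using bz z by auto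
    have mid: "comb (z m) (1/2) (comb (z n) (-1) (z m)) \<in> W" using W z by blast
    have e1: "comb (z m) (-1) (z n) = comb ?r (-1) ?p"
      by (auto simp: comb_def fun_eq_iff)
    have e2: "comb b (-1) (comb (z m) (1/2) (comb (z n) (-1) (z m))) = comb ?p (1/2) (comb ?r (-1) ?p)"
      by (auto simp: comb_def fun_eq_iff field_simps)
    have "d \<le> q (comb ?p (1/2) (comb ?r (-1) ?p)) (comb ?p (1/2) (comb ?r (-1) ?p))"
      using d_le[OF mid] unfolding D_def e2 .
    also have "\<dots> = q ?p ?p + q ?p (comb ?r (-1) ?p) + 1/4 * q (comb ?r (-1) ?p) (comb ?r (-1) ?p)"
      using comb_comb[OF pS comb_closed[OF rS pS], of "1/2"] by (simp add: power2_eq_square)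
    finally have 1: "d \<le> \<dots>" .
    have 2: "q ?p (comb ?r (-1) ?p) = q ?p ?r - q ?p ?p"
      using comb_right[OF rS pS pS, of "-1"] by simp
    have 3: "q (comb ?r (-1) ?p) (comb ?r (-1) ?p) = q ?r ?r - 2 * q ?r ?p + q ?p ?p"
      using comb_comb[OF rS pS, of "-1"] by simp
    have 4: "q ?p ?r = q ?r ?p" by (rule sym[OF pS rS])
    have "q ?p ?p < d + (1/4) ^ m" "q ?r ?r < d + (1/4) ^ n"
      using z(2)[of m] z(2)[of n] by (auto simp: D_def)
    moreover have "(1/4::real) ^ m \<le> (1/4) ^ n" using nm by (intro power_decreasing) auto
    ultimately show ?thesis unfolding e1 using 1 2 3 4 by linarith
  qed
  from complete[of z 4, OF z(1) this] obtain y where y: "y \<in> W"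
    "(\<lambda>n. q (comb (z n) (-1) y) (comb (z n) (-1) y)) \<longlonglongrightarrow> 0" by blast
  have nb: "norm_of (comb b (-1) y) \<le> sqrt (d + (1/4) ^ n) + norm_of (comb (z n) (-1) y)" for n
  proof -
    have "comb b (-1) y = comb (comb b (-1) (z n)) 1 (comb (z n) (-1) y)"
      by (auto simp: comb_def fun_eq_iff)
    moreover have "comb (z n) (-1) y \<in> S" using W z y by blast
    ultimately have "norm_of (comb b (-1) y) \<le> norm_of (comb b (-1) (z n)) + norm_of (comb (z n) (-1) y)"
      using triangle[OF bz[OF z(1)[of n]], of "comb (z n) (-1) y" 1] by simp
    moreover have "norm_of (comb b (-1) (z n)) \<le> sqrt (d + (1/4) ^ n)"
      unfolding norm_of_def using z(2)[of n] by (simp add: D_def)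
    ultimately show ?thesis by linarith
  qed
  have "(\<lambda>n. sqrt (d + (1/4) ^ n) + norm_of (comb (z n) (-1) y)) \<longlonglongrightarrow> sqrt (d + 0) + sqrt 0"
    unfolding norm_of_def by (intro tendsto_intros y(2) LIMSEQ_power_zero) simp
  then have "norm_of (comb b (-1) y) \<le> sqrt d"
    using nb by (intro LIMSEQ_le_const[of _ "sqrt d"]) auto
  then have Dy: "D y \<le> d" by (simp add: norm_of_def D_def)
  show ?thesis
  proof (rule that[OF y(1)])
    fix w assume w: "w \<in> W"
    show "q (comb b (-1) y) w = 0"
    proof (rule minimal_imp_orthogonal[OF bz[OF y(1)]])
      show "w \<in> S" using w W by blast
      fix t
      have "comb (comb b (-1) y) t w = comb b (-1) (comb y (-t) w)"
        by (auto simp: comb_def fun_eq_iff algebra_simps)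
      moreover have "D y \<le> D (comb y (-t) w)"
        using Dy d_le[OF W(3)[OF y(1) w]] by (rule order_trans)
      ultimately show "q (comb b (-1) y) (comb b (-1) y) \<le> q (comb (comb b (-1) y) t w) (comb (comb b (-1) y) t w)"
        by (simp add: D_def)
    qed
  qed
qed

end

lemma L2_graph_iff: "f \<in> L2_graph G \<longleftrightarrow> (\<forall>e\<in>edges G. l2 0 (len G e) (f e))"
  by (simp add: L2_graph_def L2_edge_iff)

lemma comb_L2_graph: "f \<in> L2_graph G \<Longrightarrow> g \<in> L2_graph G \<Longrightarrow> comb f t g \<in> L2_graph G"
  by (simp add: L2_graph_iff comb_def l2_comb)

lemma L2_inner_eq:
  assumes "f \<in> L2_graph G" "g \<in> L2_graph G"
  shows "L2_inner G f g = (\<Sum>e\<in>edges G. integral {0..len G e} (\<lambda>x. f e x * g e x))"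
  unfolding L2_inner_def using assms
  by (intro sum.cong refl lebesgue_open_integral l2_mult) (auto simp: L2_graph_iff)

lemma semi_inner_L2:
  fixes G :: "('v, 'e) mgraph"
  shows "semi_inner (L2_graph G) (L2_inner G)"
proof
  fix y w z :: "'e gfun" and t
  show "y \<in> L2_graph G \<Longrightarrow> w \<in> L2_graph G \<Longrightarrow> comb y t w \<in> L2_graph G"
    by (rule comb_L2_graph)
  show "L2_inner G y w = L2_inner G w y"
    by (simp add: L2_inner_def mult.commute)
  show "0 \<le> L2_inner G y y"
    unfolding L2_inner_def by (intro sum_nonneg Bochner_Integration.integral_nonneg) simp
  assume *: "y \<in> L2_graph G" "z \<in> L2_graph G" "w \<in> L2_graph G"
  have "integral {0..len G e} (\<lambda>x. comb y t z e x * w e x)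
      = integral {0..len G e} (\<lambda>x. y e x * w e x) + t * integral {0..len G e} (\<lambda>x. z e x * w e x)"
    if "e \<in> edges G" for e
  proof -
    have l: "l2 0 (len G e) (y e)" "l2 0 (len G e) (z e)" "l2 0 (len G e) (w e)"
      using * that by (auto simp: L2_graph_iff)
    have "integral {0..len G e} (\<lambda>x. comb y t z e x * w e x)
        = integral {0..len G e} (\<lambda>x. y e x * w e x + t * (z e x * w e x))"
      by (simp add: comb_def algebra_simps)
    also have "\<dots> = integral {0..len G e} (\<lambda>x. y e x * w e x) + integral {0..len G e} (\<lambda>x. t * (z e x * w e x))"
      using l by (intro integral_add integrable_on_mult_right l2_mult_integrable)
    finally show ?thesis by simp
  qed
  then show "L2_inner G (comb y t z) w = L2_inner G y w + t * L2_inner G z w"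
    using * by (simp add: L2_inner_eq comb_L2_graph sum.distrib sum_distrib_left)
qed

lemma L2_norm_sq: "(L2_norm G f)\<^sup>2 = L2_inner G f f"
  unfolding L2_norm_def L2_inner_def
  by (intro real_sqrt_pow2 sum_nonneg Bochner_Integration.integral_nonneg) simp

lemma Linf_l2:
  assumes c: "c \<in> Linf_edge l" and f: "l2 0 l f"
  shows "l2 0 l (\<lambda>x. c x * f x)"
proof -
  let ?M = "lebesgue_on {0<..<l}"
  have f': "f \<in> borel_measurable ?M" "integrable ?M (\<lambda>x. (f x)\<^sup>2)"
    using f[folded L2_edge_iff] by (auto simp: L2_edge_def)
  obtain C where c': "c \<in> borel_measurable ?M" "AE x in ?M. \<bar>c x\<bar> \<le> C"
    using c by (auto simp: Linf_edge_def)
  have "(\<lambda>x. c x * f x) \<in> L2_edge l"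
    unfolding L2_edge_def
  proof (intro CollectI conjI)
    show "(\<lambda>x. c x * f x) \<in> borel_measurable ?M" using f' c' by measurable
    show "integrable ?M (\<lambda>x. (c x * f x)\<^sup>2)"
    proof (rule Bochner_Integration.integrable_bound[of _ "\<lambda>x. C\<^sup>2 * (f x)\<^sup>2"])
      show "AE x in ?M. norm ((c x * f x)\<^sup>2) \<le> norm (C\<^sup>2 * (f x)\<^sup>2)"
        using c'(2)
      proof eventually_elim
        case (elim x)
        then have "(c x)\<^sup>2 \<le> C\<^sup>2" using abs_le_square_iff[of "c x" C] by simp
        then show ?case by (simp add: power_mult_distrib mult_right_mono)
      qed
      show "integrable ?M (\<lambda>x. C\<^sup>2 * (f x)\<^sup>2)" using f'(2) by simp
      show "(\<lambda>x. (c x * f x)\<^sup>2) \<in> borel_measurable ?M"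
        using f'(1) c'(1) by measurable
    qed
  qed
  then show ?thesis by (simp add: L2_edge_iff)
qed

lemma H1_graph_prim:
  assumes "metric_graph G" "y \<in> H1_graph G" "e \<in> edges G"
  shows "prim (len G e) (y e) (gderiv G y e)"
  unfolding gderiv_def using assms
  by (intro prim_wderiv) (auto simp: metric_graph_def H1_graph_def continuous_graph_def)

lemma H1_graphI:
  assumes "metric_graph G" "\<And>e. e \<in> edges G \<Longrightarrow> \<exists>g. prim (len G e) (y e) g"
    "\<And>v. v \<in> verts G \<Longrightarrow> \<exists>c. vertex_value G y v c"
  shows "y \<in> H1_graph G"
  using assms H1_edgeI prim_continuous unfolding H1_graph_def continuous_graph_def metric_graph_def
  by blast

lemma gderiv_aeq:
  assumes "metric_graph G" "e \<in> edges G" "prim (len G e) (y e) g"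
  shows "aeq 0 (len G e) (gderiv G y e) g"
  unfolding gderiv_def using assms by (intro wderiv_aeq) (auto simp: metric_graph_def)

lemma H1_graph_vertex: "y \<in> H1_graph G \<Longrightarrow> v \<in> verts G \<Longrightarrow> \<exists>c. vertex_value G y v c"
  by (simp add: H1_graph_def continuous_graph_def)

lemma vertex_value_comb:
  "vertex_value G y v c \<Longrightarrow> vertex_value G w v d \<Longrightarrow> vertex_value G (comb y t w) v (c + t * d)"
  by (simp add: vertex_value_def comb_def)

lemma comb_H1_graph:
  assumes G: "metric_graph G" and y: "y \<in> H1_graph G" and w: "w \<in> H1_graph G"
  shows "comb y t w \<in> H1_graph G"
proof (rule H1_graphI[OF G])
  show "\<exists>g. prim (len G e) (comb y t w e) g" if "e \<in> edges G" for e
    using prim_comb[OF H1_graph_prim[OF G y that] H1_graph_prim[OF G w that], of t]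
    unfolding comb_def by blast
  show "\<exists>c. vertex_value G (comb y t w) v c" if "v \<in> verts G" for v
    using H1_graph_vertex[OF y that] H1_graph_vertex[OF w that] by (blast intro: vertex_value_comb)
qed

lemma comb_H1D_graph:
  assumes "metric_graph G" "y \<in> H1D_graph G VD" "w \<in> H1D_graph G VD"
  shows "comb y t w \<in> H1D_graph G VD"
  using assms comb_H1_graph vertex_value_comb[of G y _ 0 w 0 t] by (auto simp: H1D_graph_def)

lemma H1_graph_L2: "metric_graph G \<Longrightarrow> y \<in> H1_graph G \<Longrightarrow> y \<in> L2_graph G"
  by (auto simp: L2_graph_iff intro: prim_l2_self[OF H1_graph_prim])

lemma gderiv_L2: "metric_graph G \<Longrightarrow> y \<in> H1_graph G \<Longrightarrow> gderiv G y \<in> L2_graph G"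
  by (auto simp: L2_graph_iff intro: prim_l2[OF H1_graph_prim])

lemma gderiv_comb_aeq:
  assumes "metric_graph G" "y \<in> H1_graph G" "w \<in> H1_graph G" "e \<in> edges G"
  shows "aeq 0 (len G e) (gderiv G (comb y t w) e) (\<lambda>x. gderiv G y e x + t * gderiv G w e x)"
  using prim_comb[OF H1_graph_prim[OF assms(1,2,4)] H1_graph_prim[OF assms(1,3,4)], of t] assms
  by (intro gderiv_aeq) (auto simp: comb_def)

definition gmult :: "('e \<Rightarrow> real \<Rightarrow> real) \<Rightarrow> 'e gfun \<Rightarrow> 'e gfun" where
  "gmult c y = (\<lambda>e x. c e x * y e x)"

lemma gmult_L2: "c \<in> Linf_graph G \<Longrightarrow> y \<in> L2_graph G \<Longrightarrow> gmult c y \<in> L2_graph G"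
  by (simp add: L2_graph_iff Linf_graph_def gmult_def Linf_l2)

text \<open>Splitting the form into two \<open>L\<^sup>2\<close> products reduces its linearity to that of
  \<open>L2_inner\<close>.\<close>

lemma bilin_eq:
  assumes "metric_graph G" "c \<in> Linf_graph G" "y \<in> H1_graph G" "w \<in> H1_graph G"
  shows "bilin G c y w = L2_inner G (gderiv G y) (gderiv G w) + L2_inner G (gmult c y) w"
proof -
  note L = gderiv_L2[OF assms(1,3)] gderiv_L2[OF assms(1,4)]
    gmult_L2[OF assms(2) H1_graph_L2[OF assms(1,3)]] H1_graph_L2[OF assms(1,4)]
  have "(LINT x|lebesgue_on {0<..<len G e}. gderiv G y e x * gderiv G w e x + c e x * y e x * w e x)
     = (LINT x|lebesgue_on {0<..<len G e}. gderiv G y e x * gderiv G w e x)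
     + (LINT x|lebesgue_on {0<..<len G e}. gmult c y e x * w e x)" if "e \<in> edges G" for e
  proof -
    have l: "l2 0 (len G e) (gderiv G y e)" "l2 0 (len G e) (gderiv G w e)"
      "l2 0 (len G e) (gmult c y e)" "l2 0 (len G e) (w e)"
      using L that by (auto simp: L2_graph_iff)
    have "integrable (lebesgue_on {0<..<len G e}) (\<lambda>x. f x * g x)"
      if "l2 0 (len G e) f" "l2 0 (len G e) g" for f g
      using l2_mult[OF that] by (intro absolutely_integrable_imp_integrable) (auto simp: absolutely_integrable_open_closed)
    from Bochner_Integration.integral_add[OF this[OF l(1,2)] this[OF l(3,4)]] show ?thesis
      by (simp add: gmult_def)
  qed
  then show ?thesis unfolding bilin_def L2_inner_def by (simp add: sum.distrib)
qed

lemma L2_inner_aeq: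
  assumes "f \<in> L2_graph G" "g \<in> L2_graph G" and "\<And>e. e \<in> edges G \<Longrightarrow> aeq 0 (len G e) (f e) (f' e)"
  shows "L2_inner G f g = L2_inner G f' g"
proof -
  have f': "f' \<in> L2_graph G"
    unfolding L2_graph_iff using assms(1,3) by (meson L2_graph_iff aeq_l2)
  show ?thesis unfolding L2_inner_eq[OF assms(1,2)] L2_inner_eq[OF f' assms(2)]
    by (intro sum.cong refl aeq_integral aeq_cong2[where F="\<lambda>_ u v. u * v"] assms aeq_refl)
qed

lemma semi_inner_bilin:
  fixes G :: "('v, 'e) mgraph"
  assumes G: "metric_graph G" and c: "c \<in> Linf_graph G"
    and nn: "\<forall>e\<in>edges G. AE x in lebesgue_on {0<..<len G e}. 0 \<le> c e x"
  shows "semi_inner (H1_graph G) (bilin G c)"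
proof
  interpret L: semi_inner "L2_graph G" "L2_inner G" by (rule semi_inner_L2)
  fix y w z :: "'e gfun" and t
  show "y \<in> H1_graph G \<Longrightarrow> w \<in> H1_graph G \<Longrightarrow> comb y t w \<in> H1_graph G"
    by (rule comb_H1_graph[OF G])
  show "bilin G c y w = bilin G c w y"
    by (simp add: bilin_def mult.commute mult.left_commute)
  show "0 \<le> bilin G c y y"
    unfolding bilin_def
  proof (intro sum_nonneg integral_nonneg_AE)
    fix e assume "e \<in> edges G"
    with nn have "AE x in lebesgue_on {0<..<len G e}. 0 \<le> c e x" by blast
    then show "AE x in lebesgue_on {0<..<len G e}. 0 \<le> gderiv G y e x * gderiv G y e x + c e x * y e x * y e x"
      by eventually_elim (simp add: mult.assoc)
  qed
  assume *: "y \<in> H1_graph G" "z \<in> H1_graph G" "w \<in> H1_graph G"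
  note L2s = *[THEN H1_graph_L2[OF G]]
  have "L2_inner G (gderiv G (comb y t z)) (gderiv G w) = L2_inner G (comb (gderiv G y) t (gderiv G z)) (gderiv G w)"
    using gderiv_comb_aeq[OF G *(1,2)] * 
    by (intro L2_inner_aeq gderiv_L2[OF G] comb_H1_graph[OF G]) (auto simp: comb_def)
  also have "\<dots> = L2_inner G (gderiv G y) (gderiv G w) + t * L2_inner G (gderiv G z) (gderiv G w)"
    by (intro L.comb_left gderiv_L2[OF G] *)
  finally have 1: "L2_inner G (gderiv G (comb y t z)) (gderiv G w) = \<dots>" .
  have "gmult c (comb y t z) = comb (gmult c y) t (gmult c z)"
    by (simp add: gmult_def comb_def fun_eq_iff algebra_simps)
  then have "L2_inner G (gmult c (comb y t z)) w = L2_inner G (gmult c y) w + t * L2_inner G (gmult c z) w"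
    using L.comb_left gmult_L2[OF c] L2s by simp
  with 1 show "bilin G c (comb y t z) w = bilin G c y w + t * bilin G c z w"
    using * by (simp add: bilin_eq[OF G c] comb_H1_graph[OF G] algebra_simps)
qed

text \<open>The \<open>H1\<close> inner product is the form \<open>bilin\<close> with coefficient one, so
  it shares all lemmas with it.\<close>

definition H1_inner :: "('v, 'e) mgraph \<Rightarrow> 'e gfun \<Rightarrow> 'e gfun \<Rightarrow> real" where
  "H1_inner G = bilin G (\<lambda>_ _. 1)"

lemma one_Linf: "(\<lambda>_ _. 1) \<in> Linf_graph G"
  by (auto simp: Linf_graph_def Linf_edge_def intro!: exI[of _ 1])

lemma semi_inner_H1: "metric_graph G \<Longrightarrow> semi_inner (H1_graph G) (H1_inner G)"
  unfolding H1_inner_def by (intro semi_inner_bilin one_Linf) auto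

lemma H1_inner_eq:
  assumes "metric_graph G" "y \<in> H1_graph G" "w \<in> H1_graph G"
  shows "H1_inner G y w = L2_inner G (gderiv G y) (gderiv G w) + L2_inner G y w"
  unfolding H1_inner_def by (simp add: bilin_eq[OF assms(1) one_Linf assms(2,3)] gmult_def)

lemma H1_norm_eq:
  assumes "metric_graph G" "y \<in> H1_graph G"
  shows "H1_norm G y = sqrt (H1_inner G y y)"
  by (simp add: H1_norm_def L2_norm_sq H1_inner_eq[OF assms assms(2)])

lemma H1_inner_edges:
  assumes G: "metric_graph G" and y: "y \<in> H1_graph G"
    and g: "\<And>e. e \<in> edges G \<Longrightarrow> prim (len G e) (y e) (g e)"
  shows "H1_inner G y y = (\<Sum>e\<in>edges G. integral {0..len G e} (\<lambda>x. (y e x)\<^sup>2) + integral {0..len G e} (\<lambda>x. (g e x)\<^sup>2))"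
proof -
  have "integral {0..len G e} (\<lambda>x. (gderiv G y e x)\<^sup>2) = integral {0..len G e} (\<lambda>x. (g e x)\<^sup>2)"
    if "e \<in> edges G" for e
    using aeq_integral[OF aeq_cong2[OF gderiv_aeq[where y=y and g="g e", OF G that g[OF that]] aeq_refl, of "\<lambda>_ u _. u\<^sup>2"]] .
  then show ?thesis
    by (simp add: H1_inner_eq[OF G y y] L2_inner_eq gderiv_L2[OF G y] H1_graph_L2[OF G y]
        power2_eq_square sum.distrib)
qed

lemma L2_inner_le_H1_inner:
  assumes "metric_graph G" "y \<in> H1_graph G"
  shows "L2_inner G y y \<le> H1_inner G y y"
  using semi_inner.nonneg[OF semi_inner_L2 gderiv_L2[OF assms]] by (simp add: H1_inner_eq[OF assms assms(2)])

lemma bilin_le_H1_inner: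
  assumes G: "metric_graph G" and c: "c \<in> Linf_graph G"
  obtains C where "1 \<le> C" "\<And>y. y \<in> H1_graph G \<Longrightarrow> bilin G c y y \<le> C * H1_inner G y y"
proof -
  have fin: "finite (edges G)" using G by (simp add: metric_graph_def)
  have "\<forall>e\<in>edges G. \<exists>C. AE x in lebesgue_on {0<..<len G e}. \<bar>c e x\<bar> \<le> C"
    using c by (auto simp: Linf_graph_def Linf_edge_def)
  then obtain K where K: "\<And>e. e \<in> edges G \<Longrightarrow> AE x in lebesgue_on {0<..<len G e}. \<bar>c e x\<bar> \<le> K e"
    by metis
  define C where "C = 1 + (\<Sum>e\<in>edges G. \<bar>K e\<bar>)"
  have C1: "1 \<le> C" by (simp add: C_def sum_nonneg)
  have KC: "K e \<le> C" if "e \<in> edges G" for e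
    using member_le_sum[OF that, of "\<lambda>e. \<bar>K e\<bar>"] fin by (simp add: C_def)
  have "bilin G c y y \<le> C * H1_inner G y y" if y: "y \<in> H1_graph G" for y
  proof -
    have "(LINT x|lebesgue_on {0<..<len G e}. gderiv G y e x * gderiv G y e x + c e x * y e x * y e x)
        \<le> (LINT x|lebesgue_on {0<..<len G e}. C * (gderiv G y e x * gderiv G y e x + 1 * y e x * y e x))"
      if e: "e \<in> edges G" for e
    proof (rule integral_mono_AE)
      have l: "l2 0 (len G e) (gderiv G y e)" "l2 0 (len G e) (y e)" "l2 0 (len G e) (gmult c y e)"
        using gderiv_L2[OF G y] H1_graph_L2[OF G y] gmult_L2[OF c H1_graph_L2[OF G y]] e
        by (auto simp: L2_graph_iff)
      have i: "integrable (lebesgue_on {0<..<len G e}) (\<lambda>x. f x * g x)"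
        if "l2 0 (len G e) f" "l2 0 (len G e) g" for f g
        using l2_mult[OF that] by (intro absolutely_integrable_imp_integrable) (auto simp: absolutely_integrable_open_closed)
      show "integrable (lebesgue_on {0<..<len G e}) (\<lambda>x. gderiv G y e x * gderiv G y e x + c e x * y e x * y e x)"
        using i[OF l(1,1)] i[OF l(3,2)] by (auto simp: gmult_def)
      show "integrable (lebesgue_on {0<..<len G e}) (\<lambda>x. C * (gderiv G y e x * gderiv G y e x + 1 * y e x * y e x))"
        using i[OF l(1,1)] i[OF l(2,2)] by auto
      show "AE x in lebesgue_on {0<..<len G e}. gderiv G y e x * gderiv G y e x + c e x * y e x * y e x
          \<le> C * (gderiv G y e x * gderiv G y e x + 1 * y e x * y e x)"
        using K[OF e]
      proof eventually_elim
        case (elim x)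
        then have "c e x \<le> C" using KC[OF e] by simp
        then have "c e x * (y e x * y e x) \<le> C * (y e x * y e x)" by (intro mult_right_mono) auto
        moreover have "1 * (gderiv G y e x * gderiv G y e x) \<le> C * (gderiv G y e x * gderiv G y e x)"
          using C1 by (intro mult_right_mono) auto
        ultimately show ?case by (simp add: algebra_simps)
      qed
    qed
    then show ?thesis unfolding H1_inner_def bilin_def sum_distrib_left
      by (intro sum_mono) simp
  qed
  then show ?thesis using C1 that by blast
qed

section \<open>Function spaces and the optimality system on a metric graph\<close>

lemma vertex_value_limit:
  assumes "metric_graph G" "\<And>n. vertex_value G (z n) v (c n)" "c \<longlonglongrightarrow> c'"
    and "\<And>e x. e \<in> edges G \<Longrightarrow> x \<in> {0..len G e} \<Longrightarrow> (\<lambda>n. z n e x) \<longlonglongrightarrow> y e x"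
  shows "vertex_value G y v c'"
  unfolding vertex_value_def
proof (intro ballI conjI impI)
  fix e assume e: "e \<in> edges G"
  then have l: "0 < len G e" using assms(1) by (simp add: metric_graph_def)
  show "y e 0 = c'" if "src G e = v"
  proof (rule LIMSEQ_unique)
    show "(\<lambda>n. z n e 0) \<longlonglongrightarrow> y e 0" using e l by (intro assms(4)) auto
    show "(\<lambda>n. z n e 0) \<longlonglongrightarrow> c'" using assms(2,3) e that by (simp add: vertex_value_def)
  qed
  show "y e (len G e) = c'" if "tgt G e = v"
  proof (rule LIMSEQ_unique)
    show "(\<lambda>n. z n e (len G e)) \<longlonglongrightarrow> y e (len G e)" using e l by (intro assms(4)) auto
    show "(\<lambda>n. z n e (len G e)) \<longlonglongrightarrow> c'" using assms(2,3) e that by (simp add: vertex_value_def)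
  qed
qed

text \<open>Apply completeness edge by edge; the limit is continuous at the vertices because vertex values
  are limits of vertex values.\<close>

lemma H1_graph_complete:
  fixes G :: "('a, 'b) mgraph"
  assumes G: "metric_graph G" and z: "\<And>n. z n \<in> H1_graph G"
    and C: "\<And>n m. n \<le> m \<Longrightarrow> H1_inner G (comb (z m) (-1) (z n)) (comb (z m) (-1) (z n)) \<le> B * (1/4) ^ n"
  obtains y where "y \<in> H1_graph G"
    "\<And>e x. e \<in> edges G \<Longrightarrow> x \<in> {0..len G e} \<Longrightarrow> (\<lambda>n. z n e x) \<longlonglongrightarrow> y e x"
    "(\<lambda>n. H1_inner G (comb (z n) (-1) y) (comb (z n) (-1) y)) \<longlonglongrightarrow> 0"
proof -
  have fin: "finite (edges G)" and len: "\<And>e. e \<in> edges G \<Longrightarrow> 0 < len G e"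
    using G by (auto simp: metric_graph_def)
  have d: "prim (len G e) (comb w (-1) w' e) (\<lambda>x. g x - g' x)"
    if "prim (len G e) (w e) g" "prim (len G e) (w' e) g'" for e w w' g g'
    using prim_comb[OF that, of "-1"] by (simp add: comb_def)
  define T :: "'b gfun \<Rightarrow> 'b gfun \<Rightarrow> 'b gfun \<Rightarrow> 'b gfun \<Rightarrow> 'b \<Rightarrow> real"
    where "T = (\<lambda>w g w' g' e. integral {0..len G e} (\<lambda>x. (w e x - w' e x)\<^sup>2)
      + integral {0..len G e} (\<lambda>x. (g e x - g' e x)\<^sup>2))"
  have h1T: "H1_inner G (comb w (-1) w') (comb w (-1) w') = (\<Sum>e\<in>edges G. T w g w' g' e)"
    if "w \<in> H1_graph G" "w' \<in> H1_graph G" "\<And>e. e \<in> edges G \<Longrightarrow> prim (len G e) (w e) (g e)"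
      "\<And>e. e \<in> edges G \<Longrightarrow> prim (len G e) (w' e) (g' e)" for w w' g g'
    using H1_inner_edges[OF G comb_H1_graph[OF G that(1,2)], of "-1" "\<lambda>e x. g e x - g' e x"] d that(3,4)
    by (simp add: T_def comb_def)
  have T0: "0 \<le> T w g w' g' e"
    if "prim (len G e) (w e) (g e)" "prim (len G e) (w' e) (g' e)" for w w' g g' e
    unfolding T_def using that
    by (intro add_nonneg_nonneg integral_nonneg l2_sq_integrable l2_diff)
      (auto intro: prim_l2 prim_l2_self)
  define P where "P = (\<lambda>e Y g. prim (len G e) Y g \<and> (\<forall>x\<in>{0..len G e}. (\<lambda>n. z n e x) \<longlonglongrightarrow> Y x) \<and>
    (\<lambda>n. integral {0..len G e} (\<lambda>x. (z n e x - Y x)\<^sup>2)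
       + integral {0..len G e} (\<lambda>x. (gderiv G (z n) e x - g x)\<^sup>2)) \<longlonglongrightarrow> 0)"
  have "\<exists>Y g. P e Y g" if e: "e \<in> edges G" for e
  proof -
    have "integral {0..len G e} (\<lambda>x. (z m e x - z n e x)\<^sup>2)
       + integral {0..len G e} (\<lambda>x. (gderiv G (z m) e x - gderiv G (z n) e x)\<^sup>2) \<le> B * (1/4) ^ n"
      if "n \<le> m" for n m
    proof -
      have "T (z m) (gderiv G (z m)) (z n) (gderiv G (z n)) e
          \<le> (\<Sum>e\<in>edges G. T (z m) (gderiv G (z m)) (z n) (gderiv G (z n)) e)"
        using fin e by (intro member_le_sum T0 H1_graph_prim[OF G z]) auto
      also have "\<dots> \<le> B * (1/4) ^ n"
        using C[OF that] h1T[OF z z H1_graph_prim[OF G z] H1_graph_prim[OF G z], of m n] by simp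
      finally show ?thesis by (simp add: T_def)
    qed
    then show ?thesis
      unfolding P_def by (rule prim_complete[OF len[OF e] H1_graph_prim[OF G z e]]) blast+
  qed
  then obtain y g where yg: "\<And>e. e \<in> edges G \<Longrightarrow> P e (y e) (g e)" by metis
  have y: "\<And>e. e \<in> edges G \<Longrightarrow> prim (len G e) (y e) (g e)"
    and lim: "\<And>e x. e \<in> edges G \<Longrightarrow> x \<in> {0..len G e} \<Longrightarrow> (\<lambda>n. z n e x) \<longlonglongrightarrow> y e x"
    and lT: "\<And>e. e \<in> edges G \<Longrightarrow> (\<lambda>n. T (z n) (gderiv G (z n)) y g e) \<longlonglongrightarrow> 0"
    using yg unfolding P_def T_def by blast+
  have yH: "y \<in> H1_graph G"
  proof (rule H1_graphI[OF G])
    show "\<exists>g. prim (len G e) (y e) g" if "e \<in> edges G" for e using y[OF that] by blast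
    fix v assume v: "v \<in> verts G"
    obtain c where c: "\<And>n. vertex_value G (z n) v (c n)"
      using H1_graph_vertex[OF z v] by metis
    show "\<exists>c. vertex_value G y v c"
    proof (cases "\<exists>e\<in>edges G. \<exists>x\<in>{0..len G e}. \<forall>n. z n e x = c n")
      case True
      then obtain e x where ex: "e \<in> edges G" "x \<in> {0..len G e}" "\<And>n. z n e x = c n" by blast
      then have "c \<longlonglongrightarrow> y e x" using lim[OF ex(1,2)] by simp
      then show ?thesis using vertex_value_limit[OF G c _ lim] by blast
    next
      case False
      have "src G e \<noteq> v \<and> tgt G e \<noteq> v" if e: "e \<in> edges G" for e
      proof -
        have "0 \<in> {0..len G e}" "len G e \<in> {0..len G e}" using len[OF e] by auto
        then show ?thesis using False c e unfolding vertex_value_def by blast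
      qed
      then show ?thesis by (auto simp: vertex_value_def)
    qed
  qed
  have "(\<lambda>n. \<Sum>e\<in>edges G. T (z n) (gderiv G (z n)) y g e) \<longlonglongrightarrow> (\<Sum>e\<in>edges G. 0)"
    by (rule tendsto_sum) (rule lT)
  then have "(\<lambda>n. H1_inner G (comb (z n) (-1) y) (comb (z n) (-1) y)) \<longlonglongrightarrow> 0"
    using h1T[OF z yH H1_graph_prim[OF G z] y] by simp
  from that[OF yH lim this] show ?thesis .
qed

lemma bilin_sym: "bilin G c y w = bilin G c w y"
  by (simp add: bilin_def mult.commute mult.left_commute)

text \<open>The projection theorem for the energy product. Coercivity turns Cauchy sequences in the energy
  norm into Cauchy sequences in \<open>H1\<close>; closedness of \<open>W\<close> is expressed
  by pointwise limits because vertex conditions and piecewise affinity are pointwise conditions,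
  so that \<open>H1D_graph\<close> and \<open>VhD\<close> are both covered.\<close>

lemma projection_exists:
  fixes G :: "('v, 'e) mgraph"
  assumes G: "metric_graph G" and c: "c \<in> Linf_graph G"
    and nn: "\<forall>e\<in>edges G. AE x in lebesgue_on {0<..<len G e}. 0 \<le> c e x"
    and \<alpha>: "0 < \<alpha>" "\<And>w. w \<in> H1D_graph G VD \<Longrightarrow> \<alpha> * H1_inner G w w \<le> bilin G c w w"
    and W: "W \<subseteq> H1D_graph G VD" "z0 \<in> W" "\<And>y t w. y \<in> W \<Longrightarrow> w \<in> W \<Longrightarrow> comb y t w \<in> W"
    and closed: "\<And>z y. (\<And>n. z n \<in> W) \<Longrightarrow> y \<in> H1_graph G \<Longrightarrow>
        (\<And>e x. e \<in> edges G \<Longrightarrow> x \<in> {0..len G e} \<Longrightarrow> (\<lambda>n::nat. z n e x) \<longlonglongrightarrow> y e x) \<Longrightarrow> y \<in> W"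
    and b: "b \<in> H1_graph G"
  obtains y where "y \<in> W" "\<And>w. w \<in> W \<Longrightarrow> bilin G c (comb b (-1) y) w = 0"
proof -
  interpret A: semi_inner "H1_graph G" "bilin G c" by (rule semi_inner_bilin[OF G c nn])
  obtain C where C: "1 \<le> C" "\<And>y. y \<in> H1_graph G \<Longrightarrow> bilin G c y y \<le> C * H1_inner G y y"
    using bilin_le_H1_inner[OF G c] by blast
  have WH: "W \<subseteq> H1_graph G" using W(1) by (auto simp: H1D_graph_def)
  show ?thesis
  proof (rule A.projection[OF WH W(2,3) b])
    fix z :: "nat \<Rightarrow> 'e gfun" and B
    assume z: "\<And>n. z n \<in> W"
      and Cz: "\<And>n m. n \<le> m \<Longrightarrow> bilin G c (comb (z m) (-1) (z n)) (comb (z m) (-1) (z n)) \<le> B * (1/4) ^ n"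
    have zH: "z n \<in> H1_graph G" for n using z WH by blast
    have hz: "H1_inner G (comb (z m) (-1) (z n)) (comb (z m) (-1) (z n)) \<le> (B / \<alpha>) * (1/4) ^ n" if "n \<le> m" for n m
    proof -
      have "comb (z m) (-1) (z n) \<in> H1D_graph G VD" using W z by blast
      from order_trans[OF \<alpha>(2)[OF this] Cz[OF that]]
      have "H1_inner G (comb (z m) (-1) (z n)) (comb (z m) (-1) (z n)) \<le> B * (1/4) ^ n / \<alpha>"
        using \<alpha>(1) by (simp add: pos_le_divide_eq mult.commute)
      then show ?thesis by simp
    qed
    obtain y where y: "y \<in> H1_graph G"
      "\<And>e x. e \<in> edges G \<Longrightarrow> x \<in> {0..len G e} \<Longrightarrow> (\<lambda>n. z n e x) \<longlonglongrightarrow> y e x"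
      "(\<lambda>n. H1_inner G (comb (z n) (-1) y) (comb (z n) (-1) y)) \<longlonglongrightarrow> 0"
      using H1_graph_complete[OF G zH hz] by blast
    have "(\<lambda>n. bilin G c (comb (z n) (-1) y) (comb (z n) (-1) y)) \<longlonglongrightarrow> 0"
    proof (rule tendsto_sandwich[OF _ _ tendsto_const])
      show "(\<lambda>n. C * H1_inner G (comb (z n) (-1) y) (comb (z n) (-1) y)) \<longlonglongrightarrow> 0"
        using tendsto_mult_left[OF y(3), of C] by simp
    qed (auto intro!: always_eventually A.nonneg C(2) comb_H1_graph[OF G] zH y(1))
    then show "\<exists>y\<in>W. (\<lambda>n. bilin G c (comb (z n) (-1) y) (comb (z n) (-1) y)) \<longlonglongrightarrow> 0"
      using closed[OF z y(1,2)] by blast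
  qed (use that in blast)+
qed

lemma zero_H1D: "metric_graph G \<Longrightarrow> (\<lambda>_ _. 0) \<in> H1D_graph G VD"
  unfolding H1D_graph_def
proof (intro CollectI conjI H1_graphI)
  show "\<exists>g. prim (len G e) (\<lambda>_. 0) g" for e
    by (rule exI[of _ "\<lambda>_. 0"]) (simp add: prim_def l2_const)
qed (auto simp: vertex_value_def)

lemma H1D_closed:
  assumes "metric_graph G" "\<And>n. z n \<in> H1D_graph G VD" "y \<in> H1_graph G"
    "\<And>e x. e \<in> edges G \<Longrightarrow> x \<in> {0..len G e} \<Longrightarrow> (\<lambda>n::nat. z n e x) \<longlonglongrightarrow> y e x"
  shows "y \<in> H1D_graph G VD"
  using assms vertex_value_limit[of G z _ "\<lambda>_. 0" 0 y] by (auto simp: H1D_graph_def)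

context
  fixes G :: "('v, 'e) mgraph" and n :: "'e \<Rightarrow> nat"
  assumes G: "metric_graph G" and n: "\<forall>e\<in>edges G. 1 \<le> n e"
begin

lemma Vh_H1: "y \<in> Vh G n \<Longrightarrow> y \<in> H1_graph G"
proof (rule H1_graphI[OF G])
  assume y: "y \<in> Vh G n"
  show "\<exists>g. prim (len G e) (y e) g" if "e \<in> edges G" for e
    using piecewise_affine_prim[of "len G e" "n e" "y e", OF _ _ _ refl] y that G n
    by (auto simp: Vh_def continuous_graph_def metric_graph_def)
  show "\<exists>c. vertex_value G y v c" if "v \<in> verts G" for v
    using y that by (auto simp: Vh_def continuous_graph_def)
qed

lemma VhI:
  assumes "y \<in> H1_graph G" and "\<And>e k. e \<in> edges G \<Longrightarrow> k < n e \<Longrightarrow> \<exists>a b.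
        \<forall>x\<in>{real k * (len G e / real (n e)) .. real (Suc k) * (len G e / real (n e))}. y e x = a + b * x"
  shows "y \<in> Vh G n"
  using assms by (simp add: Vh_def H1_graph_def)

lemma VhE:
  assumes "y \<in> Vh G n" "e \<in> edges G" "k < n e"
  obtains a b where "\<And>x. x \<in> {real k * (len G e / real (n e)) .. real (Suc k) * (len G e / real (n e))} \<Longrightarrow> y e x = a + b * x"
  using assms unfolding Vh_def by blast

lemma comb_Vh:
  assumes "y \<in> Vh G n" "w \<in> Vh G n"
  shows "comb y t w \<in> Vh G n"
proof (rule VhI[OF comb_H1_graph[OF G Vh_H1[OF assms(1)] Vh_H1[OF assms(2)]]])
  fix e k assume ek: "e \<in> edges G" "k < n e"
  obtain a b where 1: "\<And>x. x \<in> {real k * (len G e / real (n e)) .. real (Suc k) * (len G e / real (n e))} \<Longrightarrow> y e x = a + b * x"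
    using VhE[OF assms(1) ek] by blast
  obtain a' b' where 2: "\<And>x. x \<in> {real k * (len G e / real (n e)) .. real (Suc k) * (len G e / real (n e))} \<Longrightarrow> w e x = a' + b' * x"
    using VhE[OF assms(2) ek] by blast
  show "\<exists>a b. \<forall>x\<in>{real k * (len G e / real (n e)) .. real (Suc k) * (len G e / real (n e))}. comb y t w e x = a + b * x"
    by (intro exI[of _ "a + t * a'"] exI[of _ "b + t * b'"]) (simp add: comb_def 1 2 algebra_simps)
qed

text \<open>Being affine on \<open>[s,t]\<close> means agreeing with the chord through the end points,
  which is preserved by pointwise limits.\<close>

lemma Vh_closed:
  assumes z: "\<And>i. z i \<in> Vh G n" and y: "y \<in> H1_graph G"
    and lim: "\<And>e x. e \<in> edges G \<Longrightarrow> x \<in> {0..len G e} \<Longrightarrow> (\<lambda>i::nat. z i e x) \<longlonglongrightarrow> y e x"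
  shows "y \<in> Vh G n"
proof (rule VhI[OF y])
  fix e k assume ek: "e \<in> edges G" "k < n e"
  define s where "s = real k * (len G e / real (n e))"
  define t where "t = real (Suc k) * (len G e / real (n e))"
  have l: "0 < len G e" "1 \<le> n e" using ek G n by (auto simp: metric_graph_def)
  have st: "0 \<le> s" "s < t" "t \<le> len G e"
    using pieces_le[OF l(2) refl l(1) ek(2)] l ek(2) by (auto simp: s_def t_def field_simps)
  have aff: "y e x = y e s + (y e t - y e s) / (t - s) * (x - s)" if x: "x \<in> {s..t}" for x
  proof (rule LIMSEQ_unique)
    show "(\<lambda>i. z i e x) \<longlonglongrightarrow> y e x" using st x by (intro lim ek) auto
    have "z i e x = z i e s + (z i e t - z i e s) / (t - s) * (x - s)" for i
    proof -
      obtain a b where ab: "\<And>x. x \<in> {s..t} \<Longrightarrow> z i e x = a + b * x"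
        using VhE[OF z ek] unfolding s_def t_def by blast
      have "(z i e t - z i e s) / (t - s) = b" using st ab[of t] ab[of s] by (simp add: field_simps)
      then show ?thesis using ab[OF x] ab[of s] st by (simp add: algebra_simps)
    qed
    moreover have "(\<lambda>i. z i e s + (z i e t - z i e s) / (t - s) * (x - s)) \<longlonglongrightarrow> y e s + (y e t - y e s) / (t - s) * (x - s)"
      using st by (intro tendsto_intros lim ek) auto
    ultimately show "(\<lambda>i. z i e x) \<longlonglongrightarrow> y e s + (y e t - y e s) / (t - s) * (x - s)" by simp
  qed
  have "\<forall>x\<in>{s..t}. y e x = (y e s - (y e t - y e s) / (t - s) * s) + (y e t - y e s) / (t - s) * x"
  proof
    fix x assume "x \<in> {s..t}"
    from aff[OF this] show "y e x = (y e s - (y e t - y e s) / (t - s) * s) + (y e t - y e s) / (t - s) * x"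
      by (simp only: right_diff_distrib)
  qed
  then show "\<exists>a b. \<forall>x\<in>{real k * (len G e / real (n e)) .. real (Suc k) * (len G e / real (n e))}. y e x = a + b * x"
    unfolding s_def t_def by blast
qed

definition ginterp :: "'e gfun \<Rightarrow> 'e gfun" where
  "ginterp y = (\<lambda>e. interp (len G e) (n e) (y e))"

lemma ginterp_vertex: "vertex_value G y v c \<Longrightarrow> vertex_value G (ginterp y) v c"
  using G n by (auto simp: vertex_value_def ginterp_def interp_endpoints metric_graph_def)

lemma ginterp_Vh:
  assumes "y \<in> H1_graph G"
  shows "ginterp y \<in> Vh G n"
  unfolding Vh_def continuous_graph_def
proof (intro CollectI conjI ballI allI impI)
  show "continuous_on {0..len G e} (ginterp y e)" if "e \<in> edges G" for e
    unfolding ginterp_def using that G n by (intro interp_continuous) (auto simp: metric_graph_def)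
  show "\<exists>c. vertex_value G (ginterp y) v c" if "v \<in> verts G" for v
    using H1_graph_vertex[OF assms that] by (blast intro: ginterp_vertex)
  show "\<exists>a b. \<forall>x\<in>{real k * (len G e / real (n e))..real (Suc k) * (len G e / real (n e))}. ginterp y e x = a + b * x"
    if "e \<in> edges G" "k < n e" for e k
    unfolding ginterp_def using that G n by (intro interp_affine) (auto simp: metric_graph_def)
qed

lemma mesh_size_ge: "e \<in> edges G \<Longrightarrow> len G e / real (n e) \<le> mesh_size G n"
  unfolding mesh_size_def using G by (intro Max_ge) (auto simp: metric_graph_def)

text \<open>The edgewise estimates add up. The graph without edges is separate, since there
  \<open>mesh_size\<close> is the maximum of the empty set; both sides vanish.\<close>

lemma ginterp_error:
  assumes y: "y \<in> H1_graph G" and y2: "\<And>e. e \<in> edges G \<Longrightarrow> gderiv G y e \<in> H1_edge (len G e)"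
  shows "sqrt (H1_inner G (comb y (-1) (ginterp y)) (comb y (-1) (ginterp y)))
      \<le> sqrt (1 + (\<Sum>e\<in>edges G. (len G e)\<^sup>2)) * mesh_size G n * H2_seminorm G y"
proof (cases "edges G = {}")
  case True
  then show ?thesis by (simp add: H1_inner_def bilin_def H2_seminorm_def L2_norm_def L2_inner_def)
next
  case False
  have fin: "finite (edges G)" using G by (simp add: metric_graph_def)
  let ?K = "1 + (\<Sum>e\<in>edges G. (len G e)\<^sup>2)" and ?d = "comb y (-1) (ginterp y)"
  let ?k = "gderiv G (gderiv G y)"
  have kL2: "?k \<in> L2_graph G"
    using wderiv_H1_edge[OF y2] by (auto simp: L2_graph_def gderiv_def)
  have dH: "?d \<in> H1_graph G" by (intro comb_H1_graph[OF G] y Vh_H1 ginterp_Vh)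
  have "H1_inner G ?d ?d = (\<Sum>e\<in>edges G. integral {0..len G e} (\<lambda>x. (?d e x)\<^sup>2) + integral {0..len G e} (\<lambda>x. (gderiv G ?d e x)\<^sup>2))"
    by (rule H1_inner_edges[OF G dH H1_graph_prim[OF G dH]])
  also have "\<dots> \<le> (\<Sum>e\<in>edges G. ?K * (mesh_size G n)\<^sup>2 * integral {0..len G e} (\<lambda>x. (?k e x)\<^sup>2))"
  proof (rule sum_mono)
    fix e assume e: "e \<in> edges G"
    have l: "0 < len G e" "1 \<le> n e" using e G n by (auto simp: metric_graph_def)
    have l2k: "l2 0 (len G e) (?k e)" using kL2 e by (simp add: L2_graph_iff)
    have wd: "is_weak_deriv (len G e) (gderiv G y e) (?k e)"
      using wderiv_H1_edge[OF y2[OF e]] by (simp add: gderiv_def)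
    obtain g where g: "prim (len G e) g (?k e)" "aeq 0 (len G e) (gderiv G y e) g"
      using weak_deriv_imp_prim[OF l(1) prim_l2[OF H1_graph_prim[OF G y e]] l2k wd] .
    have d: "?d e = (\<lambda>x. y e x - interp (len G e) (n e) (y e) x)"
      by (simp add: comb_def ginterp_def)
    have "integral {0..len G e} (\<lambda>x. (?d e x)\<^sup>2) + integral {0..len G e} (\<lambda>x. (gderiv G ?d e x)\<^sup>2)
       \<le> (1 + (len G e)\<^sup>2) * (len G e / real (n e))\<^sup>2 * integral {0..len G e} (\<lambda>x. (?k e x)\<^sup>2)"
      using interp_error[OF l(2,1) refl H1_graph_prim[OF G y e] g(2,1) H1_graph_prim[OF G dH e, unfolded d]]
      by (simp add: d)
    also have "\<dots> \<le> ?K * (mesh_size G n)\<^sup>2 * integral {0..len G e} (\<lambda>x. (?k e x)\<^sup>2)"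
    proof (intro mult_right_mono mult_mono power_mono)
      show "1 + (len G e)\<^sup>2 \<le> ?K" using member_le_sum[OF e, of "\<lambda>e. (len G e)\<^sup>2"] fin by simp
      show "len G e / real (n e) \<le> mesh_size G n" by (rule mesh_size_ge[OF e])
      show "0 \<le> integral {0..len G e} (\<lambda>x. (?k e x)\<^sup>2)"
        by (intro integral_nonneg l2_sq_integrable l2k) simp
    qed (use l in \<open>auto intro!: add_nonneg_nonneg sum_nonneg\<close>)
    finally show "integral {0..len G e} (\<lambda>x. (?d e x)\<^sup>2) + integral {0..len G e} (\<lambda>x. (gderiv G ?d e x)\<^sup>2) \<le> \<dots>" .
  qed
  also have "\<dots> = ?K * (mesh_size G n)\<^sup>2 * (H2_seminorm G y)\<^sup>2"
    unfolding H2_seminorm_def L2_norm_sq L2_inner_eq[OF kL2 kL2]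
    by (simp add: sum_distrib_left power2_eq_square)
  finally have "sqrt (H1_inner G ?d ?d) \<le> sqrt (?K * (mesh_size G n)\<^sup>2 * (H2_seminorm G y)\<^sup>2)"
    by (rule real_sqrt_le_mono)
  also have "\<dots> = sqrt ?K * \<bar>mesh_size G n\<bar> * \<bar>H2_seminorm G y\<bar>"
    by (simp add: real_sqrt_mult)
  also have "\<bar>mesh_size G n\<bar> = mesh_size G n"
  proof -
    obtain e where e: "e \<in> edges G" using False by blast
    then have "0 \<le> len G e / real (n e)" using G by (auto simp: metric_graph_def less_imp_le)
    then show ?thesis using mesh_size_ge[OF e] by simp
  qed
  also have "\<bar>H2_seminorm G y\<bar> = H2_seminorm G y"
  proof -
    have "0 \<le> L2_inner G ?k ?k" using L2_norm_sq[of G ?k] zero_le_power2 by metis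
    then show ?thesis by (simp add: H2_seminorm_def L2_norm_def)
  qed
  finally show ?thesis .
qed

text \<open>An extension of vertex values that is affine on whole edges lies in the finite element space
  for every grid, so its norm bound does not depend on the grid.\<close>

definition lift :: "('v \<Rightarrow> real) \<Rightarrow> 'e gfun" where
  "lift d = (\<lambda>e x. d (src G e) + (d (tgt G e) - d (src G e)) / len G e * x)"

lemma lift_prim:
  assumes "e \<in> edges G"
  shows "prim (len G e) (lift d e) (\<lambda>_. (d (tgt G e) - d (src G e)) / len G e)"
  by (simp add: prim_def l2_const lift_def)

lemma lift_vertex: "vertex_value G (lift d) v (d v)"
  using G by (auto simp: vertex_value_def lift_def metric_graph_def)

lemma lift_Vh: "lift d \<in> Vh G n"
proof (rule VhI)
  show "lift d \<in> H1_graph G"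
    using lift_prim lift_vertex by (intro H1_graphI[OF G]) blast+
qed (unfold lift_def, intro exI ballI, rule refl)

lemma lift_bound:
  assumes m: "\<And>v. \<bar>d v\<bar> \<le> m"
  shows "H1_inner G (lift d) (lift d) \<le> (\<Sum>e\<in>edges G. len G e + 4 / len G e) * m\<^sup>2"
proof -
  have m0: "0 \<le> m" using m[of undefined] by linarith
  have "H1_inner G (lift d) (lift d) = (\<Sum>e\<in>edges G. integral {0..len G e} (\<lambda>x. (lift d e x)\<^sup>2)
      + integral {0..len G e} (\<lambda>x. ((d (tgt G e) - d (src G e)) / len G e)\<^sup>2))"
    by (rule H1_inner_edges[OF G Vh_H1[OF lift_Vh] lift_prim])
  also have "\<dots> \<le> (\<Sum>e\<in>edges G. (len G e + 4 / len G e) * m\<^sup>2)"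
  proof (rule sum_mono)
    fix e assume e: "e \<in> edges G"
    have l: "0 < len G e" using e G by (auto simp: metric_graph_def)
    let ?s = "d (src G e)" and ?t = "d (tgt G e)"
    have "(lift d e x)\<^sup>2 \<le> m\<^sup>2" if x: "x \<in> {0..len G e}" for x
    proof -
      define \<theta> where "\<theta> = x / len G e"
      have \<theta>: "0 \<le> \<theta>" "\<theta> \<le> 1" using x l by (auto simp: \<theta>_def)
      have "lift d e x = (1 - \<theta>) * ?s + \<theta> * ?t" by (simp add: lift_def \<theta>_def algebra_simps diff_divide_distrib)
      also have "\<bar>\<dots>\<bar> \<le> (1 - \<theta>) * \<bar>?s\<bar> + \<theta> * \<bar>?t\<bar>"
        using \<theta> abs_triangle_ineq[of "(1 - \<theta>) * ?s" "\<theta> * ?t"] by (simp add: abs_mult)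
      also have "\<dots> \<le> (1 - \<theta>) * m + \<theta> * m" using \<theta> m by (intro add_mono mult_left_mono) auto
      finally have "\<bar>lift d e x\<bar> \<le> m" by (simp add: algebra_simps)
      then show ?thesis using m0 by (simp add: abs_le_square_iff[symmetric])
    qed
    then have "integral {0..len G e} (\<lambda>x. (lift d e x)\<^sup>2) \<le> integral {0..len G e} (\<lambda>x. m\<^sup>2)"
      by (intro integral_le l2_sq_integrable[OF prim_l2_self[OF lift_prim[OF e]]] l2_integrable[OF l2_const])
    then have 1: "integral {0..len G e} (\<lambda>x. (lift d e x)\<^sup>2) \<le> len G e * m\<^sup>2" using l by simp
    have "\<bar>?t - ?s\<bar> \<le> 2 * m" using m[of "src G e"] m[of "tgt G e"] by linarith
    then have "\<bar>?t - ?s\<bar>\<^sup>2 \<le> (2 * m)\<^sup>2" by (intro power_mono) auto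
    then have "(?t - ?s)\<^sup>2 \<le> (2 * m)\<^sup>2" by simp
    then have "(?t - ?s)\<^sup>2 / len G e \<le> 4 * m\<^sup>2 / len G e" using l by (intro divide_right_mono) (auto simp: power_mult_distrib)
    moreover have "integral {0..len G e} (\<lambda>x. ((?t - ?s) / len G e)\<^sup>2) = (?t - ?s)\<^sup>2 / len G e"
      using l by (simp add: power_divide power2_eq_square)
    ultimately show "integral {0..len G e} (\<lambda>x. (lift d e x)\<^sup>2) + integral {0..len G e} (\<lambda>x. ((?t - ?s) / len G e)\<^sup>2)
        \<le> (len G e + 4 / len G e) * m\<^sup>2"
      using 1 by (simp add: algebra_simps)
  qed
  finally show ?thesis by (simp add: sum_distrib_right)
qed

end

text \<open>Test functions of a single edge, extended by zero to the other edges, belong to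
  \<open>H1D_graph\<close>. Testing with them shows that \<open>c y - F\<close> is the weak
  derivative of \<open>y'\<close>.\<close>

lemma weak_solution_regular:
  fixes G :: "('v, 'e) mgraph"
  assumes G: "metric_graph G" and c: "c \<in> Linf_graph G" and y: "y \<in> H1_graph G" and F: "F \<in> L2_graph G"
    and eq: "\<And>w. w \<in> H1D_graph G VD \<Longrightarrow> bilin G c y w = L2_inner G F w" and e: "e \<in> edges G"
  shows "gderiv G y e \<in> H1_edge (len G e)"
proof -
  let ?l = "len G e"
  have l: "0 < ?l" and fin: "finite (edges G)" using e G by (auto simp: metric_graph_def)
  have l2s: "l2 0 ?l (gderiv G y e)" "l2 0 ?l (gmult c y e)" "l2 0 ?l (F e)"
    using gderiv_L2[OF G y] gmult_L2[OF c H1_graph_L2[OF G y]] F e by (auto simp: L2_graph_iff)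
  define k where "k = (\<lambda>x. gmult c y e x - F e x)"
  have l2k: "l2 0 ?l k" unfolding k_def by (intro l2_diff l2s)
  have "is_weak_deriv ?l (gderiv G y e) k"
    unfolding is_weak_deriv_iff[OF l2s(1) l2k]
  proof
    fix \<phi> assume "\<phi> \<in> test_functions ?l"
    then obtain D where D: "\<And>x. (\<phi> has_vector_derivative D x) (at x)" "continuous_on UNIV D" "deriv \<phi> = D"
      "\<And>x. x \<notin> {0<..<?l} \<Longrightarrow> \<phi> x = 0" "continuous_on UNIV \<phi>"
      by (erule test_functionE)
    have l2D: "l2 0 ?l D" "l2 0 ?l \<phi>"
      using D by (auto intro!: l2_continuous elim: continuous_on_subset)
    have "\<phi> x = \<phi> 0 + integral {0..x} D" if "x \<in> {0..?l}" for x
    proof -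
      have "(D has_integral (\<phi> x - \<phi> 0)) {0..x}"
        using that D(1) by (intro fundamental_theorem_of_calculus) (auto intro: has_vector_derivative_at_within)
      then show ?thesis by (simp add: integral_unique)
    qed
    then have p\<phi>: "prim ?l \<phi> D" unfolding prim_def using l2D by blast
    define w where "w = (\<lambda>e'. if e' = e then \<phi> else (\<lambda>_. 0))"
    define gw where "gw = (\<lambda>e'. if e' = e then D else (\<lambda>_. 0))"
    have pw: "prim (len G e') (w e') (gw e')" for e'
    proof -
      have "prim (len G e') (\<lambda>_. 0) (\<lambda>_. 0)" by (simp add: prim_def l2_const)
      then show ?thesis using p\<phi> by (simp add: w_def gw_def)
    qed
    have v0: "vertex_value G w v 0" for v
      using D(4)[of 0] D(4)[of ?l] by (auto simp: vertex_value_def w_def)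
    have wH: "w \<in> H1_graph G" using pw v0 by (intro H1_graphI[OF G]) blast+
    then have wD: "w \<in> H1D_graph G VD" using v0 by (simp add: H1D_graph_def)
    have gwL: "gw \<in> L2_graph G" using prim_l2[OF pw] by (simp add: L2_graph_iff)
    have single: "L2_inner G f g = integral {0..?l} (\<lambda>x. f e x * g e x)"
      if "f \<in> L2_graph G" "g \<in> L2_graph G" "\<And>e'. e' \<noteq> e \<Longrightarrow> g e' = (\<lambda>_. 0)" for f g
    proof -
      have "L2_inner G f g = (\<Sum>e'\<in>edges G. if e' = e then integral {0..?l} (\<lambda>x. f e x * g e x) else 0)"
        unfolding L2_inner_eq[OF that(1,2)] using that(3) by (intro sum.cong) auto
      then show ?thesis using fin e by simp
    qed
    have "L2_inner G (gderiv G y) (gderiv G w) = L2_inner G (gderiv G w) (gderiv G y)"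
      by (simp add: L2_inner_def mult.commute)
    also have "\<dots> = L2_inner G gw (gderiv G y)"
      by (intro L2_inner_aeq gderiv_L2[OF G] wH y gderiv_aeq[OF G _ pw])
    also have "\<dots> = L2_inner G (gderiv G y) gw"
      by (simp add: L2_inner_def mult.commute)
    also have "\<dots> = integral {0..?l} (\<lambda>x. gderiv G y e x * D x)"
      by (subst single[OF gderiv_L2[OF G y] gwL]) (auto simp: gw_def)
    finally have 1: "L2_inner G (gderiv G y) (gderiv G w) = \<dots>" .
    have 2: "L2_inner G (gmult c y) w = integral {0..?l} (\<lambda>x. gmult c y e x * \<phi> x)"
      by (subst single[OF gmult_L2[OF c H1_graph_L2[OF G y]] H1_graph_L2[OF G wH]]) (auto simp: w_def)
    have 3: "L2_inner G F w = integral {0..?l} (\<lambda>x. F e x * \<phi> x)"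
      by (subst single[OF F H1_graph_L2[OF G wH]]) (auto simp: w_def)
    have "integral {0..?l} (\<lambda>x. k x * \<phi> x) = integral {0..?l} (\<lambda>x. gmult c y e x * \<phi> x) - integral {0..?l} (\<lambda>x. F e x * \<phi> x)"
      unfolding k_def left_diff_distrib by (intro integral_diff l2_mult_integrable l2s l2D)
    then show "integral {0..?l} (\<lambda>x. gderiv G y e x * deriv \<phi> x) = - integral {0..?l} (\<lambda>x. k x * \<phi> x)"
      using eq[OF wD] bilin_eq[OF G c y wH] 1 2 3 by (simp add: D(3))
  qed
  then show ?thesis using l2s(1) l2k by (auto simp: H1_edge_def L2_edge_iff)
qed

text \<open>First order optimality in the direction \<open>(d, s)\<close>, for arbitrary state and test
  spaces: it is used for the continuous and for the discrete problem. The objective along this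
  line is a quadratic in \<open>t\<close>.\<close>

lemma optimality_condition:
  assumes G: "metric_graph G" and c: "c \<in> Linf_graph G"
    and nn: "\<forall>e\<in>edges G. AE x in lebesgue_on {0<..<len G e}. 0 \<le> c e x" and fin: "finite VD"
    and opt: "optimal G VD c \<beta> f ybar Y W u y" and ybar: "ybar \<in> L2_graph G"
    and YW: "Y \<subseteq> H1_graph G" "W \<subseteq> H1_graph G" "\<And>y t w. y \<in> Y \<Longrightarrow> w \<in> Y \<Longrightarrow> comb y t w \<in> Y"
    and s: "s \<in> Y" "\<And>v. v \<in> VD \<Longrightarrow> vertex_value G s v (d v)" "\<And>w. w \<in> W \<Longrightarrow> bilin G c s w = 0"
  shows "L2_inner G (gdiff y ybar) s + \<beta> * (\<Sum>v\<in>VD. u v * d v) = 0"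
proof -
  interpret A: semi_inner "H1_graph G" "bilin G c" by (rule semi_inner_bilin[OF G c nn])
  interpret L: semi_inner "L2_graph G" "L2_inner G" by (rule semi_inner_L2)
  have feas: "y \<in> Y" "\<And>v. v \<in> VD \<Longrightarrow> vertex_value G y v (u v)" "\<And>w. w \<in> W \<Longrightarrow> bilin G c y w = L2_inner G f w"
    using opt by (auto simp: optimal_def feasible_def)
  have sL: "s \<in> L2_graph G" and yL: "y \<in> L2_graph G" using s feas YW H1_graph_L2[OF G] by blast+
  have dL: "gdiff y ybar \<in> L2_graph G" unfolding gdiff_eq_comb by (intro comb_L2_graph yL ybar)
  define B where "B = L2_inner G (gdiff y ybar) s + \<beta> * (\<Sum>v\<in>VD. u v * d v)"
  define E where "E = L2_inner G s s + \<beta> * (\<Sum>v\<in>VD. (d v)\<^sup>2)"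
  have sq: "(L2_set x VD)\<^sup>2 = (\<Sum>v\<in>VD. (x v)\<^sup>2)" for x
    unfolding L2_set_def by (simp add: sum_nonneg)
  have quad: "0 \<le> 0 + 2 * t * B + t\<^sup>2 * E" for t
  proof -
    have "feasible G VD c f Y W (\<lambda>v. u v + t * d v) (comb y t s)"
      unfolding feasible_def
    proof (intro conjI ballI)
      show "comb y t s \<in> Y" using YW(3) feas(1) s(1) .
      show "vertex_value G (comb y t s) v (u v + t * d v)" if "v \<in> VD" for v
        by (intro vertex_value_comb feas s that)
      show "bilin G c (comb y t s) w = L2_inner G f w" if "w \<in> W" for w
        using A.comb_left[of y s w t] feas s YW that by (auto simp: subset_iff)
    qed
    then have "objective G VD \<beta> ybar u y \<le> objective G VD \<beta> ybar (\<lambda>v. u v + t * d v) (comb y t s)"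
      using opt unfolding optimal_def by blast
    moreover have "gdiff (comb y t s) ybar = comb (gdiff y ybar) t s"
      by (simp add: gdiff_def comb_def fun_eq_iff)
    moreover have "(\<Sum>v\<in>VD. (u v + t * d v)\<^sup>2) = (\<Sum>v\<in>VD. (u v)\<^sup>2) + 2 * t * (\<Sum>v\<in>VD. u v * d v) + t\<^sup>2 * (\<Sum>v\<in>VD. (d v)\<^sup>2)"
      by (simp add: power2_sum sum.distrib sum_distrib_left power_mult_distrib algebra_simps)
    ultimately show ?thesis
      using L.comb_comb[OF dL sL, of t]
      by (simp add: objective_def L2_norm_sq sq B_def E_def algebra_simps)
  qed
  have "B\<^sup>2 \<le> 0 * \<bar>E\<bar>"
  proof (rule quadratic_nonneg_discriminant)
    show "0 \<le> 0 + 2 * t * B + t\<^sup>2 * \<bar>E\<bar>" for t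
      using quad[of t] mult_left_mono[OF abs_ge_self[of E] zero_le_power2[of t]] by linarith
  qed simp
  then show ?thesis by (simp add: B_def)
qed

section \<open>The error estimate\<close>

context
  fixes G :: "('v, 'e) mgraph" and VD :: "'v set" and c0 :: "'e gfun" and \<alpha> C \<beta> :: real
  assumes G: "metric_graph G" and VD: "VD \<subseteq> verts G" and c0: "c0 \<in> Linf_graph G"
    and nn: "\<forall>e\<in>edges G. AE x in lebesgue_on {0<..<len G e}. 0 \<le> c0 e x"
    and \<alpha>: "0 < \<alpha>" "\<And>w. w \<in> H1D_graph G VD \<Longrightarrow> \<alpha> * H1_inner G w w \<le> bilin G c0 w w"
    and C: "1 \<le> C" "\<And>y. y \<in> H1_graph G \<Longrightarrow> bilin G c0 y y \<le> C * H1_inner G y y"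
    and \<beta>: "0 < \<beta>"
begin

interpretation A: semi_inner "H1_graph G" "bilin G c0" by (rule semi_inner_bilin[OF G c0 nn])
interpretation H: semi_inner "H1_graph G" "H1_inner G" by (rule semi_inner_H1[OF G])
interpretation L: semi_inner "L2_graph G" "L2_inner G" by (rule semi_inner_L2)

lemma energy_le: "y \<in> H1_graph G \<Longrightarrow> A.norm_of y \<le> sqrt C * H.norm_of y"
  using real_sqrt_le_mono[OF C(2)] by (simp add: A.norm_of_def H.norm_of_def real_sqrt_mult)

lemma energy_ge: "w \<in> H1D_graph G VD \<Longrightarrow> H.norm_of w \<le> A.norm_of w / sqrt \<alpha>"
  using real_sqrt_le_mono[OF \<alpha>(2)] \<alpha>(1)
  by (simp add: A.norm_of_def H.norm_of_def real_sqrt_mult pos_le_divide_eq mult.commute)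

lemma L2_le_H1: "y \<in> H1_graph G \<Longrightarrow> L.norm_of y \<le> H.norm_of y"
  using real_sqrt_le_mono[OF L2_inner_le_H1_inner[OF G]] by (simp add: L.norm_of_def H.norm_of_def)

lemma H1D_H1: "w \<in> H1D_graph G VD \<Longrightarrow> w \<in> H1_graph G"
  by (simp add: H1D_graph_def)

lemma finite_VD: "finite VD"
  using G VD finite_subset by (auto simp: metric_graph_def)

text \<open>Bounds in terms of these constants: the discrete harmonic extension of \<open>d\<close> by
  \<open>lift_const |d|\<close>, the finite element error for exact boundary values by
  \<open>ritz_const\<close> times the interpolation error (Cea's lemma), and the total error by
  \<open>total_const\<close> times the sum of the interpolation errors.\<close>

definition "lift_const = (1 + sqrt C / sqrt \<alpha>) * sqrt (\<Sum>e\<in>edges G. len G e + 4 / len G e)"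
definition "ritz_const = sqrt C / sqrt \<alpha>"
definition "total_const = (1 + lift_const) * (lift_const / \<beta> * (C + ritz_const)) + ritz_const"

lemma const_pos: "0 \<le> lift_const" "0 < ritz_const" "0 < total_const"
proof -
  have "0 \<le> (\<Sum>e\<in>edges G. len G e + 4 / len G e)"
    using G by (intro sum_nonneg add_nonneg_nonneg divide_nonneg_nonneg) (auto simp: metric_graph_def less_imp_le)
  then show 1: "0 \<le> lift_const" using C \<alpha> by (simp add: lift_const_def)
  show 2: "0 < ritz_const" using C \<alpha> by (simp add: ritz_const_def)
  show "0 < total_const" using 1 2 C \<beta> unfolding total_const_def
    by (intro add_nonneg_pos mult_nonneg_nonneg divide_nonneg_nonneg) auto
qed

text \<open>The harmonic extension \<open>s\<close> of the control error is the direction in which both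
  optimality conditions are evaluated. Orthogonality is available for the energy product, the
  bounds are wanted in \<open>H1\<close>; passing between them costs the factors
  \<open>\<surd>C\<close> and \<open>1 / \<surd>\<alpha>\<close>.\<close>

lemma error_le_interpolation_errors:
  assumes n: "\<forall>e\<in>edges G. 1 \<le> n e" and ybar: "ybar \<in> L2_graph G"
    and P: "solves_P G VD c0 \<beta> f ybar u y" and Ph: "solves_Ph G VD c0 \<beta> f ybar n uh yh"
    and p: "is_adjoint G VD c0 ybar y p"
  shows "L2_set (\<lambda>v. u v - uh v) VD + H.norm_of (comb y (-1) yh)
    \<le> total_const * (H.norm_of (comb y (-1) (ginterp G n y)) + H.norm_of (comb p (-1) (ginterp G n p)))"
proof -
  note Vh_H1 = Vh_H1[OF G n] and comb_Vh = comb_Vh[OF G n]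
  have y: "y \<in> H1_graph G" "\<And>v. v \<in> VD \<Longrightarrow> vertex_value G y v (u v)"
    "\<And>w. w \<in> H1D_graph G VD \<Longrightarrow> bilin G c0 y w = L2_inner G f w"
    using P by (auto simp: solves_P_def optimal_def feasible_def)
  have yh: "yh \<in> Vh G n" "\<And>v. v \<in> VD \<Longrightarrow> vertex_value G yh v (uh v)"
    "\<And>w. w \<in> VhD G VD n \<Longrightarrow> bilin G c0 yh w = L2_inner G f w"
    using Ph by (auto simp: solves_Ph_def optimal_def feasible_def)
  have p: "p \<in> H1D_graph G VD" "\<And>w. w \<in> H1D_graph G VD \<Longrightarrow> bilin G c0 w p = L2_inner G (gdiff y ybar) w"
    using p by (auto simp: is_adjoint_def)
  note yhH = Vh_H1[OF yh(1)] and pH = H1D_H1[OF p(1)]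
  have WhW: "VhD G VD n \<subseteq> H1D_graph G VD" and WhV: "VhD G VD n \<subseteq> Vh G n" by (auto simp: VhD_def)
  have combW: "comb w t w' \<in> H1D_graph G VD" if "w \<in> H1D_graph G VD" "w' \<in> H1D_graph G VD" for w t w'
    by (rule comb_H1D_graph[OF G that])
  have combWh: "comb w t w' \<in> VhD G VD n" if "w \<in> VhD G VD n" "w' \<in> VhD G VD n" for w t w'
    using that combW comb_Vh by (auto simp: VhD_def)
  have zeroWh: "(\<lambda>_ _. 0) \<in> VhD G VD n"
  proof -
    have "(\<lambda>_ _. 0) \<in> Vh G n"
    proof (rule VhI[OF G n])
      show "\<exists>a b. \<forall>x\<in>{real k * (len G e / real (n e))..real (Suc k) * (len G e / real (n e))}. (0::real) = a + b * x" for e k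
        by (intro exI[of _ 0]) simp
    qed (rule H1D_H1[OF zero_H1D[OF G]])
    then show ?thesis using zero_H1D[OF G] by (simp add: VhD_def)
  qed
  have projW: "\<exists>z\<in>H1D_graph G VD. \<forall>w\<in>H1D_graph G VD. bilin G c0 (comb b (-1) z) w = 0"
    if b: "b \<in> H1_graph G" for b
  proof (rule projection_exists[OF G c0 nn \<alpha>(1) \<alpha>(2) order_refl zero_H1D[OF G] combW _ b])
    fix z :: "nat \<Rightarrow> 'e gfun" and w
    assume z: "\<And>i. z i \<in> H1D_graph G VD" and w: "w \<in> H1_graph G"
      and lim: "\<And>e x. e \<in> edges G \<Longrightarrow> x \<in> {0..len G e} \<Longrightarrow> (\<lambda>i. z i e x) \<longlonglongrightarrow> w e x"
    show "w \<in> H1D_graph G VD" by (rule H1D_closed[OF G z w lim])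
  qed blast+
  have projWh: "\<exists>z\<in>VhD G VD n. \<forall>w\<in>VhD G VD n. bilin G c0 (comb b (-1) z) w = 0"
    if b: "b \<in> H1_graph G" for b
  proof (rule projection_exists[OF G c0 nn \<alpha>(1) \<alpha>(2) WhW zeroWh combWh _ b])
    fix z :: "nat \<Rightarrow> 'e gfun" and w
    assume z: "\<And>i. z i \<in> VhD G VD n" and w: "w \<in> H1_graph G"
      and lim: "\<And>e x. e \<in> edges G \<Longrightarrow> x \<in> {0..len G e} \<Longrightarrow> (\<lambda>i. z i e x) \<longlonglongrightarrow> w e x"
    have zV: "z i \<in> Vh G n" and zD: "z i \<in> H1D_graph G VD" for i using z[of i] by (auto simp: VhD_def)
    show "w \<in> VhD G VD n"
      using Vh_closed[OF G n zV w lim] H1D_closed[OF G zD w lim] by (auto simp: VhD_def)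
  qed blast+
  \<comment> \<open>By the adjoint equation the optimality condition for the harmonic extension \<open>b - z\<close> of \<open>d\<close>
    takes a form that holds for every extension \<open>b\<close>.\<close>
  have opt: "\<beta> * (\<Sum>v\<in>VD. u v * d v) + L2_inner G (gdiff y ybar) b - bilin G c0 b p = 0"
    if b: "b \<in> H1_graph G" "\<And>v. v \<in> VD \<Longrightarrow> vertex_value G b v (d v)" for b d
  proof -
    obtain z where z: "z \<in> H1D_graph G VD" "\<And>w. w \<in> H1D_graph G VD \<Longrightarrow> bilin G c0 (comb b (-1) z) w = 0"
      using projW[OF b(1)] by blast
    note zH = H1D_H1[OF z(1)]
    have dL: "gdiff y ybar \<in> L2_graph G"
      unfolding gdiff_eq_comb by (intro comb_L2_graph H1_graph_L2[OF G] y ybar)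
    have "L2_inner G (gdiff y ybar) (comb b (-1) z) + \<beta> * (\<Sum>v\<in>VD. u v * d v) = 0"
    proof (rule optimality_condition[OF G c0 nn finite_VD P[unfolded solves_P_def] ybar order_refl])
      show "vertex_value G (comb b (-1) z) v (d v)" if "v \<in> VD" for v
        using vertex_value_comb[OF b(2)[OF that], of z 0 "-1"] z(1) that by (simp add: H1D_graph_def)
    qed (use H1D_H1 z comb_H1_graph[OF G] b(1) zH in auto)
    moreover have "L2_inner G (gdiff y ybar) (comb b (-1) z) = L2_inner G (gdiff y ybar) b - L2_inner G (gdiff y ybar) z"
      using L.comb_right[OF _ _ dL, of b z "-1"] H1_graph_L2[OF G] b zH by simp
    moreover have "bilin G c0 (comb b (-1) z) p = bilin G c0 b p - bilin G c0 z p"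
      using A.comb_left[OF b(1) zH pH, of "-1"] by simp
    ultimately show ?thesis using p(2)[OF z(1)] z(2)[OF p(1)] by linarith
  qed
  define d where "d = (\<lambda>v. if v \<in> VD then u v - uh v else 0)"
  define D where "D = L2_set (\<lambda>v. u v - uh v) VD"
  have D0: "0 \<le> D" by (simp add: D_def)
  have D2: "(\<Sum>v\<in>VD. (u v - uh v) * d v) = D\<^sup>2"
    by (simp add: D_def L2_set_def sum_nonneg d_def power2_eq_square)
  have dD: "\<bar>d v\<bar> \<le> D" for v
    using member_le_L2_set[OF finite_VD, of v "\<lambda>v. \<bar>u v - uh v\<bar>"] D0 by (simp add: d_def D_def L2_set_def)
  define b where "b = lift G d"
  have bV: "b \<in> Vh G n" unfolding b_def by (rule lift_Vh[OF G n])
  note bH = Vh_H1[OF bV]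
  let ?Kl = "sqrt (\<Sum>e\<in>edges G. len G e + 4 / len G e)"
  have bN: "H.norm_of b \<le> ?Kl * D"
    using real_sqrt_le_mono[OF lift_bound[OF G n, of d D]] dD D0
    by (simp add: H.norm_of_def b_def real_sqrt_mult)
  obtain z where z: "z \<in> VhD G VD n" "\<And>w. w \<in> VhD G VD n \<Longrightarrow> bilin G c0 (comb b (-1) z) w = 0"
    using projWh[OF bH] by blast
  have zW: "z \<in> H1D_graph G VD" and zV: "z \<in> Vh G n" using z(1) by (auto simp: VhD_def)
  note zH = H1D_H1[OF zW]
  \<comment> \<open>\<open>s\<close> is the discrete harmonic extension of \<open>d\<close>.\<close>
  define s where "s = comb b (-1) z"
  have sV: "s \<in> Vh G n" unfolding s_def by (intro comb_Vh bV zV)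
  note sH = Vh_H1[OF sV]
  have sW: "bilin G c0 s w = 0" if "w \<in> VhD G VD n" for w using z(2)[OF that] by (simp add: s_def)
  have sv: "vertex_value G s v (u v - uh v)" if "v \<in> VD" for v
    using vertex_value_comb[OF lift_vertex[OF G n, of d v], of z 0 "-1"] zW that
    by (simp add: H1D_graph_def s_def b_def d_def)
  have sN: "H.norm_of s \<le> lift_const * D"
  proof -
    have "bilin G c0 b b = bilin G c0 s s + bilin G c0 z z"
    proof -
      have "b = comb s 1 z" by (simp add: s_def comb_def)
      then show ?thesis using A.comb_comb[OF sH zH, of 1] sW[OF z(1)] by simp
    qed
    then have "A.norm_of z \<le> A.norm_of b" using A.nonneg[OF sH] by (simp add: A.norm_of_def)
    also have "\<dots> \<le> sqrt C * H.norm_of b" by (rule energy_le[OF bH])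
    finally have "A.norm_of z / sqrt \<alpha> \<le> sqrt C * H.norm_of b / sqrt \<alpha>" using \<alpha>(1) by (intro divide_right_mono) auto
    then have "H.norm_of z \<le> sqrt C / sqrt \<alpha> * H.norm_of b" using energy_ge[OF zW] by simp
    moreover have "H.norm_of s \<le> H.norm_of b + H.norm_of z" using H.triangle[OF bH zH, of "-1"] by (simp add: s_def)
    ultimately have "H.norm_of s \<le> (1 + sqrt C / sqrt \<alpha>) * H.norm_of b" by (simp add: algebra_simps)
    also have "\<dots> \<le> (1 + sqrt C / sqrt \<alpha>) * (?Kl * D)"
      using C \<alpha> by (intro mult_left_mono bN) auto
    finally show ?thesis by (simp add: lift_const_def)
  qed
  define Iy where "Iy = ginterp G n y"
  define Ip where "Ip = ginterp G n p"
  have IyV: "Iy \<in> Vh G n" and IpV: "Ip \<in> Vh G n"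
    unfolding Iy_def Ip_def by (intro ginterp_Vh[OF G n] y pH)+
  note IyH = Vh_H1[OF IyV] and IpH = Vh_H1[OF IpV]
  have IpW: "Ip \<in> VhD G VD n"
    using p(1) IpV IpH ginterp_vertex[OF G n] by (auto simp: VhD_def H1D_graph_def Ip_def)
  define ey where "ey = comb y (-1) Iy"
  define ep where "ep = comb p (-1) Ip"
  have eH: "ey \<in> H1_graph G" "ep \<in> H1_graph G"
    unfolding ey_def ep_def by (intro comb_H1_graph[OF G] y pH IyH IpH)+
  \<comment> \<open>The discrete state with exact boundary values \<open>u\<close> is \<open>yh + s\<close>; its error \<open>r\<close> is \<open>a\<close>-orthogonal to \<open>VhD\<close>.\<close>
  define r where "r = comb (comb y (-1) yh) (-1) s"
  have eyhH: "comb y (-1) yh \<in> H1_graph G" by (intro comb_H1_graph[OF G] y yhH)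
  have rH: "r \<in> H1_graph G" unfolding r_def by (intro comb_H1_graph[OF G] eyhH sH)
  have rW: "r \<in> H1D_graph G VD"
    unfolding H1D_graph_def
  proof (intro CollectI conjI ballI rH)
    fix v assume v: "v \<in> VD"
    show "vertex_value G r v 0"
      using vertex_value_comb[OF vertex_value_comb[OF y(2)[OF v] yh(2)[OF v], of "-1"] sv[OF v], of "-1"]
      by (simp add: r_def)
  qed
  have r0: "bilin G c0 r w = 0" if w: "w \<in> VhD G VD n" for w
  proof -
    have wW: "w \<in> H1D_graph G VD" using w WhW by blast
    note wH = H1D_H1[OF wW]
    have "bilin G c0 r w = bilin G c0 y w - bilin G c0 yh w - bilin G c0 s w"
      using A.comb_left[OF eyhH sH wH, of "-1"] A.comb_left[OF y(1) yhH wH, of "-1"] by (simp add: r_def)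
    then show ?thesis using y(3)[OF wW] yh(3)[OF w] sW[OF w] by simp
  qed
  have rN: "H.norm_of r \<le> ritz_const * H.norm_of ey"
  proof -
    \<comment> \<open>\<open>r\<close> and the interpolation error \<open>ey\<close> differ by an element of \<open>VhD\<close>, which is orthogonal to \<open>r\<close>.\<close>
    define q where "q = comb r (-1) ey"
    have qH: "q \<in> H1_graph G" unfolding q_def by (intro comb_H1_graph[OF G] rH eH)
    have "q = comb (comb Iy (-1) yh) (-1) s"
      by (auto simp: q_def r_def ey_def comb_def fun_eq_iff)
    then have "q \<in> Vh G n" using comb_Vh IyV yh(1) sV by simp
    moreover have "vertex_value G q v 0" if v: "v \<in> VD" for v
    proof -
      have "vertex_value G r v 0" using rW v by (simp add: H1D_graph_def)
      moreover have "vertex_value G ey v (u v + -1 * u v)"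
        unfolding ey_def Iy_def by (intro vertex_value_comb y(2) ginterp_vertex[OF G n] v)
      ultimately show ?thesis using vertex_value_comb[of G r v 0 ey 0 "-1"] by (simp add: q_def)
    qed
    ultimately have "q \<in> VhD G VD n" using qH by (simp add: VhD_def H1D_graph_def)
    then have "bilin G c0 r q = 0" by (rule r0)
    moreover have "bilin G c0 r q = bilin G c0 r r - bilin G c0 r ey"
      using A.comb_right[OF rH eH(1) rH, of "-1"] by (simp add: q_def)
    ultimately have "(A.norm_of r)\<^sup>2 = bilin G c0 r ey" using A.norm_of_sq[OF rH] by simp
    also have "\<dots> \<le> A.norm_of r * A.norm_of ey" using A.Cauchy_Schwarz[OF rH eH(1)] by linarith
    finally have "A.norm_of r \<le> A.norm_of ey"
      using A.norm_of_nonneg[OF rH] A.norm_of_nonneg[OF eH(1)]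
      by (cases "A.norm_of r = 0") (auto simp: power2_eq_square)
    also have "\<dots> \<le> sqrt C * H.norm_of ey" by (rule energy_le[OF eH(1)])
    finally have "A.norm_of r / sqrt \<alpha> \<le> sqrt C * H.norm_of ey / sqrt \<alpha>" using \<alpha>(1) by (intro divide_right_mono) auto
    then show ?thesis using energy_ge[OF rW] by (simp add: ritz_const_def)
  qed
  have main: "\<beta> * D\<^sup>2 \<le> lift_const * D * (C * H.norm_of ep + ritz_const * H.norm_of ey)"
  proof -
    have yL: "y \<in> L2_graph G" and yhL: "yh \<in> L2_graph G" and sL: "s \<in> L2_graph G" and rL: "r \<in> L2_graph G"
      using y yhH sH rH H1_graph_L2[OF G] by blast+
    have dLs: "L2_inner G (gdiff w ybar) s = L2_inner G w s - L2_inner G ybar s" if "w \<in> L2_graph G" for w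
      unfolding gdiff_eq_comb using L.comb_left[OF that ybar sL, of "-1"] by simp
    have 1: "\<beta> * (\<Sum>v\<in>VD. u v * (u v - uh v)) + L2_inner G (gdiff y ybar) s - bilin G c0 s p = 0"
      by (rule opt[OF sH sv])
    have 2: "L2_inner G (gdiff yh ybar) s + \<beta> * (\<Sum>v\<in>VD. uh v * (u v - uh v)) = 0"
    proof (rule optimality_condition[OF G c0 nn finite_VD Ph[unfolded solves_Ph_def] ybar])
      show "VhD G VD n \<subseteq> H1_graph G" using WhV Vh_H1 by blast
    qed (use Vh_H1 comb_Vh sV sv sW in auto)
    have "(\<Sum>v\<in>VD. u v * (u v - uh v)) - (\<Sum>v\<in>VD. uh v * (u v - uh v)) = D\<^sup>2"
      unfolding sum_subtractf[symmetric] D2[symmetric]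
      by (rule sum.cong) (auto simp: d_def algebra_simps)
    then have 3: "\<beta> * (\<Sum>v\<in>VD. u v * (u v - uh v)) - \<beta> * (\<Sum>v\<in>VD. uh v * (u v - uh v)) = \<beta> * D\<^sup>2"
      by (simp add: right_diff_distrib[symmetric])
    have 4: "bilin G c0 s ep = bilin G c0 s p"
      using A.comb_right[OF pH IpH sH, of "-1"] sW[OF IpW] by (simp add: ep_def)
    have "comb y (-1) yh = comb r 1 s" by (simp add: r_def comb_def)
    then have 5: "L2_inner G y s - L2_inner G yh s = L2_inner G r s + L2_inner G s s"
      using L.comb_left[OF yL yhL sL, of "-1"] L.comb_left[OF rL sL sL, of 1] by simp
    have "\<beta> * D\<^sup>2 = bilin G c0 s ep - L2_inner G r s - L2_inner G s s"
      using 1 2 3 4 5 dLs[OF yL] dLs[OF yhL] by linarith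
    also have "\<dots> \<le> \<bar>bilin G c0 s ep\<bar> + \<bar>L2_inner G r s\<bar>"
      using L.nonneg[OF sL] by linarith
    also have "\<bar>bilin G c0 s ep\<bar> \<le> (sqrt C * H.norm_of s) * (sqrt C * H.norm_of ep)"
      using A.Cauchy_Schwarz[OF sH eH(2)] mult_mono[OF energy_le[OF sH] energy_le[OF eH(2)]]
        A.norm_of_nonneg[OF eH(2)] H.norm_of_nonneg[OF sH] C by fastforce
    also have "\<dots> = H.norm_of s * (C * H.norm_of ep)" using C by simp
    also have "\<bar>L2_inner G r s\<bar> \<le> (ritz_const * H.norm_of ey) * H.norm_of s"
    proof -
      have "\<bar>L2_inner G r s\<bar> \<le> L.norm_of r * L.norm_of s" by (rule L.Cauchy_Schwarz[OF rL sL])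
      also have "\<dots> \<le> H.norm_of r * H.norm_of s"
        by (intro mult_mono L2_le_H1 rH sH L.norm_of_nonneg sL H.norm_of_nonneg)
      also have "\<dots> \<le> (ritz_const * H.norm_of ey) * H.norm_of s"
        by (intro mult_right_mono rN H.norm_of_nonneg sH)
      finally show ?thesis .
    qed
    also have "H.norm_of s * (C * H.norm_of ep) + (ritz_const * H.norm_of ey) * H.norm_of s = H.norm_of s * (C * H.norm_of ep + ritz_const * H.norm_of ey)"
      by (simp add: algebra_simps)
    also have "\<dots> \<le> lift_const * D * (C * H.norm_of ep + ritz_const * H.norm_of ey)"
      using C const_pos H.norm_of_nonneg[OF eH(1)] H.norm_of_nonneg[OF eH(2)]
      by (intro mult_right_mono sN add_nonneg_nonneg mult_nonneg_nonneg) auto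
    finally show ?thesis by simp
  qed
  define X where "X = H.norm_of ey + H.norm_of ep"
  have N0: "0 \<le> H.norm_of ey" "0 \<le> H.norm_of ep" using H.norm_of_nonneg eH by auto
  have "C * H.norm_of ep + ritz_const * H.norm_of ey \<le> (C + ritz_const) * X"
    using C const_pos N0 by (simp add: X_def algebra_simps)
  then have "lift_const * D * (C * H.norm_of ep + ritz_const * H.norm_of ey) \<le> lift_const * D * ((C + ritz_const) * X)"
    using const_pos D0 by (intro mult_left_mono) auto
  with main have "\<beta> * D\<^sup>2 \<le> D * (lift_const * ((C + ritz_const) * X))" by (simp add: mult.assoc mult.left_commute)
  then have "D * (\<beta> * D) \<le> D * (lift_const * ((C + ritz_const) * X))" by (simp add: power2_eq_square mult.left_commute)
  then have "\<beta> * D \<le> lift_const * ((C + ritz_const) * X)"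
    using D0 const_pos C N0 by (cases "D = 0") (auto simp: X_def)
  then have DX: "D \<le> lift_const / \<beta> * (C + ritz_const) * X" using \<beta> by (simp add: field_simps)
  have "comb y (-1) yh = comb r 1 s" by (simp add: r_def comb_def)
  then have "H.norm_of (comb y (-1) yh) \<le> H.norm_of r + H.norm_of s" using H.triangle[OF rH sH, of 1] by simp
  also have "\<dots> \<le> ritz_const * X + lift_const * D"
  proof -
    have "ritz_const * H.norm_of ey \<le> ritz_const * X" using const_pos N0 by (intro mult_left_mono) (auto simp: X_def)
    then show ?thesis using rN sN by linarith
  qed
  finally have "D + H.norm_of (comb y (-1) yh) \<le> (1 + lift_const) * D + ritz_const * X" by (simp add: algebra_simps)
  also have "\<dots> \<le> (1 + lift_const) * (lift_const / \<beta> * (C + ritz_const) * X) + ritz_const * X"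
    using DX const_pos by (intro add_right_mono mult_left_mono) auto
  also have "\<dots> = total_const * X" by (simp add: total_const_def algebra_simps)
  finally show ?thesis by (simp add: D_def X_def ey_def ep_def Iy_def Ip_def)
qed

lemma error_estimate:
  assumes n: "\<forall>e\<in>edges G. 1 \<le> n e" and f: "f \<in> L2_graph G" and ybar: "ybar \<in> L2_graph G"
    and P: "solves_P G VD c0 \<beta> f ybar u y" and Ph: "solves_Ph G VD c0 \<beta> f ybar n uh yh"
    and p: "is_adjoint G VD c0 ybar y p"
  shows "L2_set (\<lambda>v. u v - uh v) VD + H1_norm G (gdiff y yh)
    \<le> total_const * sqrt (1 + (\<Sum>e\<in>edges G. (len G e)\<^sup>2)) * mesh_size G n * (H2_seminorm G y + H2_seminorm G p)"
proof -
  have y: "y \<in> H1_graph G" "\<And>w. w \<in> H1D_graph G VD \<Longrightarrow> bilin G c0 y w = L2_inner G f w"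
    using P by (auto simp: solves_P_def optimal_def feasible_def)
  have yh: "yh \<in> H1_graph G"
    using Ph Vh_H1[OF G n] by (auto simp: solves_Ph_def optimal_def feasible_def)
  have pD: "p \<in> H1D_graph G VD" "\<And>w. w \<in> H1D_graph G VD \<Longrightarrow> bilin G c0 p w = L2_inner G (gdiff y ybar) w"
    using p bilin_sym[of G c0 p] by (auto simp: is_adjoint_def)
  have dL: "gdiff y ybar \<in> L2_graph G"
    unfolding gdiff_eq_comb by (intro comb_L2_graph H1_graph_L2[OF G] y ybar)
  let ?K = "sqrt (1 + (\<Sum>e\<in>edges G. (len G e)\<^sup>2))"
  have "H1_norm G (gdiff y yh) = H.norm_of (comb y (-1) yh)"
    unfolding gdiff_eq_comb H.norm_of_def by (intro H1_norm_eq[OF G] comb_H1_graph[OF G] y yh)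
  then have "L2_set (\<lambda>v. u v - uh v) VD + H1_norm G (gdiff y yh)
      \<le> total_const * (H.norm_of (comb y (-1) (ginterp G n y)) + H.norm_of (comb p (-1) (ginterp G n p)))"
    using error_le_interpolation_errors[OF n ybar P Ph p] by simp
  also have "\<dots> \<le> total_const * (?K * mesh_size G n * H2_seminorm G y + ?K * mesh_size G n * H2_seminorm G p)"
    unfolding H.norm_of_def using const_pos y pD(1)
      weak_solution_regular[OF G c0 y(1) f y(2)] weak_solution_regular[OF G c0 H1D_H1[OF pD(1)] dL pD(2)]
    by (intro mult_left_mono add_mono ginterp_error[OF G n]) (auto simp: H1D_H1)
  finally show ?thesis by (simp add: algebra_simps)
qed

end

theorem theorem3p6:
  fixes G :: "('v, 'e) mgraph" and VK VD :: "'v set" and c0 :: "'e \<Rightarrow> real \<Rightarrow> real" and \<beta> :: real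
  assumes "metric_graph G"
    and "verts G = VK \<union> VD" and "VK \<inter> VD = {}"
    and "c0 \<in> Linf_graph G"
    and "\<forall>e\<in>edges G. AE x in lebesgue_on {0<..<len G e}. 0 \<le> c0 e x"
    and "coercive_on G (H1D_graph G VD) (bilin G c0)"
    and "0 < \<beta>"
  shows "\<exists>c>0. \<forall>n f ybar u y uh yh p.
      (\<forall>e\<in>edges G. 1 \<le> n e) \<longrightarrow>
      f \<in> L2_graph G \<longrightarrow> ybar \<in> L2_graph G \<longrightarrow>
      solves_P G VD c0 \<beta> f ybar u y \<longrightarrow>
      solves_Ph G VD c0 \<beta> f ybar n uh yh \<longrightarrow>
      is_adjoint G VD c0 ybar y p \<longrightarrow>
      L2_set (\<lambda>v. u v - uh v) VD + H1_norm G (gdiff y yh)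
        \<le> c * mesh_size G n * (H2_seminorm G y + H2_seminorm G p)"
proof -
  note G = assms(1) and c0 = assms(4) and nn = assms(5) and \<beta> = assms(7)
  have VD: "VD \<subseteq> verts G" using assms(2) by blast
  obtain \<alpha> where \<alpha>0: "0 < \<alpha>" and co: "\<And>w. w \<in> H1D_graph G VD \<Longrightarrow> \<alpha> * (H1_norm G w)\<^sup>2 \<le> bilin G c0 w w"
    using assms(6) by (auto simp: coercive_on_def)
  have \<alpha>: "\<alpha> * H1_inner G w w \<le> bilin G c0 w w" if w: "w \<in> H1D_graph G VD" for w
  proof -
    have wH: "w \<in> H1_graph G" using w by (simp add: H1D_graph_def)
    have "(H1_norm G w)\<^sup>2 = H1_inner G w w"
      using H1_norm_eq[OF G wH] semi_inner.nonneg[OF semi_inner_H1[OF G] wH] by simp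
    then show ?thesis using co[OF w] by simp
  qed
  obtain C where C: "1 \<le> C" "\<And>y. y \<in> H1_graph G \<Longrightarrow> bilin G c0 y y \<le> C * H1_inner G y y"
    using bilin_le_H1_inner[OF G c0] by blast
  have K: "1 \<le> sqrt (1 + (\<Sum>e\<in>edges G. (len G e)\<^sup>2))" by (simp add: sum_nonneg)
  show ?thesis
  proof (intro exI conjI allI impI)
    show "0 < total_const G \<alpha> C \<beta> * sqrt (1 + (\<Sum>e\<in>edges G. (len G e)\<^sup>2))"
      using const_pos(3)[OF G VD c0 nn \<alpha>0 \<alpha> C \<beta>] K by (intro mult_pos_pos) auto
  qed (rule error_estimate[OF G VD c0 nn \<alpha>0 \<alpha> C \<beta>])
qed

end
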